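(* Let $q=p^e$ be a fixed prime power and $k>0$ a fixed integer. There is a constant $C>0$ depending only on $q$ and $k$ such that the following holds. Let $(m_j,n_{1,j},n_{2,j},g_j,N_j)$ be a sequence where $m_j,n_{1,j},n_{2,j}$ are positive integers with $n_{1,j},n_{2,j}\ge q$, $$m_j\ge C\log_q n_{1,j}\,\log_q\log_q n_{1,j}\quad\text{and}\quad m_j-p\left(\log_q n_{2,j}-\log_q\log_q n_{2,j}+2k\log_q\log_q n_{1,j}\right)\to\infty,$$ $g_j\in\mathbb{F}_q[t,x]$ is square-free with $\deg_x g_j\le k$ and $\deg_t g_j\le n_{1,j}$, and $N_j\in\mathbb{F}_q[t]$ has degree $n_{2,j}$. Let $I(N_j,m_j)=\{N_j+a: a\in\mathbb{F}_q[t],\ \deg a<m_j\}$. Then, as $j\to\infty$, $$\#\{b\in I(N_j,m_j): g_j(b)\text{ is square-free}\}=c_{g_j}\,q^{m_j}\,(1+o(1)).$$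
   Context: $\mathbb{F}_q[t]$ is the polynomial ring over the finite field with $q$ elements; $\deg 0<m$ for every $m$. A polynomial in $\mathbb{F}_q[t]$ (resp. $\mathbb{F}_q[t,x]$) is square-free if it is nonzero and not divisible by the square of any non-constant polynomial. For $g\in\mathbb{F}_q[t,x]$ and $b\in\mathbb{F}_q[t]$, $g(b)=g(t,b(t))$. $\mathcal{P}$ denotes the set of monic irreducible polynomials in $\mathbb{F}_q[t]$; for nonzero $D$, $\|D\|=q^{\deg D}$ and $\rho_g(D)=\#\{a\bmod D: g(a)\equiv0\pmod D\}$; $c_g=\prod_{P\in\mathcal{P}}\left(1-\frac{\rho_g(P^2)}{\|P\|^2}\right)$. *)

theory Defs
  imports
    Complex_Main
    "HOL-Library.Cardinality"
    "HOL-Computational_Algebra.Polynomial"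
    "HOL-Computational_Algebra.Squarefree"
begin

text \<open>
  The field with $q$ elements is a type \<open>'a :: {field,finite}\<close> with \<open>CARD('a) = q\<close>.
  Elements of $F_q[t]$ have type \<open>'a poly\<close>; those of $F_q[t,x] = F_q[t][x]$ have type
  \<open>'a poly poly\<close>, the outer variable being $x$. So \<open>degree g\<close> is $\deg_x g$, and
  \<open>poly g b\<close> is $g(b) = g(t,b(t))$.
\<close>

definition deg_t :: "'a::zero poly poly \<Rightarrow> nat" where
  "deg_t g = Max (range (\<lambda>i. degree (coeff g i)))"

lemma finite_range_degree_coeff: "finite (range (\<lambda>i. degree (coeff g i)))"
proof -
  have "range (\<lambda>i. degree (coeff g i)) \<subseteq> insert 0 ((\<lambda>i. degree (coeff g i)) ` {..degree g})"
    by (auto simp: image_iff) (metis atMost_iff coeff_eq_0 degree_0 not_le)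
  then show ?thesis
    by (rule finite_subset) simp
qed

lemma deg_t_le_iff: "deg_t g \<le> n \<longleftrightarrow> (\<forall>i. degree (coeff g i) \<le> n)"
  unfolding deg_t_def using finite_range_degree_coeff[of g] by (subst Max_le_iff) auto

text \<open>
  The library constant \<^const>\<open>squarefree\<close> asks that every square divisor is the square of a unit.
  The units of $F_q[t]$ and of $F_q[t,x]$ are the nonzero constants; in particular, in $F_q[t,x]$
  a non-constant polynomial in $t$ alone is not a unit.
\<close>

lemma squarefree_poly_iff:
  fixes f :: "'a::field poly"
  shows "squarefree f \<longleftrightarrow> f \<noteq> 0 \<and> (\<forall>h. h ^ 2 dvd f \<longrightarrow> degree h = 0)"
proof (intro iffI conjI allI impI; (elim conjE)?)
  assume "squarefree f"
  then show "f \<noteq> 0" by auto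
next
  fix h assume "squarefree f" "h ^ 2 dvd f"
  then have "h dvd 1" by (rule squarefreeD)
  then show "degree h = 0" by (metis is_unit_iff_degree not_is_unit_0)
next
  assume "f \<noteq> 0" and *: "\<forall>h. h ^ 2 dvd f \<longrightarrow> degree h = 0"
  show "squarefree f"
  proof (rule squarefreeI)
    fix h assume "h ^ 2 dvd f"
    with * \<open>f \<noteq> 0\<close> show "h dvd 1"
      by (metis is_unit_iff_degree zero_power2 dvd_0_left)
  qed
qed

lemma squarefree_poly_poly_iff:
  fixes g :: "'a::field poly poly"
  shows "squarefree g \<longleftrightarrow> g \<noteq> 0 \<and> (\<forall>h. h ^ 2 dvd g \<longrightarrow> degree h = 0 \<and> deg_t h = 0)"
proof -
  have unit: "h dvd 1 \<longleftrightarrow> degree h = 0 \<and> deg_t h = 0" if "h \<noteq> 0" for h :: "'a poly poly"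
  proof
    assume "h dvd 1"
    then obtain c where c: "h = [:c:]" "c dvd 1"
      by (auto simp: is_unit_poly_iff)
    then have "degree c = 0"
      by (metis is_unit_iff_degree not_is_unit_0)
    with c show "degree h = 0 \<and> deg_t h = 0"
      using deg_t_le_iff[of h 0] by (auto simp: coeff_pCons split: nat.splits)
  next
    assume *: "degree h = 0 \<and> deg_t h = 0"
    then obtain c where c: "h = [:c:]" using degree_eq_zeroE by blast
    have "degree c = 0" using deg_t_le_iff[of h 0] * c by (metis coeff_pCons_0 le_zero_eq)
    moreover have "c \<noteq> 0" using c that by auto
    ultimately have "c dvd 1" using is_unit_iff_degree by blast
    then show "h dvd 1" using c is_unit_poly_iff by blast
  qed
  show ?thesis
  proof (intro iffI conjI allI impI; (elim conjE)?)
    assume "squarefree g"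
    then show "g \<noteq> 0" by auto
  next
    fix h assume "squarefree g" "h ^ 2 dvd g"
    then have "h dvd 1" "h \<noteq> 0" by (auto dest: squarefreeD)
    then show "degree h = 0" "deg_t h = 0" using unit by auto
  next
    assume "g \<noteq> 0" and *: "\<forall>h. h ^ 2 dvd g \<longrightarrow> degree h = 0 \<and> deg_t h = 0"
    show "squarefree g"
    proof (rule squarefreeI)
      fix h assume "h ^ 2 dvd g"
      with * \<open>g \<noteq> 0\<close> show "h dvd 1"
        by (metis unit zero_power2 dvd_0_left)
    qed
  qed
qed

definition monic_irreducibles :: "'a::{field,finite} poly set" where
  "monic_irreducibles = {P. lead_coeff P = 1 \<and> irreducible P}"

definition poly_norm :: "'a::{field,finite} poly \<Rightarrow> real" where
  "poly_norm D = real CARD('a) ^ degree D"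

text \<open>Residue classes modulo \<open>D\<close> are represented by remainders.\<close>

definition rho :: "'a::{field,finite} poly poly \<Rightarrow> 'a poly \<Rightarrow> nat" where
  "rho g D = card ((\<lambda>a. a mod D) ` {a. D dvd poly g a})"

text \<open>
  The product over all monic irreducibles is the limit of its finite subproducts along the net of
  finite subsets. All factors lie in $[0,1]$, so this limit always exists and no order of the
  factors has to be chosen. It is 0 if a factor vanishes.
\<close>

definition c_const :: "'a::{field,finite} poly poly \<Rightarrow> real" where
  "c_const g = Lim (finite_subsets_at_top monic_irreducibles)
     (\<lambda>F. \<Prod>P\<in>F. 1 - real (rho g (P ^ 2)) / poly_norm P ^ 2)"

lemma rho_le_norm:
  fixes D :: "'a::{field,finite} poly"
  assumes "D \<noteq> 0"
  shows "real (rho g D) \<le> poly_norm D"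
proof -
  define L where "L = {xs :: 'a list. set xs \<subseteq> UNIV \<and> length xs = degree D}"
  have fin: "finite L" and card: "card L = CARD('a) ^ degree D"
    unfolding L_def by (rule finite_lists_length_eq, simp) (rule card_lists_length_eq, simp)
  have "(\<lambda>a. a mod D) ` {a. D dvd poly g a} \<subseteq> Poly ` L"
  proof safe
    fix a
    let ?r = "a mod D"
    let ?xs = "map (coeff ?r) [0..<degree D]"
    have "coeff ?r n = 0" if "n \<ge> degree D" for n
      proof (cases "?r = 0")
      case False
      then show ?thesis using degree_mod_less[OF assms, of a] that by (intro coeff_eq_0) auto
    qed simp
    then have "?r = Poly ?xs"
      by (intro poly_eqI) (auto simp: coeff_Poly_eq nth_default_def)
    moreover have "?xs \<in> L" by (simp add: L_def)
    ultimately show "?r \<in> Poly ` L" by blast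
  qed
  then have "rho g D \<le> card (Poly ` L)"
    unfolding rho_def using fin by (intro card_mono) auto
  also have "\<dots> \<le> CARD('a) ^ degree D"
    using card_image_le[OF fin, of Poly] card by simp
  finally show ?thesis
    unfolding poly_norm_def by (metis of_nat_le_iff of_nat_power)
qed

lemma c_const_tendsto:
  "((\<lambda>F. \<Prod>P\<in>F. 1 - real (rho g (P ^ 2)) / poly_norm P ^ 2) \<longlongrightarrow> c_const g)
     (finite_subsets_at_top monic_irreducibles)"
proof -
  define M :: "'a poly set" where "M = monic_irreducibles"
  define f where "f = (\<lambda>P. 1 - real (rho g (P ^ 2)) / poly_norm P ^ 2)"
  have f: "0 \<le> f P" "f P \<le> 1" if "P \<in> M" for P
  proof -
    have "P \<noteq> 0" using that by (auto simp: M_def monic_irreducibles_def)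
    then have "real (rho g (P ^ 2)) \<le> poly_norm P ^ 2"
      using rho_le_norm[of "P ^ 2" g]
      by (simp add: poly_norm_def degree_power_eq power_mult mult.commute)
    moreover have "poly_norm P > 0" by (simp add: poly_norm_def)
    ultimately show "0 \<le> f P" "f P \<le> 1" by (simp_all add: f_def)
  qed
  define S where "S = {F. finite F \<and> F \<subseteq> M}"
  have bdd: "bdd_below (prod f ` S)"
    by (rule bdd_belowI[of _ 0]) (auto simp: S_def intro!: prod_nonneg f)
  have ne: "S \<noteq> {}" by (auto simp: S_def)
  have "(prod f \<longlongrightarrow> (INF F\<in>S. prod f F)) (finite_subsets_at_top M)"
  proof (rule decreasing_tendsto)
    show "\<forall>\<^sub>F F in finite_subsets_at_top M. (INF F\<in>S. prod f F) \<le> prod f F"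
      unfolding eventually_finite_subsets_at_top
      by (rule exI[of _ "{}"]) (auto simp: S_def[symmetric] intro!: cINF_lower bdd, auto simp: S_def)
  next
    fix x assume "(INF F\<in>S. prod f F) < x"
    then obtain F0 where F0: "F0 \<in> S" "prod f F0 < x"
      using cINF_less_iff[OF ne bdd] by blast
    show "\<forall>\<^sub>F F in finite_subsets_at_top M. prod f F < x"
      unfolding eventually_finite_subsets_at_top
    proof (intro exI[of _ F0] conjI allI impI)
      fix F assume F: "finite F \<and> F0 \<subseteq> F \<and> F \<subseteq> M"
      have "prod f F = prod f (F - F0) * prod f F0"
        using F by (intro prod.subset_diff) auto
      also have "\<dots> \<le> 1 * prod f F0"
        using F F0 f by (intro mult_right_mono prod_le_1 prod_nonneg) (auto simp: S_def subset_iff)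
      finally show "prod f F < x" using F0 by simp
    qed (use F0 in \<open>auto simp: S_def\<close>)
  qed
  moreover from this have "c_const g = (INF F\<in>S. prod f F)"
    unfolding c_const_def M_def f_def by (intro tendsto_Lim) auto
  ultimately show ?thesis by (simp add: M_def f_def)
qed

text \<open>The disjunct \<open>a = 0\<close> encodes the convention $\deg 0 < m$.\<close>

definition short_interval :: "'a::{field,finite} poly \<Rightarrow> nat \<Rightarrow> 'a poly set" where
  "short_interval N m = {N + a | a. a = 0 \<or> degree a < m}"

end

theory Submission
  imports Defs "Berlekamp_Zassenhaus.Unique_Factorization_Poly"
begin

text \<open>
  Let \<open>x_P = \<rho>_g(P^2) / \<parallel>P\<parallel>^2\<close> and \<open>L = log_q n_1\<close>. The conditions \<open>P^2 dvd g(b)\<close> are sieved by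
  the degree of \<open>P\<close>.

  Small \<open>P\<close>, of degree at most \<open>w\<close> with \<open>w\<close> of order \<open>L\<close>: Brun's pure sieve truncated at level
  \<open>r\<close> of order \<open>log L\<close>; residue classes modulo \<open>D\<close> are equidistributed in the interval as soon as
  \<open>deg D \<le> m\<close>, which is why \<open>m\<close> must exceed \<open>L log L\<close>.

  Medium \<open>P\<close>, of degree below \<open>s = ceiling (m / p)\<close>: a union bound. One has \<open>x_P \<le> k / \<parallel>P\<parallel>^2\<close> unless
  the curve \<open>g = 0\<close> has a singular point above \<open>P\<close>, and \<open>x_P \<le> k / \<parallel>P\<parallel>\<close> always. The singular \<open>P\<close> divide
  a nonzero polynomial of degree \<open>O(n_1)\<close>, obtained by eliminating \<open>x\<close> from \<open>g\<close> and
  \<open>g_t + u g_x\<close>; these are coprime over \<open>F_q(t)\<close> for all but \<open>k\<close> polynomials \<open>u\<close>.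

  Large \<open>P\<close>: if \<open>P^2 dvd g(b)\<close> then \<open>P\<close> divides \<open>g(b)\<close> and its derivative
  \<open>g_t(b) + b' g_x(b)\<close>. Split the interval into the fibres of \<open>b \<mapsto> b'\<close>, that is, into cosets
  of the \<open>p\<close>-th powers. On all but \<open>k\<close> fibres, elimination leaves few candidates \<open>P\<close>, and each
  accounts for at most \<open>k\<close> elements, since \<open>deg P\<close> exceeds the degrees of the \<open>p\<close>-th roots.

  By a bound of Mertens' type, \<open>\<Sum> x_P \<le> k log L + O(1)\<close>, so that \<open>c_g\<close> is either \<open>0\<close> (with a vanishing
  factor, and then no value is square-free) or at least a constant times \<open>L^(-2k)\<close>; all error
  terms are smaller than that.
\<close>

subsection \<open>The total derivative\<close>

lemma prime_CHAR_finite_field: "prime CHAR('a::{field,finite})"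
  by (intro prime_CHAR_semidom finite_imp_CHAR_pos) simp

text \<open>The Frobenius map is additive with trivial kernel, hence injective, and an injective map
  of a finite set to itself is onto.\<close>

lemma finite_field_pth_root: "\<exists>y. y ^ CHAR('a) = (x::'a::{field,finite})"
proof -
  have "inj (\<lambda>y::'a. y ^ CHAR('a))"
  proof (rule injI)
    fix y z :: 'a
    assume eq: "y ^ CHAR('a) = z ^ CHAR('a)"
    have "((y - z) + z) ^ CHAR('a) = (y - z) ^ CHAR('a) + z ^ CHAR('a)"
      by (rule freshmans_dream) (auto simp: prime_CHAR_finite_field)
    with eq have "(y - z) ^ CHAR('a) = 0" by simp
    then show "y = z" by simp
  qed
  then have "surj (\<lambda>y::'a. y ^ CHAR('a))" by (intro finite_UNIV_inj_surj) auto
  then show ?thesis by (metis surjD)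
qed

text \<open>A vanishing derivative leaves only exponents divisible by \<open>p\<close>, and the
  termwise \<open>p\<close>-th roots add up because Frobenius is additive. The condition on
  coefficients lets this apply over \<open>F_q\<close>, where Frobenius is onto, and then over
  \<open>F_q[t]\<close>, where it is not.\<close>

lemma poly_eq_pth_power:
  fixes f :: "'b::idom poly"
  assumes "prime CHAR('b)" "pderiv f = 0" "\<And>i. \<exists>c. coeff f i = c ^ CHAR('b)"
  shows "\<exists>h. f = h ^ CHAR('b)"
proof -
  let ?p = "CHAR('b)"
  obtain c where c: "\<And>i. coeff f i = c i ^ ?p" using assms(3) by metis
  define h where "h = (\<Sum>i\<le>degree f. if ?p dvd i then monom (c i) (i div ?p) else 0)"
  have p0: "?p > 0" using assms(1) prime_gt_0_nat by blast
  have "h ^ ?p = (\<Sum>i\<le>degree f. (if ?p dvd i then monom (c i) (i div ?p) else 0) ^ ?p)"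
    unfolding h_def by (rule freshmans_dream_sum) (use assms(1) in auto)
  also have "\<dots> = (\<Sum>i\<le>degree f. monom (coeff f i) i)"
  proof (rule sum.cong)
    fix i
    show "(if ?p dvd i then monom (c i) (i div ?p) else 0) ^ ?p = monom (coeff f i) i"
    proof (cases "?p dvd i")
      case True
      then show ?thesis by (simp add: monom_power c)
    next
      case False
      then obtain n where n: "i = Suc n" by (cases i) auto
      have "of_nat i * coeff f i = 0"
        using assms(2) coeff_pderiv[of f n] unfolding n by simp
      moreover have "of_nat i \<noteq> (0::'b)" using False of_nat_eq_0_iff_char_dvd by blast
      ultimately have "coeff f i = 0" by (metis mult_eq_0_iff)
      with False p0 show ?thesis by simp
    qed
  qed simp
  also have "\<dots> = f" by (rule poly_as_sum_of_monoms)
  finally show ?thesis by metis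
qed

lemma poly_eq_pth_power_finite_field:
  fixes f :: "'a::{field,finite} poly"
  assumes "pderiv f = 0"
  shows "\<exists>h. f = h ^ CHAR('a)"
  using poly_eq_pth_power[OF prime_CHAR_finite_field assms] finite_field_pth_root by metis

text \<open>If \<open>u\<close> is the derivative of \<open>b\<close>, this is the polynomial whose value at \<open>b\<close> is the
  derivative of \<open>g(b)\<close>.\<close>

definition total_deriv :: "'a::idom poly poly \<Rightarrow> 'a poly \<Rightarrow> 'a poly poly" where
  "total_deriv g u = map_poly pderiv g + smult u (pderiv g)"

lemma coeff_map_poly_pderiv [simp]:
  "coeff (map_poly pderiv g) i = pderiv (coeff g i)"
  by (simp add: coeff_map_poly)

lemma map_poly_pderiv_mult:
  fixes f g :: "'a::idom poly poly"
  shows "map_poly pderiv (f * g) = map_poly pderiv f * g + f * map_poly pderiv g"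
  by (rule poly_eqI) (simp add: coeff_mult pderiv_sum pderiv_mult sum.distrib add.commute mult.commute[of _ "pderiv _"])

lemma total_deriv_mult:
  "total_deriv (f * g) u = total_deriv f u * g + f * total_deriv g u"
  by (simp add: total_deriv_def map_poly_pderiv_mult pderiv_mult algebra_simps smult_add_right)

lemma pderiv_poly_eq_total_deriv:
  fixes g :: "'a::idom poly poly"
  shows "pderiv (poly g b) = poly (total_deriv g (pderiv b)) b"
  unfolding total_deriv_def
  by (induction g) (simp_all add: map_poly_pCons pderiv_mult pderiv_add pderiv_pCons algebra_simps)

lemma degree_total_deriv_le: "degree (total_deriv g u) \<le> degree g"
proof (rule degree_le, intro allI impI)
  fix i assume "degree g < i"
  then show "coeff (total_deriv g u) i = 0"
    by (simp add: total_deriv_def coeff_pderiv coeff_eq_0)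
qed

lemma degree_pderiv_le: "degree (pderiv (f::'a::idom poly)) \<le> degree f"
  by (rule degree_le) (auto simp: coeff_pderiv coeff_eq_0)

lemma degree_coeff_total_deriv_le:
  assumes "\<And>i. degree (coeff g i) \<le> n"
  shows "degree (coeff (total_deriv g u) i) \<le> n + degree u"
proof -
  have 1: "degree (pderiv (coeff g i)) \<le> n"
    using degree_pderiv_le[of "coeff g i"] assms[of i] by linarith
  have "degree (u * coeff (pderiv g) i) \<le> degree u + degree (coeff (pderiv g) i)"
    by (rule degree_mult_le)
  moreover have "degree (coeff (pderiv g) i) \<le> n"
    using assms[of "Suc i"]
      degree_mult_le[of "of_nat (Suc i)" "coeff g (Suc i)"]
    by (simp add: coeff_pderiv of_nat_poly del: of_nat_Suc)
  ultimately show ?thesis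
    using 1 by (auto simp: total_deriv_def intro!: degree_add_le)
qed

text \<open>A form of the perfectness of \<open>F_q\<close>: by degrees both partial derivatives of
  \<open>f\<close> vanish, so the coefficients of \<open>f\<close> and then \<open>f\<close> itself
  are \<open>p\<close>-th powers, against irreducibility.\<close>

lemma irreducible_not_dvd_both_derivs:
  fixes f :: "'a::{field,finite} poly poly"
  assumes irr: "irreducible f" and "f dvd pderiv f" "f dvd map_poly pderiv f"
  shows "False"
proof -
  have f0: "f \<noteq> 0" using irr by auto
  have fx: "pderiv f = 0"
  proof (rule ccontr)
    assume *: "pderiv f \<noteq> 0"
    have "degree f \<noteq> 0"
    proof
      assume "degree f = 0"
      then obtain c where "f = [:c:]" by (rule degree_eq_zeroE)
      with * show False by (simp add: pderiv_pCons)
    qed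
    moreover have "coeff (pderiv f) (degree f) = 0" by (simp add: coeff_pderiv coeff_eq_0)
    moreover have "degree (pderiv f) \<le> degree f" by (rule degree_pderiv_le)
    ultimately have "degree (pderiv f) < degree f"
      using * by (metis le_neq_implies_less leading_coeff_0_iff)
    with dvd_imp_degree_le[OF assms(2) *] show False by simp
  qed
  obtain w where w: "map_poly pderiv f = f * w" using assms(3) by (elim dvdE)
  have ft: "map_poly pderiv f = 0"
  proof (rule ccontr)
    assume *: "map_poly pderiv f \<noteq> 0"
    then have w0: "w \<noteq> 0" using w by auto
    have "degree (map_poly pderiv f) \<le> degree f"
      by (rule degree_le) (auto simp: coeff_eq_0)
    then have "degree w = 0" using degree_mult_eq[OF f0 w0] w by simp
    then obtain c where c: "w = [:c:]" by (rule degree_eq_zeroE)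
    with w0 have c0: "c \<noteq> 0" by auto
    \<comment> \<open>Differentiation in \<open>t\<close> need not lower the degree in
      \<open>x\<close>, so the contradiction comes from the \<open>t\<close>-degree of the leading
      coefficient.\<close>
    define l where "l = lead_coeff f"
    have l0: "l \<noteq> 0" using f0 by (simp add: l_def)
    have "coeff (map_poly pderiv f) (degree f) = coeff (f * w) (degree f)" using w by simp
    then have e: "pderiv l = c * l" by (simp add: c l_def mult.commute)
    then have n0: "pderiv l \<noteq> 0" using c0 l0 by simp
    then have "degree l \<noteq> 0" by (metis degree_eq_zeroE pderiv_pCons pderiv_0 add_0 pCons_0_0)
    moreover have "coeff (pderiv l) (degree l) = 0" by (simp add: coeff_pderiv coeff_eq_0)
    ultimately have "degree (pderiv l) < degree l"
      using degree_pderiv_le[of l] n0 by (metis le_neq_implies_less leading_coeff_0_iff)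
    with e show False using degree_mult_eq[OF c0 l0] by simp
  qed
  have "\<exists>h. f = h ^ CHAR('a poly)"
  proof (rule poly_eq_pth_power)
    show "prime CHAR('a poly)" using prime_CHAR_finite_field[where 'a='a] by simp
    show "\<exists>c. coeff f i = c ^ CHAR('a poly)" for i
    proof -
      have "pderiv (coeff f i) = 0" using ft by (metis coeff_map_poly_pderiv coeff_0)
      then show ?thesis using poly_eq_pth_power_finite_field by simp
    qed
  qed (rule fx)
  then obtain h where h: "f = h ^ CHAR('a)" by auto
  obtain n where n: "CHAR('a) = Suc (Suc n)"
    using prime_ge_2_nat[OF prime_CHAR_finite_field[where 'a='a]] by (metis add_2_eq_Suc le_Suc_ex)
  have "f = h * h ^ Suc n" using h n by simp
  then have "h dvd 1 \<or> h ^ Suc n dvd 1" using irr irreducibleD by blast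
  then have "h dvd 1" by (metis dvd_triv_left dvd_trans power_Suc)
  then have "f dvd 1" unfolding h by (metis dvd_power_same power_one)
  with irr show False by (simp add: irreducible_not_unit)
qed

section \<open>Exceptional derivatives\<close>

lemma prime_elem_dvd_prod:
  fixes f :: "'i \<Rightarrow> 'b::idom"
  assumes "prime_elem a" "a dvd prod f I"
  shows "\<exists>i\<in>I. a dvd f i"
  using assms(2)
proof (induction I rule: infinite_finite_induct)
  case (insert x F)
  then have "a dvd f x \<or> a dvd prod f F" using prime_elem_dvd_multD[OF assms(1)] by (metis prod.insert)
  with insert show ?case by auto
qed (use assms(1) in \<open>auto simp: prime_elem_not_unit\<close>)

lemma prod_primes_dvd:
  fixes f :: "'i \<Rightarrow> 'b::idom"
  assumes "finite I" "\<And>i. i \<in> I \<Longrightarrow> prime_elem (f i)" "\<And>i. i \<in> I \<Longrightarrow> f i dvd g"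
    "\<And>i j. i \<in> I \<Longrightarrow> j \<in> I \<Longrightarrow> i \<noteq> j \<Longrightarrow> \<not> f i dvd f j"
  shows "prod f I dvd g"
  using assms
proof (induction I rule: finite_induct)
  case empty
  then show ?case by simp
next
  case (insert x F)
  then obtain e where e: "g = prod f F * e" by (meson dvdE insertCI)
  have prime: "prime_elem (f x)" using insert.prems by simp
  have "\<not> f x dvd prod f F"
  proof
    assume "f x dvd prod f F"
    then obtain i where "i \<in> F" "f x dvd f i"
      using prime_elem_dvd_prod[OF prime] by metis
    with insert.prems(3)[of x i] insert.hyps show False by auto
  qed
  moreover have "f x dvd prod f F * e" using insert.prems(2)[of x] e by simp
  ultimately have "f x dvd e" using prime_elem_dvd_multD[OF prime] by metis
  with e insert.hyps show ?case by (simp add: mult.commute mult_dvd_mono)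
qed

text \<open>For these \<open>u\<close> the elimination of \<open>x\<close> from \<open>g\<close> and
  \<open>total_deriv g u\<close> breaks down. Common factors free of \<open>x\<close> are allowed,
  since they merely divide the eliminant.\<close>

definition bad_derivs :: "'a::{field,finite} poly poly \<Rightarrow> 'a poly set" where
  "bad_derivs g = {u. \<exists>f. irreducible f \<and> degree f > 0 \<and> f dvd g \<and> f dvd total_deriv g u}"

text \<open>Write \<open>g = f * e\<close>. Since \<open>f\<close> does not divide \<open>e\<close>,
  the product rule carries the divisibility over to \<open>total_deriv f u\<close> and
  \<open>total_deriv f v\<close>. Their difference \<open>(u - v) * pderiv f\<close> then forces
  \<open>f\<close> to divide both partial derivatives.\<close>

lemma bad_derivs_unique:
  fixes g :: "'a::{field,finite} poly poly"
  assumes sf: "squarefree g" and f: "irreducible f" "degree f > 0" "f dvd g"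
    and uv: "f dvd total_deriv g u" "f dvd total_deriv g v"
  shows "u = v"
proof (rule ccontr)
  assume ne: "u \<noteq> v"
  obtain e where e: "g = f * e" using f(3) by (elim dvdE)
  have prime: "prime_elem f" using f(1) by simp
  have nd: "\<not> f dvd e"
  proof
    assume "f dvd e"
    then have "f ^ 2 dvd g" unfolding e power2_eq_square by (rule mult_dvd_mono[OF dvd_refl])
    then show False using squarefreeD[OF sf] f(1) irreducible_not_unit by blast
  qed
  have *: "f dvd total_deriv f z" if "f dvd total_deriv g z" for z
  proof -
    have "f dvd total_deriv f z * e"
      using that unfolding e total_deriv_mult by (simp add: dvd_add_left_iff)
    then show ?thesis using prime_elem_dvd_multD[OF prime] nd by metis
  qed
  have "f dvd total_deriv f u - total_deriv f v" using * uv by auto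
  also have "total_deriv f u - total_deriv f v = [:u - v:] * pderiv f"
    by (simp add: total_deriv_def smult_diff_left)
  finally have "f dvd [:u - v:] \<or> f dvd pderiv f" using prime_elem_dvd_multD[OF prime] by metis
  moreover have "\<not> f dvd [:u - v:]"
    using f(2) ne dvd_imp_degree_le[of f "[:u - v:]"] by auto
  ultimately have x: "f dvd pderiv f" by blast
  have "f dvd total_deriv f u - [:u:] * pderiv f"
    using x *[OF uv(1)] by (metis dvd_diff dvd_mult)
  then have "f dvd map_poly pderiv f" by (simp add: total_deriv_def)
  with irreducible_not_dvd_both_derivs[OF f(1) x] show False by blast
qed

text \<open>Every bad \<open>u\<close> uses up an irreducible factor of positive degree in
  \<open>x\<close>. For distinct \<open>u\<close> none of these divides another, so they multiply to
  a divisor of \<open>g\<close>.\<close>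

lemma card_bad_derivs:
  fixes g :: "'a::{field,finite} poly poly"
  assumes sf: "squarefree g"
  shows "finite (bad_derivs g)" "card (bad_derivs g) \<le> degree g"
proof -
  have g0: "g \<noteq> 0" using sf by auto
  have "\<forall>u \<in> bad_derivs g. \<exists>f. irreducible f \<and> degree f > 0 \<and> f dvd g \<and> f dvd total_deriv g u"
    by (auto simp: bad_derivs_def)
  then obtain f where f: "\<And>u. u \<in> bad_derivs g \<Longrightarrow>
      irreducible (f u) \<and> degree (f u) > 0 \<and> f u dvd g \<and> f u dvd total_deriv g u"
    by metis
  have bound: "card Y \<le> degree g" if Y: "Y \<subseteq> bad_derivs g" "finite Y" for Y
  proof -
    have "prod f Y dvd g"
    proof (rule prod_primes_dvd)
      fix u v assume uv: "u \<in> Y" "v \<in> Y" "u \<noteq> v"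
      show "\<not> f u dvd f v"
      proof
        assume "f u dvd f v"
        moreover have "u \<in> bad_derivs g" "v \<in> bad_derivs g" using uv Y by auto
        ultimately have "f u dvd total_deriv g v" using f[of v] dvd_trans by metis
        with bad_derivs_unique[OF sf, of "f u" u v] f[of u] \<open>u \<in> bad_derivs g\<close> uv(3)
        show False by metis
      qed
    qed (use Y f in auto)
    then have "degree (prod f Y) \<le> degree g" using g0 dvd_imp_degree_le by blast
    moreover have "degree (prod f Y) = (\<Sum>u\<in>Y. degree (f u))"
      using f Y by (intro degree_prod_eq_sum_degree) auto
    moreover have "card Y \<le> (\<Sum>u\<in>Y. degree (f u))"
      using f Y sum_mono[of Y "\<lambda>_. 1" "\<lambda>u. degree (f u)"] by (auto simp: Suc_le_eq)
    ultimately show ?thesis by simp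
  qed
  show "finite (bad_derivs g)" using finite_if_finite_subsets_card_bdd[of "bad_derivs g"] bound by blast
  then show "card (bad_derivs g) \<le> degree g" using bound by blast
qed

subsection \<open>Elimination of one variable\<close>

text \<open>The condition on coefficients includes \<open>0\<close> for every \<open>n\<close>, even
  \<open>n = 0\<close>, as the convention \<open>deg 0 < m\<close> demands; \<open>degree\<close>
  alone would not, since \<open>degree 0 = 0\<close>.\<close>

definition polys_below :: "nat \<Rightarrow> 'a::zero poly set" where
  "polys_below n = {r. \<forall>i\<ge>n. coeff r i = 0}"

lemma polys_below_iff: "r \<in> polys_below n \<longleftrightarrow> r = 0 \<or> degree r < n"
proof
  assume r: "r \<in> polys_below n"
  show "r = 0 \<or> degree r < n"
  proof (rule ccontr)
    assume "\<not> (r = 0 \<or> degree r < n)"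
    then have "n \<le> degree r" "lead_coeff r \<noteq> 0" by auto
    with r show False by (auto simp: polys_below_def)
  qed
qed (auto simp: polys_below_def coeff_eq_0)

lemma polys_below_Suc_iff: "r \<in> polys_below (Suc n) \<longleftrightarrow> degree r \<le> n"
  by (auto simp: polys_below_iff)

lemma polys_below_0 [simp]: "0 \<in> polys_below n"
  by (simp add: polys_below_def)

lemma polys_below_diff:
  "a \<in> polys_below n \<Longrightarrow> b \<in> polys_below n \<Longrightarrow> a - b \<in> polys_below n"
  for a :: "'a::ab_group_add poly"
  by (simp add: polys_below_def)

lemma polys_below_add:
  "a \<in> polys_below n \<Longrightarrow> b \<in> polys_below n \<Longrightarrow> a + b \<in> polys_below n"
  for a :: "'a::comm_monoid_add poly"
  by (simp add: polys_below_def)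

text \<open>The coefficient set is arbitrary so that the count covers both \<open>F_q[t]\<close> and
  the boxes in \<open>F_q[t][x]\<close> with bounded degree in \<open>t\<close>.\<close>

lemma polys_with_coeffs:
  assumes "finite S"
  shows "finite {p. p \<in> polys_below d \<and> (\<forall>i<d. coeff p i \<in> S)}"
    and "card {p. p \<in> polys_below d \<and> (\<forall>i<d. coeff p i \<in> S)} = card S ^ d"
proof -
  let ?X = "\<lambda>d. {p. p \<in> polys_below d \<and> (\<forall>i<d. coeff p i \<in> S)}"
  have "finite (?X d) \<and> card (?X d) = card S ^ d"
  proof (induction d)
    case 0
    have "?X 0 = {0}" by (auto simp: polys_below_def poly_eq_iff)
    then show ?case by (metis card.insert finite.intros card.empty empty_iff power_0 One_nat_def)
  next
    case (Suc d)
    have eq: "?X (Suc d) = (\<lambda>(c, p). pCons c p) ` (S \<times> ?X d)"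
    proof (intro equalityI subsetI)
      fix f assume f: "f \<in> ?X (Suc d)"
      obtain c p where cp: "f = pCons c p" by (cases f)
      have "coeff p i = 0" if "i \<ge> d" for i
      proof -
        have "coeff f (Suc i) = 0" using f that by (auto simp: polys_below_def)
        then show ?thesis by (simp add: cp)
      qed
      moreover have "coeff p i \<in> S" if "i < d" for i
      proof -
        have "coeff f (Suc i) \<in> S" using f that by auto
        then show ?thesis by (simp add: cp)
      qed
      moreover have "coeff f 0 \<in> S" using f by auto
      ultimately show "f \<in> (\<lambda>(c, p). pCons c p) ` (S \<times> ?X d)"
        unfolding cp by (auto simp: polys_below_def)
    qed (auto simp: polys_below_def coeff_pCons split: nat.splits)
    have inj: "inj_on (\<lambda>(c, p). pCons c p) (S \<times> ?X d)" by (auto simp: inj_on_def)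
    show ?case unfolding eq using Suc assms card_image[OF inj]
      by (simp add: card_cartesian_product)
  qed
  then show "finite (?X d)" "card (?X d) = card S ^ d" by blast+
qed

lemma card_finite_field_gt_1: "CARD('a::{field,finite}) > 1"
  using card_mono[of "UNIV :: 'a set" "{0, 1}"] by simp

lemma finite_polys_below: "finite (polys_below n :: 'a::{zero,finite} poly set)"
  and card_polys_below: "card (polys_below n :: 'a::{zero,finite} poly set) = CARD('a) ^ n"
  using polys_with_coeffs[of "UNIV :: 'a set" n] by auto

text \<open>Prime factors of positive degree are cancelled against \<open>B\<close> one at a time,
  as they cannot divide \<open>h\<close>; those of degree \<open>0\<close> do not affect the
  degrees.\<close>

lemma prod_mset_dvd_degree_le:
  fixes B h :: "'b::idom poly"
  assumes "B \<noteq> 0" "\<And>f. f \<in># F \<Longrightarrow> prime_elem f"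
    and "\<And>f. f \<in># F \<Longrightarrow> degree f > 0 \<Longrightarrow> \<not> f dvd h"
    and "prod_mset F dvd B * h"
  shows "degree (prod_mset F) \<le> degree B"
  using assms
proof (induction F arbitrary: B)
  case empty
  then show ?case by simp
next
  case (add f F)
  have prime: "prime_elem f" using add.prems by simp
  have f0: "f \<noteq> 0" using prime by (rule prime_elem_not_zeroI)
  show ?case
  proof (cases "degree f > 0")
    case False
    have "prod_mset F dvd B * h" using add.prems(4) by (metis prod_mset.add_mset dvd_mult_right)
    then have "degree (prod_mset F) \<le> degree B" using add.IH[of B] add.prems by simp
    moreover have "degree (f * prod_mset F) \<le> degree f + degree (prod_mset F)" by (rule degree_mult_le)
    ultimately show ?thesis using False by simp
  next
    case True
    have "f dvd B * h" using add.prems(4) by (metis prod_mset.add_mset dvd_mult_left)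
    moreover have "\<not> f dvd h" using True add.prems by simp
    ultimately have "f dvd B" using prime_elem_dvd_multD[OF prime] by metis
    then obtain B' where B': "B = f * B'" by (elim dvdE)
    with add.prems have B'0: "B' \<noteq> 0" by auto
    have "f * prod_mset F dvd f * (B' * h)" using add.prems(4) by (simp add: B' mult.assoc)
    then have "prod_mset F dvd B' * h" using f0 by simp
    then have "degree (prod_mset F) \<le> degree B'" using add.IH[of B'] add.prems B'0 by simp
    moreover have "degree (f * prod_mset F) \<le> degree f + degree (prod_mset F)" by (rule degree_mult_le)
    moreover have "degree B = degree f + degree B'" unfolding B' by (rule degree_mult_eq[OF f0 B'0])
    ultimately show ?thesis by simp
  qed
qed

text \<open>Only a degree bound is claimed and not \<open>g dvd B\<close>, because \<open>g\<close>
  and \<open>h\<close> may share factors in \<open>t\<close> alone.\<close>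

lemma dvd_mult_degree_le:
  fixes g B h :: "'a::field poly poly"
  assumes "g \<noteq> 0" "B \<noteq> 0" "g dvd B * h"
    and cop: "\<And>f. irreducible f \<Longrightarrow> degree f > 0 \<Longrightarrow> f dvd g \<Longrightarrow> \<not> f dvd h"
  shows "degree g \<le> degree B"
proof (cases "g dvd 1")
  case True
  then show ?thesis by (auto simp: is_unit_poly_iff)
next
  case False
  then obtain F where F: "mset_factors F g" using mset_factors_exist[OF assms(1)] by metis
  have g: "g = prod_mset F" and irr: "\<And>f. f \<in># F \<Longrightarrow> irreducible f"
    using F by (auto simp: mset_factors_def)
  have dvd: "f dvd g" if "f \<in># F" for f using that mset_factors_imp_dvd[OF F] by metis
  have "degree (prod_mset F) \<le> degree B"
    by (rule prod_mset_dvd_degree_le[where h = h]) (use irr cop dvd assms(2,3) g in auto)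
  then show ?thesis using g by simp
qed

text \<open>A pigeonhole argument on coefficients, as in Siegel's lemma, takes the place of the resultant.\<close>

lemma eliminate_variable:
  fixes g h :: "'a::{field,finite} poly poly"
  assumes g0: "g \<noteq> 0" and gk: "degree g \<le> k" and hk: "degree h \<le> k"
    and gn: "\<And>i. degree (coeff g i) \<le> n" and hn: "\<And>i. degree (coeff h i) \<le> n"
    and cop: "\<And>f. irreducible f \<Longrightarrow> degree f > 0 \<Longrightarrow> f dvd g \<Longrightarrow> \<not> f dvd h"
  shows "\<exists>R A B. R \<noteq> 0 \<and> degree R \<le> (2 * k + 1) * n \<and> [:R:] = A * g + B * h"
proof (cases "degree g = 0")
  case True
  then obtain c where c: "g = [:c:]" by (rule degree_eq_zeroE)
  then have "c \<noteq> 0" "degree c \<le> n" using g0 gn[of 0] by auto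
  then show ?thesis using c
    by (intro exI[of _ c] exI[of _ 1] exI[of _ 0]) (auto intro: le_trans[of _ n])
next
  case False
  define a b where "a = degree g" and "b = degree h"
  have a0: "a > 0" using False by (simp add: a_def)
  \<comment> \<open>As for the Sylvester matrix, \<open>A\<close> and \<open>B\<close> range over
    degrees in \<open>x\<close> below \<open>b\<close> and \<open>a\<close>, so
    \<open>A * g + B * h\<close> has degree at most \<open>d\<close> in \<open>x\<close>; the
    \<open>d\<close> coefficients at positive powers of \<open>x\<close> must be made to
    vanish.\<close>
  define d where "d = a + b - 1"
  \<comment> \<open>With this \<open>T\<close> the free coefficients over \<open>F_q\<close> number
    \<open>(T + 1) * (d + 1)\<close>, which exceeds by exactly one the
    \<open>(T + n + 1) * d\<close> conditions.\<close>
  define T where "T = d * n"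
  let ?q = "CARD('a)"
  have q: "?q > 1" by (rule card_finite_field_gt_1)
  define S1 where "S1 = (polys_below (Suc T) :: 'a poly set)"
  define S2 where "S2 = (polys_below (Suc (T + n)) :: 'a poly set)"
  define X where "X = (\<lambda>d. {p :: 'a poly poly. p \<in> polys_below d \<and> (\<forall>i<d. coeff p i \<in> S1)})"
  define Y where "Y = {p :: 'a poly poly. p \<in> polys_below d \<and> (\<forall>i<d. coeff p i \<in> S2)}"
  \<comment> \<open>The shift drops the constant term in \<open>x\<close>, so two pairs with the
    same image differ by a pair whose combination is free of \<open>x\<close>.\<close>
  define \<phi> where "\<phi> = (\<lambda>(A, B). poly_shift 1 (A * g + B * h))"
  have finS: "finite S1" "finite S2" unfolding S1_def S2_def by (rule finite_polys_below)+
  have finX: "finite (X i)" "card (X i) = card S1 ^ i" for i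
    unfolding X_def using polys_with_coeffs[OF finS(1)] by auto
  have finY: "finite Y" "card Y = card S2 ^ d"
    unfolding Y_def using polys_with_coeffs[OF finS(2)] by auto
  have coeff_deg: "degree (coeff (A * f) i) \<le> T + n"
    if "\<And>i. degree (coeff A i) \<le> T" "\<And>i. degree (coeff f i) \<le> n" for A f :: "'a poly poly" and i
  proof -
    have "degree (coeff A j * coeff f (i - j)) \<le> T + n" for j
      using degree_mult_le[of "coeff A j" "coeff f (i - j)"] that(1)[of j] that(2)[of "i - j"]
      by linarith
    then show ?thesis unfolding coeff_mult by (intro degree_sum_le) auto
  qed
  have X_deg: "degree (coeff A i) \<le> T" if "A \<in> X j" for A i j
    using that by (cases "i < j") (auto simp: X_def S1_def polys_below_Suc_iff polys_below_def[of j])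
  have \<phi>Y: "\<phi> ` (X b \<times> X a) \<subseteq> Y"
  proof (rule image_subsetI)
    fix AB assume AB: "AB \<in> X b \<times> X a"
    obtain A B where [simp]: "AB = (A, B)" by (cases AB)
    have z1: "coeff (A * g) i = 0" if "i > d" for i
    proof (cases "A = 0")
      case False
      then have "degree A < b" using AB by (auto simp: X_def polys_below_iff)
      then have "degree (A * g) < i" using that degree_mult_le[of A g] by (simp add: d_def a_def)
      then show ?thesis by (rule coeff_eq_0)
    qed simp
    have z2: "coeff (B * h) i = 0" if "i > d" for i
    proof (cases "B = 0")
      case False
      then have "degree B < a" using AB by (auto simp: X_def polys_below_iff)
      then have "degree (B * h) < i" using that degree_mult_le[of B h] by (simp add: d_def b_def)
      then show ?thesis by (rule coeff_eq_0)
    qed simp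
    have "coeff (A * g + B * h) (Suc i) = 0" if "d \<le> i" for i
      using that by (simp add: z1 z2)
    moreover have "degree (coeff (A * g + B * h) i) \<le> T + n" for i
      using coeff_deg[of A g i] coeff_deg[of B h i] X_deg[of A b] X_deg[of B a] AB gn hn
      by (auto intro!: degree_add_le)
    ultimately show "\<phi> AB \<in> Y"
      by (auto simp: \<phi>_def Y_def S2_def polys_below_Suc_iff polys_below_def[of d] coeff_poly_shift
          simp del: coeff_add)
  qed
  have "card (X b \<times> X a) = card (X b) * card (X a)" by (rule card_cartesian_product)
  also have "\<dots> = (?q ^ Suc T) ^ (a + b)"
    unfolding finX(2) S1_def card_polys_below power_add by (rule mult.commute)
  finally have "card (X b \<times> X a) = ?q ^ (Suc T * (a + b))" by (simp only: power_mult)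
  moreover have "card Y = ?q ^ (Suc (T + n) * d)"
    using finY by (simp add: S2_def card_polys_below flip: power_mult power_Suc)
  moreover have "Suc (T + n) * d < Suc T * (a + b)"
  proof -
    have "a + b = Suc d" using a0 by (simp add: d_def)
    then show ?thesis by (simp add: T_def algebra_simps)
  qed
  ultimately have "card Y < card (X b \<times> X a)" using q by (simp add: power_strict_increasing)
  then have "card (\<phi> ` (X b \<times> X a)) < card (X b \<times> X a)"
    using card_mono[OF finY(1) \<phi>Y] by linarith
  then have "\<not> inj_on \<phi> (X b \<times> X a)" by (rule pigeonhole)
  then obtain A1 B1 A2 B2 where AB: "A1 \<in> X b" "B1 \<in> X a" "A2 \<in> X b" "B2 \<in> X a"
      "(A1, B1) \<noteq> (A2, B2)" "\<phi> (A1, B1) = \<phi> (A2, B2)"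
    by (auto simp: inj_on_def)
  define A B where "A = A1 - A2" and "B = B1 - B2"
  define C where "C = A * g + B * h"
  have Ceq: "C = (A1 * g + B1 * h) - (A2 * g + B2 * h)"
    by (simp add: C_def A_def B_def algebra_simps)
  have "coeff C (Suc i) = 0" for i
  proof -
    have "coeff (A1 * g + B1 * h) (Suc i) = coeff (A2 * g + B2 * h) (Suc i)"
      using arg_cong[OF AB(6), of "\<lambda>p. coeff p i"] by (simp add: \<phi>_def coeff_poly_shift del: coeff_add)
    then show ?thesis unfolding Ceq by simp
  qed
  then have C: "C = [:coeff C 0:]"
    by (intro poly_eqI) (simp add: coeff_pCons split: nat.split)
  \<comment> \<open>If \<open>C = 0\<close>, then \<open>g dvd B * h\<close> with \<open>B\<close>
    of smaller degree in \<open>x\<close> than \<open>g\<close>, which forces \<open>B = 0\<close>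
    and \<open>A = 0\<close>, although the two pairs are distinct.\<close>
  have "C \<noteq> 0"
  proof
    assume "C = 0"
    then have *: "B * h = - A * g" by (simp add: C_def eq_neg_iff_add_eq_0 add.commute)
    have "B = 0"
    proof (rule ccontr)
      assume B0: "B \<noteq> 0"
      have "degree g \<le> degree B"
        by (rule dvd_mult_degree_le[OF g0 B0 _ cop]) (auto simp: *)
      moreover have "B \<in> polys_below a"
        unfolding B_def using AB by (intro polys_below_diff) (auto simp: X_def)
      ultimately show False using B0 by (simp add: polys_below_iff a_def)
    qed
    with * g0 have "A = 0" by simp
    with \<open>B = 0\<close> AB(5) show False by (simp add: A_def B_def)
  qed
  moreover have "degree (coeff C 0) \<le> T + n"
  proof -
    have "degree (coeff (A1 * g + B1 * h) 0) \<le> T + n" "degree (coeff (A2 * g + B2 * h) 0) \<le> T + n"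
      unfolding coeff_add by (intro degree_add_le coeff_deg X_deg AB gn hn; (rule AB)?)+
    then show ?thesis unfolding Ceq coeff_diff by (intro degree_diff_le)
  qed
  moreover have "T + n \<le> (2 * k + 1) * n"
  proof -
    have "d + 1 \<le> 2 * k + 1" using gk hk by (simp add: d_def a_def b_def)
    then have "(d + 1) * n \<le> (2 * k + 1) * n" by (rule mult_right_mono) simp
    then show ?thesis by (simp add: T_def)
  qed
  ultimately show ?thesis using C
    by (intro exI[of _ "coeff C 0"] exI[of _ A] exI[of _ B]) (auto simp: C_def)
qed

text \<open>One \<open>R\<close> serves all \<open>P\<close> and \<open>a\<close>, since the
  identity \<open>[:R:] = A * g + B * total_deriv g u\<close> can be evaluated at every
  \<open>a\<close>.\<close>

lemma singular_primes_divide: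
  fixes g :: "'a::{field,finite} poly poly"
  assumes sf: "squarefree g" and gk: "degree g \<le> k" and gn: "\<And>i. degree (coeff g i) \<le> n"
    and u: "u \<notin> bad_derivs g"
  shows "\<exists>R. R \<noteq> 0 \<and> degree R \<le> (2 * k + 1) * (n + degree u) \<and>
           (\<forall>P a. P dvd poly g a \<longrightarrow> P dvd poly (total_deriv g u) a \<longrightarrow> P dvd R)"
proof -
  have "\<exists>R A B. R \<noteq> 0 \<and> degree R \<le> (2 * k + 1) * (n + degree u) \<and>
      [:R:] = A * g + B * total_deriv g u"
  proof (rule eliminate_variable)
    show "degree (total_deriv g u) \<le> k" using degree_total_deriv_le[of g u] gk by linarith
    show "degree (coeff g i) \<le> n + degree u" for i using gn[of i] by linarith
    show "degree (coeff (total_deriv g u) i) \<le> n + degree u" for i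
      by (rule degree_coeff_total_deriv_le[OF gn])
    show "\<not> f dvd total_deriv g u" if "irreducible f" "degree f > 0" "f dvd g" for f
      using u that by (auto simp: bad_derivs_def)
  qed (use sf gk in auto)
  then obtain R A B where R: "R \<noteq> 0" "degree R \<le> (2 * k + 1) * (n + degree u)"
    and eq: "[:R:] = A * g + B * total_deriv g u" by metis
  have "P dvd R" if "P dvd poly g a" "P dvd poly (total_deriv g u) a" for P a
  proof -
    have "R = poly A a * poly g a + poly B a * poly (total_deriv g u) a"
      using arg_cong[OF eq, of "\<lambda>p. poly p a"] by simp
    then show ?thesis using that by (metis dvd_add dvd_mult)
  qed
  with R show ?thesis by metis
qed

subsection \<open>Residue classes and short intervals\<close>

lemma monic_irreducibleD:
  assumes "P \<in> monic_irreducibles"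
  shows "irreducible P" "prime_elem P" "P \<noteq> 0" "degree P > 0" "lead_coeff P = 1"
proof -
  show irr: "irreducible P" and "lead_coeff P = 1" using assms by (auto simp: monic_irreducibles_def)
  then show "prime_elem P" "P \<noteq> 0" by auto
  then show "degree P > 0" using irr is_unit_iff_degree[of P] irreducible_not_unit[of P] by auto
qed

lemma monic_irreducible_dvd_imp_eq:
  assumes P: "P \<in> monic_irreducibles" and Q: "Q \<in> monic_irreducibles" and "P dvd Q"
  shows "P = Q"
proof -
  obtain c where c: "Q = P * c" using assms(3) by (elim dvdE)
  then have "c dvd 1"
    using irreducibleD[OF monic_irreducibleD(1)[OF Q] c] monic_irreducibleD(1)[OF P]
      irreducible_not_unit by metis
  then obtain d where d: "c = [:d:]" by (metis is_unit_poly_iff)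
  have "lead_coeff Q = d" using monic_irreducibleD(5)[OF P] by (simp add: c d lead_coeff_mult)
  with monic_irreducibleD(5)[OF Q] c d show ?thesis by simp
qed

lemma exists_monic_irreducible_factor:
  fixes h :: "'a::{field,finite} poly"
  assumes "h \<noteq> 0" "\<not> h dvd 1"
  shows "\<exists>P \<in> monic_irreducibles. P dvd h"
proof -
  obtain F where F: "mset_factors F h" using mset_factors_exist[OF assms] by metis
  then have "F \<noteq> {#}" "\<forall>f. f \<in># F \<longrightarrow> irreducible f" by (auto simp: mset_factors_def)
  then obtain f where f: "f \<in># F" "irreducible f" by (metis multiset_nonemptyE)
  have dvd: "f dvd h" by (rule mset_factors_imp_dvd[OF F f(1)])
  define c where "c = inverse (lead_coeff f)"
  have c0: "c \<noteq> 0" using f(2) by (auto simp: c_def)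
  have "smult c f dvd h" using dvd c0 by (simp add: smult_dvd_iff)
  moreover have "lead_coeff (smult c f) = 1" using f(2) by (auto simp: c_def)
  moreover have "irreducible (smult c f)"
  proof -
    have "smult c f = [:c:] * f" "[:c:] dvd 1" using c0 by (auto simp: is_unit_poly_iff)
    then show ?thesis using f(2) irreducible_mult_unit_left[of "[:c:]" f] by metis
  qed
  ultimately show ?thesis unfolding monic_irreducibles_def by blast
qed

lemma not_squarefree_imp_square_dvd:
  fixes f :: "'a::{field,finite} poly"
  assumes "\<not> squarefree f"
  shows "\<exists>P \<in> monic_irreducibles. P ^ 2 dvd f"
proof (cases "f = 0")
  case True
  \<comment> \<open>Every square divides \<open>0\<close>, so any irreducible will do; one exists as
    a factor of \<open>t\<close>.\<close>
  have "[:0, 1:] \<noteq> (0::'a poly)" "\<not> [:0, 1:] dvd (1::'a poly)" by (auto simp: is_unit_iff_degree)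
  with exists_monic_irreducible_factor[of "[:0, 1 :: 'a:]"] True show ?thesis by auto
next
  case False
  then obtain h where h: "h ^ 2 dvd f" "\<not> h dvd 1" using assms by (auto simp: squarefree_def)
  with False have "h \<noteq> 0" by auto
  then obtain P where "P \<in> monic_irreducibles" "P dvd h"
    using exists_monic_irreducible_factor h(2) by blast
  then show ?thesis using h(1) dvd_power_same dvd_trans by blast
qed

lemma sum_degree_le_of_dvd:
  fixes f :: "'a::{field,finite} poly"
  assumes "finite F" "F \<subseteq> monic_irreducibles" "\<And>P. P \<in> F \<Longrightarrow> P dvd f" "f \<noteq> 0"
  shows "(\<Sum>P\<in>F. degree P) \<le> degree f"
proof -
  have "prod (\<lambda>P. P) F dvd f"
  proof (rule prod_primes_dvd)
    fix P Q assume "P \<in> F" "Q \<in> F" "P \<noteq> Q"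
    then show "\<not> P dvd Q" using assms(2) monic_irreducible_dvd_imp_eq[of P Q] by (metis subsetD)
  qed (use assms monic_irreducibleD(2) in \<open>metis subsetD\<close>)+
  moreover have "degree (prod (\<lambda>P. P) F) = (\<Sum>P\<in>F. degree P)"
  proof (rule degree_prod_eq_sum_degree)
    show "\<forall>P\<in>F. P \<noteq> 0" using assms(2) monic_irreducibleD(3) by (metis subsetD)
  qed
  ultimately show ?thesis using assms(4) dvd_imp_degree_le[of "prod (\<lambda>P. P) F" f] by simp
qed

lemma finite_irreducible_divisors:
  fixes f :: "'a::{field,finite} poly"
  assumes "f \<noteq> 0"
  shows "finite {P \<in> monic_irreducibles. P dvd f}"
proof (rule finite_subset[OF _ finite_polys_below])
  show "{P \<in> monic_irreducibles. P dvd f} \<subseteq> polys_below (Suc (degree f))"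
    using assms by (auto simp: polys_below_Suc_iff dvd_imp_degree_le)
qed

section \<open>Residue classes and equidistribution in short intervals\<close>

lemma poly_cong_dvd: "D dvd a - b \<Longrightarrow> D dvd poly g a - poly g b"
  for D :: "'a::comm_ring_1"
proof (induction g)
  case (pCons c p)
  then have "D dvd poly p a - poly p b" by simp
  then have "D dvd (a - b) * poly p a + b * (poly p a - poly p b)"
    using pCons.prems by (intro dvd_add dvd_mult2 dvd_mult)
  then show ?case by (simp add: algebra_simps)
qed simp

lemma dvd_poly_mod_iff: "D dvd poly g (a mod D) \<longleftrightarrow> D dvd poly g a"
  for D :: "'a::field poly"
proof -
  have "D dvd a - a mod D" by (simp add: minus_mod_eq_mult_div)
  then have "D dvd poly g a - poly g (a mod D)" by (rule poly_cong_dvd)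
  then show ?thesis by (metis dvd_diff_commute dvd_add_right_iff diff_add_cancel)
qed

lemma mod_in_polys_below: "D \<noteq> 0 \<Longrightarrow> a mod D \<in> polys_below (degree D)"
  for D :: "'a::field poly"
  using degree_mod_less[of D a] by (auto simp: polys_below_iff)

lemma mod_polys_below: "r \<in> polys_below (degree D) \<Longrightarrow> r mod D = r"
  for D :: "'a::field poly"
  by (auto simp: polys_below_iff mod_poly_less)

lemma rho_eq_card:
  fixes D :: "'a::{field,finite} poly"
  assumes "D \<noteq> 0"
  shows "rho g D = card {r \<in> polys_below (degree D). D dvd poly g r}"
proof -
  have "(\<lambda>a. a mod D) ` {a. D dvd poly g a} = {r \<in> polys_below (degree D). D dvd poly g r}"
  proof (intro equalityI subsetI)
    fix r assume "r \<in> {r \<in> polys_below (degree D). D dvd poly g r}"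
    then show "r \<in> (\<lambda>a. a mod D) ` {a. D dvd poly g a}"
      by (intro image_eqI[of _ _ r]) (auto simp: mod_polys_below)
  qed (use assms in \<open>auto simp: mod_in_polys_below dvd_poly_mod_iff\<close>)
  then show ?thesis by (simp add: rho_def)
qed

lemma short_interval_iff: "b \<in> short_interval N m \<longleftrightarrow> b - N \<in> polys_below m"
  unfolding short_interval_def polys_below_iff[symmetric] by force

lemma short_interval_eq: "short_interval N m = (+) N ` polys_below m"
  unfolding short_interval_def polys_below_iff[symmetric] by auto

lemma finite_short_interval: "finite (short_interval N m)"
  by (simp add: short_interval_eq finite_polys_below)

lemma card_short_interval:
  fixes N :: "'a::{field,finite} poly"
  shows "card (short_interval N m) = CARD('a) ^ m"
  unfolding short_interval_eq by (subst card_image) (auto simp: card_polys_below)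

text \<open>Dividing \<open>b - N\<close> by \<open>D\<close> identifies the interval with all pairs
  of a remainder and a quotient of degree below \<open>m - degree D\<close>; hence every class is
  met equally often, without error term.\<close>

lemma card_short_interval_mod:
  fixes D N :: "'a::{field,finite} poly"
  assumes D: "D \<noteq> 0" "degree D \<le> m" and S: "S \<subseteq> polys_below (degree D)"
  shows "card {b \<in> short_interval N m. b mod D \<in> S} = card S * CARD('a) ^ (m - degree D)"
proof -
  define d where "d = degree D"
  \<comment> \<open>The element with residue \<open>r\<close> modulo \<open>D\<close> whose
    difference from \<open>N\<close> has quotient \<open>c\<close>.\<close>
  define f where "f = (\<lambda>(r, c). N + ((r - N) mod D + D * c))"
  have D_mult: "D * c \<in> polys_below m" if "c \<in> polys_below (m - d)" for c
    using that degree_mult_le[of D c] by (auto simp: polys_below_iff d_def)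
  have below: "(r - N) mod D \<in> polys_below m" for r
    using mod_in_polys_below[OF D(1), of "r - N"] D(2) by (auto simp: polys_below_def)
  have modf: "f (r, c) mod D = r" if "r \<in> S" for r c
  proof -
    have "f (r, c) - r = D * (c - (r - N) div D)"
      by (simp add: f_def minus_div_mult_eq_mod[symmetric] algebra_simps)
    then have "f (r, c) mod D = r mod D" by (simp add: mod_eq_dvd_iff)
    then show ?thesis using S that mod_polys_below[of r D] by auto
  qed
  have "bij_betw f (S \<times> polys_below (m - d)) {b \<in> short_interval N m. b mod D \<in> S}"
    unfolding bij_betw_def
  proof (intro conjI)
    show "inj_on f (S \<times> polys_below (m - d))"
    proof (rule inj_onI)
      fix x y assume xy: "x \<in> S \<times> polys_below (m - d)" "y \<in> S \<times> polys_below (m - d)" "f x = f y"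
      obtain r c r' c' where [simp]: "x = (r, c)" "y = (r', c')" by (cases x, cases y) auto
      have "r = r'" using modf[of r c] modf[of r' c'] xy by auto
      with xy(3) D(1) show "x = y" by (simp add: f_def)
    qed
    show "f ` (S \<times> polys_below (m - d)) = {b \<in> short_interval N m. b mod D \<in> S}"
    proof (intro equalityI subsetI)
      fix b assume "b \<in> f ` (S \<times> polys_below (m - d))"
      then obtain r c where rc: "r \<in> S" "c \<in> polys_below (m - d)" "b = f (r, c)" by auto
      have "b - N \<in> polys_below m"
        using polys_below_add[OF below D_mult[OF rc(2)], of r] by (simp add: rc(3) f_def)
      then show "b \<in> {b \<in> short_interval N m. b mod D \<in> S}"
        using modf[OF rc(1)] rc by (simp add: short_interval_iff)
    next
      fix b assume b: "b \<in> {b \<in> short_interval N m. b mod D \<in> S}"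
      define r c where "r = b mod D" and "c = (b - N) div D"
      have "(r - N) mod D = (b - N) mod D" by (simp add: r_def mod_simps)
      then have fb: "f (r, c) = b" by (simp add: f_def c_def)
      have "D * c \<in> polys_below m"
      proof -
        have "D * c = (b - N) - (r - N) mod D" using fb[symmetric] by (simp add: f_def)
        then show ?thesis using polys_below_diff[OF _ below] b by (simp add: short_interval_iff)
      qed
      then have "c \<in> polys_below (m - d)"
        using D degree_mult_eq[of D c] by (cases "c = 0") (auto simp: polys_below_iff d_def)
      then show "b \<in> f ` (S \<times> polys_below (m - d))"
        using fb b by (intro image_eqI[of _ _ "(r, c)"]) (auto simp: r_def)
    qed
  qed
  from bij_betw_same_card[OF this] show ?thesis
    by (simp add: card_cartesian_product card_polys_below d_def)
qed

lemma card_short_interval_dvd: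
  fixes D N :: "'a::{field,finite} poly"
  assumes D: "D \<noteq> 0" "degree D \<le> m"
  shows "card {b \<in> short_interval N m. D dvd poly g b} = rho g D * CARD('a) ^ (m - degree D)"
proof -
  have "{b \<in> short_interval N m. D dvd poly g b} =
      {b \<in> short_interval N m. b mod D \<in> {r \<in> polys_below (degree D). D dvd poly g r}}"
    using mod_in_polys_below[OF D(1)] by (auto simp: dvd_poly_mod_iff)
  then show ?thesis
    using card_short_interval_mod[OF D, of "{r \<in> polys_below (degree D). D dvd poly g r}" N]
      rho_eq_card[OF D(1), of g] by auto
qed

text \<open>The Chinese remainder theorem by counting: \<open>cop\<close> makes the pair of residues
  injective, and both sides have the same size. \<open>cop\<close> expresses coprimality through
  multiples, the form that squares of distinct primes satisfy directly.\<close>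

lemma rho_mult:
  fixes D E :: "'a::{field,finite} poly"
  assumes nz: "D \<noteq> 0" "E \<noteq> 0"
    and cop: "\<And>x. D dvd x \<Longrightarrow> E dvd x \<Longrightarrow> D * E dvd x"
  shows "rho g (D * E) = rho g D * rho g E"
proof -
  define f where "f = (\<lambda>r. (r mod D, r mod E))"
  let ?X = "polys_below (degree (D * E)) :: 'a poly set"
  let ?Y = "polys_below (degree D) \<times> polys_below (degree E) :: ('a poly \<times> 'a poly) set"
  let ?A = "\<lambda>D. {r \<in> polys_below (degree D). D dvd poly g r}"
  have inj: "inj_on f ?X"
  proof (rule inj_onI)
    fix r s assume rs: "r \<in> ?X" "s \<in> ?X" "f r = f s"
    then have "D dvd r - s" "E dvd r - s" by (auto simp: f_def mod_eq_dvd_iff)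
    then have "D * E dvd r - s" by (rule cop)
    then have "(r - s) mod (D * E) = 0" by simp
    moreover have "r - s \<in> polys_below (degree (D * E))" using rs by (intro polys_below_diff)
    ultimately show "r = s" using mod_polys_below[of "r - s" "D * E"] by simp
  qed
  have "f ` ?X = ?Y"
  proof (rule card_subset_eq)
    show "finite ?Y" by (simp add: finite_polys_below)
    show "f ` ?X \<subseteq> ?Y" using nz by (auto simp: f_def mod_in_polys_below)
    show "card (f ` ?X) = card ?Y"
      unfolding card_image[OF inj] using nz
      by (simp add: card_cartesian_product card_polys_below degree_mult_eq power_add)
  qed
  note img = this
  have iff: "D * E dvd poly g r \<longleftrightarrow> D dvd poly g (r mod D) \<and> E dvd poly g (r mod E)" for r
    unfolding dvd_poly_mod_iff using cop[of "poly g r"] dvd_mult_left[of D E] dvd_mult_right[of D E]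
    by metis
  have "f ` ?A (D * E) = ?A D \<times> ?A E"
  proof (intro equalityI subsetI)
    fix z assume "z \<in> f ` ?A (D * E)"
    then show "z \<in> ?A D \<times> ?A E" using nz by (auto simp: f_def iff mod_in_polys_below)
  next
    fix z assume z: "z \<in> ?A D \<times> ?A E"
    then have "z \<in> f ` ?X" unfolding img by auto
    then obtain r where r: "r \<in> ?X" "z = f r" by auto
    with z have "r \<in> ?A (D * E)" by (simp add: f_def iff)
    with r(2) show "z \<in> f ` ?A (D * E)" by (rule image_eqI)
  qed
  then have "card (?A D \<times> ?A E) = card (f ` ?A (D * E))" by simp
  also have "\<dots> = card (?A (D * E))"
    by (rule card_image, rule inj_on_subset[OF inj]) auto
  finally show ?thesis using nz by (simp add: rho_eq_card card_cartesian_product)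
qed

section \<open>Squares of distinct irreducibles\<close>

lemma prime_square_dvd_mult:
  fixes p :: "'b::idom"
  assumes "prime_elem p" "\<not> p dvd a" "p ^ 2 dvd a * b"
  shows "p ^ 2 dvd b"
proof -
  have "p dvd a * b" using assms(3) by (metis dvd_mult_left power2_eq_square)
  then have "p dvd b" using prime_elem_dvd_multD[OF assms(1)] assms(2) by metis
  then obtain c where c: "b = p * c" by (elim dvdE)
  have "p * p dvd p * (a * c)" using assms(3) by (simp add: c power2_eq_square mult.left_commute)
  then have "p dvd a * c" using prime_elem_not_zeroI[OF assms(1)] by simp
  then have "p dvd c" using prime_elem_dvd_multD[OF assms(1)] assms(2) by metis
  then show ?thesis by (simp add: c power2_eq_square)
qed

lemma prod_squares_mult_dvd:
  assumes T: "finite T" "T \<subseteq> monic_irreducibles" "P \<in> monic_irreducibles" "P \<notin> T"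
    and dvd: "P ^ 2 dvd x" "(\<Prod>Q\<in>T. Q ^ 2) dvd x"
  shows "P ^ 2 * (\<Prod>Q\<in>T. Q ^ 2) dvd x"
proof -
  have prime: "prime_elem P" using T(3) by (rule monic_irreducibleD)
  obtain e where e: "x = (\<Prod>Q\<in>T. Q ^ 2) * e" using dvd(2) by (elim dvdE)
  have "\<not> P dvd (\<Prod>Q\<in>T. Q ^ 2)"
  proof
    assume "P dvd (\<Prod>Q\<in>T. Q ^ 2)"
    then obtain Q where "Q \<in> T" "P dvd Q ^ 2" using prime_elem_dvd_prod[OF prime] by metis
    then have "P dvd Q" "Q \<in> monic_irreducibles" using prime_elem_dvd_power[OF prime] T by auto
    with T \<open>Q \<in> T\<close> monic_irreducible_dvd_imp_eq show False by blast
  qed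
  then have "P ^ 2 dvd e" using prime_square_dvd_mult[OF prime] dvd(1) e by metis
  then show ?thesis unfolding e by (simp add: mult.commute mult_dvd_mono)
qed

lemma rho_prod_squares:
  assumes "finite T" "T \<subseteq> monic_irreducibles"
  shows "rho g (\<Prod>P\<in>T. P ^ 2) = (\<Prod>P\<in>T. rho g (P ^ 2))"
  using assms
proof (induction T rule: finite_induct)
  case empty
  have "(\<lambda>a. a mod 1) ` {a. 1 dvd poly g a} = {0}" by auto
  then show ?case by (simp add: rho_def)
next
  case (insert P T)
  have "(\<Prod>Q\<in>T. Q ^ 2) \<noteq> 0" "P ^ 2 \<noteq> 0"
    using insert monic_irreducibleD(3) by (auto simp: prod_zero_iff subset_iff)
  then have "rho g (P ^ 2 * (\<Prod>Q\<in>T. Q ^ 2)) = rho g (P ^ 2) * rho g (\<Prod>Q\<in>T. Q ^ 2)"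
    using prod_squares_mult_dvd[OF insert.hyps(1) _ _ insert.hyps(2)] insert.prems
    by (intro rho_mult) auto
  with insert show ?case by simp
qed

lemma prod_squares_dvd_iff:
  assumes "finite T" "T \<subseteq> monic_irreducibles"
  shows "(\<Prod>P\<in>T. P ^ 2) dvd x \<longleftrightarrow> (\<forall>P\<in>T. P ^ 2 dvd x)"
  using assms
proof (induction T rule: finite_induct)
  case (insert P T)
  have "P ^ 2 * (\<Prod>Q\<in>T. Q ^ 2) dvd x \<longleftrightarrow> P ^ 2 dvd x \<and> (\<Prod>Q\<in>T. Q ^ 2) dvd x"
    using prod_squares_mult_dvd[OF insert.hyps(1) _ _ insert.hyps(2), of x] insert.prems
      dvd_mult_left[of "P ^ 2"] dvd_mult_right[of "P ^ 2"] by (metis insert_subset)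
  with insert show ?case by simp
qed simp

text \<open>The quantity \<open>x_P\<close>; its complement is the factor of
  \<open>c_const g\<close> at \<open>P\<close>.\<close>

definition sq_density :: "'a::{field,finite} poly poly \<Rightarrow> 'a poly \<Rightarrow> real" where
  "sq_density g P = real (rho g (P ^ 2)) / poly_norm P ^ 2"

lemma poly_norm_pos: "poly_norm P > 0"
  by (simp add: poly_norm_def)

lemma sq_density_nonneg: "sq_density g P \<ge> 0"
  using poly_norm_pos[of P] by (simp add: sq_density_def)

lemma sq_density_le_1: "P \<noteq> 0 \<Longrightarrow> sq_density g P \<le> 1"
  using rho_le_norm[of "P ^ 2" g] poly_norm_pos[of P]
  by (simp add: sq_density_def poly_norm_def degree_power_eq power_mult mult.commute)

text \<open>The squares of distinct irreducibles are coprime and their product has degree at most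
  \<open>m\<close>, so equidistribution is exact and the conditions are independent.\<close>

lemma card_short_interval_squares_dvd:
  fixes g :: "'a::{field,finite} poly poly"
  assumes T: "finite T" "T \<subseteq> monic_irreducibles" and m: "(\<Sum>P\<in>T. 2 * degree P) \<le> m"
  shows "real (card {b \<in> short_interval N m. \<forall>P\<in>T. P ^ 2 dvd poly g b}) =
    real CARD('a) ^ m * (\<Prod>P\<in>T. sq_density g P)"
proof -
  define D where "D = (\<Prod>P\<in>T. P ^ 2)"
  let ?q = "real CARD('a)"
  have nz: "P \<noteq> 0" if "P \<in> T" for P using T that monic_irreducibleD(3) by blast
  then have D0: "D \<noteq> 0" using T by (auto simp: D_def prod_zero_iff)
  have degD: "degree D = (\<Sum>P\<in>T. 2 * degree P)"
    unfolding D_def using nz by (subst degree_prod_eq_sum_degree) (auto simp: degree_power_eq mult.commute)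
  have "real (card {b \<in> short_interval N m. \<forall>P\<in>T. P ^ 2 dvd poly g b}) =
      real (rho g D) * ?q ^ (m - degree D)"
    using card_short_interval_dvd[OF D0, of m N g] m degD prod_squares_dvd_iff[OF T]
    by (simp add: D_def)
  also have "\<dots> = real (rho g D) * (?q ^ m / ?q ^ degree D)"
    using m degD by (simp add: power_diff)
  also have "?q ^ degree D = (\<Prod>P\<in>T. poly_norm P ^ 2)"
    unfolding degD power_sum poly_norm_def by (simp add: power_mult mult.commute flip: power_mult)
  also have "real (rho g D) = (\<Prod>P\<in>T. real (rho g (P ^ 2)))"
    unfolding D_def rho_prod_squares[OF T] by simp
  finally show ?thesis by (simp add: sq_density_def prod_dividef)
qed

section \<open>Roots modulo \<open>P\<close> and \<open>P ^ 2\<close>\<close>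

lemma card_roots_mod_prime:
  fixes f :: "'b::idom poly"
  assumes "finite S" "prime_elem P" "\<not> [:P:] dvd f"
    and "\<And>r. r \<in> S \<Longrightarrow> P dvd poly f r"
    and "\<And>r s. r \<in> S \<Longrightarrow> s \<in> S \<Longrightarrow> r \<noteq> s \<Longrightarrow> \<not> P dvd r - s"
  shows "card S \<le> degree f"
  using assms(1,3-)
proof (induction S arbitrary: f rule: finite_induct)
  case (insert r S)
  \<comment> \<open>Synthetic division keeps Lagrange's root count inside the domain, without
    passing to the quotient by \<open>P\<close>: the other roots \<open>s\<close> pass to
    \<open>h\<close> because \<open>P\<close> does not divide \<open>s - r\<close>.\<close>
  define h where "h = synthetic_div f r"
  have f: "f = [:poly f r:] + [:- r, 1:] * h"
    using synthetic_div_correct'[of r f] by (simp add: h_def add.commute)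
  have Pr: "P dvd poly f r" using insert.prems(2) by simp
  have "degree f \<noteq> 0"
  proof
    assume "degree f = 0"
    then obtain c where "f = [:c:]" by (rule degree_eq_zeroE)
    with Pr insert.prems(1) show False by (simp add: const_poly_dvd_const_poly_iff)
  qed
  moreover have "card S \<le> degree h"
  proof (rule insert.IH)
    show "\<not> [:P:] dvd h"
    proof
      assume "[:P:] dvd h"
      moreover have "[:P:] dvd [:poly f r:]" using Pr by (simp add: const_poly_dvd_const_poly_iff)
      ultimately have "[:P:] dvd [:poly f r:] + [:- r, 1:] * h" by (intro dvd_add dvd_mult)
      with f insert.prems(1) show False by metis
    qed
    show "P dvd poly h s" if s: "s \<in> S" for s
    proof -
      have "poly f s = poly f r + (s - r) * poly h s"
        using arg_cong[OF f, of "\<lambda>p. poly p s"] by (simp add: algebra_simps)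
      moreover have "P dvd poly f s" using insert.prems(2) s by simp
      ultimately have "P dvd (s - r) * poly h s" using Pr by (metis dvd_add_right_iff)
      moreover have "\<not> P dvd s - r" using insert.prems(3)[of s r] s insert.hyps(2) by auto
      ultimately show ?thesis using prime_elem_dvd_multD[OF assms(2)] by metis
    qed
  qed (use insert.prems in auto)
  moreover have "degree h = degree f - 1" by (simp add: h_def degree_synthetic_div)
  ultimately show ?case using insert.hyps by simp
qed simp

text \<open>If \<open>P\<close> divides the content of \<open>g\<close>, the roots modulo \<open>P\<close> of \<open>g / P\<close> are counted.\<close>

lemma card_square_root_classes:
  fixes g :: "'a::{field,finite} poly poly"
  assumes sf: "squarefree g" and P: "P \<in> monic_irreducibles"
  shows "finite ((\<lambda>a. a mod P) ` {a. P ^ 2 dvd poly g a})"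
    and "card ((\<lambda>a. a mod P) ` {a. P ^ 2 dvd poly g a}) \<le> degree g"
proof -
  let ?S = "(\<lambda>a. a mod P) ` {a. P ^ 2 dvd poly g a}"
  note PD = monic_irreducibleD[OF P]
  have sub: "?S \<subseteq> polys_below (degree P)" using mod_in_polys_below[OF PD(3)] by auto
  then show fin: "finite ?S" using finite_polys_below finite_subset by blast
  have "\<exists>h. degree h \<le> degree g \<and> \<not> [:P:] dvd h \<and> (\<forall>a. P ^ 2 dvd poly g a \<longrightarrow> P dvd poly h a)"
  proof (cases "[:P:] dvd g")
    case False
    then show ?thesis by (intro exI[of _ g]) (auto simp: power2_eq_square intro: dvd_mult_left)
  next
    case True
    then obtain h where h: "g = [:P:] * h" by (elim dvdE)
    have "\<not> [:P:] dvd h"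
    proof
      assume "[:P:] dvd h"
      then have "[:P:] ^ 2 dvd g" unfolding h power2_eq_square by (rule mult_dvd_mono[OF dvd_refl])
      then have "[:P:] dvd 1" using squarefreeD[OF sf] by blast
      then show False using irreducible_not_unit[OF PD(1)] by (metis is_unit_const_poly_iff)
    qed
    then show ?thesis using PD(3) by (intro exI[of _ h]) (auto simp: h power2_eq_square)
  qed
  then obtain h where h: "degree h \<le> degree g" "\<not> [:P:] dvd h"
    "\<And>a. P ^ 2 dvd poly g a \<Longrightarrow> P dvd poly h a" by metis
  have "card ?S \<le> degree h"
  proof (rule card_roots_mod_prime[OF fin PD(2) h(2)])
    show "P dvd poly h r" if "r \<in> ?S" for r using that h(3) dvd_poly_mod_iff by auto
    show "\<not> P dvd r - s" if "r \<in> ?S" "s \<in> ?S" "r \<noteq> s" for r s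
      using that by (auto simp flip: mod_eq_dvd_iff)
  qed
  with h(1) show "card ?S \<le> degree g" by simp
qed

text \<open>First-order Taylor expansion; no factorials are divided by, so it holds in every
  characteristic.\<close>

lemma poly_taylor1_dvd:
  fixes g :: "'b::idom poly"
  shows "w ^ 2 dvd poly g (b + w) - poly g b - w * poly (pderiv g) b"
proof (induction g)
  case (pCons c p)
  obtain e where e: "poly p (b + w) - poly p b - w * poly (pderiv p) b = w ^ 2 * e"
    using pCons.IH by (elim dvdE)
  then have e': "poly p (b + w) = w ^ 2 * e + poly p b + w * poly (pderiv p) b"
    by (simp add: algebra_simps)
  have "poly (pCons c p) (b + w) - poly (pCons c p) b - w * poly (pderiv (pCons c p)) b =
      w ^ 2 * (b * e + poly (pderiv p) b + w * e)"
    by (simp add: e' pderiv_pCons algebra_simps power2_eq_square)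
  then show ?case by simp
qed simp

lemma dvd_pderiv_of_square_dvd:
  fixes f :: "'b::idom poly"
  assumes "P ^ 2 dvd f"
  shows "P dvd pderiv f"
proof -
  obtain e where "f = P ^ 2 * e" using assms by (elim dvdE)
  then have "f = P * P * e" by (simp add: power2_eq_square)
  then have "pderiv f = P * (2 * pderiv P * e + P * pderiv e)"
    by (simp add: pderiv_mult algebra_simps)
  then show ?thesis by simp
qed

text \<open>Roots modulo \<open>P ^ 2\<close> lie in at most \<open>degree g\<close> classes modulo
  \<open>P\<close>, each with \<open>CARD('a) ^ degree P\<close> lifts. This covers singular
  \<open>P\<close> as well.\<close>

lemma rho_square_le:
  fixes g :: "'a::{field,finite} poly poly"
  assumes sf: "squarefree g" and P: "P \<in> monic_irreducibles"
  shows "rho g (P ^ 2) \<le> degree g * CARD('a) ^ degree P"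
proof -
  note PD = monic_irreducibleD[OF P]
  let ?S = "(\<lambda>a. a mod P) ` {a. P ^ 2 dvd poly g a}"
  have deg: "degree (P ^ 2) = 2 * degree P" using PD(3) by (simp add: degree_power_eq)
  have sub: "?S \<subseteq> polys_below (degree P)" using mod_in_polys_below[OF PD(3)] by auto
  have "rho g (P ^ 2) = card {r \<in> polys_below (2 * degree P). P ^ 2 dvd poly g r}"
    using rho_eq_card[of "P ^ 2" g] PD(3) deg by simp
  also have "\<dots> \<le> card {r \<in> short_interval 0 (2 * degree P). r mod P \<in> ?S}"
    by (rule card_mono, simp add: finite_short_interval) (auto simp: short_interval_iff)
  also have "\<dots> = card ?S * CARD('a) ^ degree P"
    using card_short_interval_mod[OF PD(3) _ sub, of "2 * degree P" 0] by simp
  also have "\<dots> \<le> degree g * CARD('a) ^ degree P"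
    using card_square_root_classes(2)[OF sf P] by (rule mult_right_mono) simp
  finally show ?thesis .
qed

text \<open>The uniqueness part of Hensel's lemma: reduction modulo \<open>P\<close> is injective on
  roots modulo \<open>P ^ 2\<close>, because \<open>pderiv g\<close> does not vanish modulo
  \<open>P\<close> there.\<close>

lemma rho_square_le_nonsingular:
  fixes g :: "'a::{field,finite} poly poly"
  assumes sf: "squarefree g" and P: "P \<in> monic_irreducibles"
    and ns: "\<And>a. P dvd poly g a \<Longrightarrow> \<not> P dvd poly (total_deriv g u) a"
  shows "rho g (P ^ 2) \<le> degree g"
proof -
  note PD = monic_irreducibleD[OF P]
  let ?A = "{r \<in> polys_below (degree (P ^ 2)). P ^ 2 dvd poly g r}"
  have "inj_on (\<lambda>r. r mod P) ?A"
  proof (rule inj_onI)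
    fix a b assume ab: "a \<in> ?A" "b \<in> ?A" "a mod P = b mod P"
    then have ga: "P ^ 2 dvd poly g a" and gb: "P ^ 2 dvd poly g b" by auto
    have w: "P dvd a - b" using ab(3) by (simp add: mod_eq_dvd_iff)
    \<comment> \<open>Since \<open>P\<close> divides the derivative
      \<open>g_t(b) + b' g_x(b)\<close> of \<open>g(b)\<close>, divisibility of
      \<open>g_x(b)\<close> would pass to \<open>g_t(b)\<close> and so to
      \<open>total_deriv g u\<close> at \<open>b\<close>.\<close>
    have "\<not> P dvd poly (pderiv g) b"
    proof
      assume x: "P dvd poly (pderiv g) b"
      have "P dvd poly (total_deriv g (pderiv b)) b"
        using dvd_pderiv_of_square_dvd[OF gb] by (simp add: pderiv_poly_eq_total_deriv)
      then have "P dvd poly (map_poly pderiv g) b"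
        using x by (simp add: total_deriv_def dvd_add_left_iff)
      then have "P dvd poly (total_deriv g u) b" using x by (simp add: total_deriv_def)
      moreover have "P dvd poly g b" using gb by (auto simp: power2_eq_square intro: dvd_mult_left)
      ultimately show False using ns by blast
    qed
    moreover have "P ^ 2 dvd poly (pderiv g) b * (a - b)"
    proof -
      have "P ^ 2 dvd poly g a - poly g b - (a - b) * poly (pderiv g) b"
        using poly_taylor1_dvd[of "a - b" g b] dvd_trans[OF dvd_power_same[OF w, of 2]] by simp
      with dvd_diff[OF ga gb] have "P ^ 2 dvd (poly g a - poly g b) -
          (poly g a - poly g b - (a - b) * poly (pderiv g) b)"
        by (rule dvd_diff)
      then show ?thesis by (simp add: mult.commute)
    qed
    ultimately have "P ^ 2 dvd a - b" by (rule prime_square_dvd_mult[OF PD(2)])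
    then have "a mod P ^ 2 = b mod P ^ 2" by (simp add: mod_eq_dvd_iff)
    with ab show "a = b" using mod_polys_below[of a "P ^ 2"] mod_polys_below[of b "P ^ 2"] by simp
  qed
  then have "card ?A = card ((\<lambda>r. r mod P) ` ?A)" by (simp add: card_image)
  also have "\<dots> \<le> card ((\<lambda>a. a mod P) ` {a. P ^ 2 dvd poly g a})"
    by (rule card_mono[OF card_square_root_classes(1)[OF sf P]]) auto
  also have "\<dots> \<le> degree g" by (rule card_square_root_classes(2)[OF sf P])
  finally show ?thesis using rho_eq_card[of "P ^ 2" g] PD(3) by simp
qed

subsection \<open>Brun's pure sieve and sums over irreducibles\<close>

text \<open>The elementary symmetric polynomials, the terms of inclusion-exclusion.\<close>

definition esym :: "nat \<Rightarrow> ('i \<Rightarrow> real) \<Rightarrow> 'i set \<Rightarrow> real" where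
  "esym r x A = (\<Sum>T | T \<subseteq> A \<and> card T = r. prod x T)"

lemma esym_0: "finite A \<Longrightarrow> esym 0 x A = 1"
proof -
  assume "finite A"
  then have "{T. T \<subseteq> A \<and> card T = 0} = {{}}" by (auto dest: finite_subset)
  then show ?thesis by (simp add: esym_def)
qed

lemma esym_Suc_empty: "esym (Suc r) x {} = 0"
  by (simp add: esym_def)

lemma esym_insert:
  assumes "finite A" "a \<notin> A"
  shows "esym (Suc r) x (insert a A) = esym (Suc r) x A + x a * esym r x A"
proof -
  let ?S = "\<lambda>r. {T. T \<subseteq> A \<and> card T = r}"
  have fin: "finite (?S r)" for r using assms(1) by simp
  have finT: "finite T" if "T \<in> ?S r" for T r using that assms(1) finite_subset by blast
  have eq: "{T. T \<subseteq> insert a A \<and> card T = Suc r} = ?S (Suc r) \<union> insert a ` ?S r"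
  proof (intro equalityI subsetI)
    fix T assume T: "T \<in> {T. T \<subseteq> insert a A \<and> card T = Suc r}"
    then have "finite T" using assms(1) by (auto intro: finite_subset)
    show "T \<in> ?S (Suc r) \<union> insert a ` ?S r"
    proof (cases "a \<in> T")
      case True
      then have "T = insert a (T - {a})" by auto
      moreover have "T - {a} \<in> ?S r" using T True \<open>finite T\<close> by auto
      ultimately show ?thesis by blast
    qed (use T in auto)
  next
    fix T assume T: "T \<in> ?S (Suc r) \<union> insert a ` ?S r"
    show "T \<in> {T. T \<subseteq> insert a A \<and> card T = Suc r}"
    proof (cases "T \<in> ?S (Suc r)")
      case False
      then obtain U where U: "U \<in> ?S r" "T = insert a U" using T by auto
      then have "a \<notin> U" using assms(2) by auto
      with U finT[OF U(1)] show ?thesis by auto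
    qed auto
  qed
  have inj: "inj_on (insert a) (?S r)"
    using assms(2) by (intro inj_onI) (auto simp: insert_ident subset_iff)
  have "(\<Sum>T\<in>insert a ` ?S r. prod x T) = (\<Sum>T\<in>?S r. x a * prod x T)"
    using assms(2) finT by (subst sum.reindex[OF inj]) (auto intro!: sum.cong prod.insert)
  moreover have "?S (Suc r) \<inter> insert a ` ?S r = {}" using assms(2) by auto
  ultimately show ?thesis
    using fin by (simp add: esym_def eq sum.union_disjoint sum_distrib_left)
qed

text \<open>Induction on \<open>A\<close>: adding \<open>a\<close> turns the product
  \<open>p\<close> into \<open>p - x a * p\<close> and, for positive \<open>r\<close>, the
  truncation \<open>E r\<close> into \<open>E r - x a * E (r - 1)\<close>, so the errors combine as
  in the recursion for \<open>esym\<close>. Real weights allow both indicators and densities as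
  \<open>x\<close>.\<close>

lemma bonferroni:
  assumes "finite A" "\<And>i. i \<in> A \<Longrightarrow> 0 \<le> x i \<and> x i \<le> 1"
  shows "\<bar>(\<Prod>i\<in>A. 1 - x i) - (\<Sum>i\<le>r. (- 1) ^ i * esym i x A)\<bar> \<le> esym (Suc r) x A"
  using assms
proof (induction A arbitrary: r rule: finite_induct)
  case empty
  have "(\<Sum>i\<le>r. (- 1) ^ i * esym i x {}) = 1"
    by (subst sum.atMost_shift) (simp add: esym_0 esym_Suc_empty)
  then show ?case by (simp add: esym_Suc_empty)
next
  case (insert a A)
  define p where "p = (\<Prod>i\<in>A. 1 - x i)"
  define E where "E = (\<lambda>r. \<Sum>i\<le>r. (- 1) ^ i * esym i x A)"
  have xa: "0 \<le> x a" "x a \<le> 1" using insert.prems by auto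
  have IH: "\<bar>p - E r\<bar> \<le> esym (Suc r) x A" for r
    unfolding p_def E_def using insert by auto
  have p: "0 \<le> p" "p \<le> 1"
    unfolding p_def using insert.prems by (auto intro!: prod_nonneg prod_le_1)
  have prod: "(\<Prod>i\<in>insert a A. 1 - x i) = p - x a * p"
    using insert.hyps by (simp add: p_def algebra_simps)
  show ?case
  proof (cases r)
    case 0
    have "\<bar>p - 1\<bar> \<le> esym 1 x A" using IH[of 0] insert.hyps by (simp add: E_def esym_0)
    moreover have "x a * p \<le> x a" "0 \<le> x a * p" using xa p by (auto simp: mult_left_le)
    ultimately show ?thesis unfolding prod
      using 0 insert.hyps by (simp add: esym_0 esym_insert)
  next
    case (Suc s)
    have "(\<Sum>i\<le>r. (- 1) ^ i * esym i x (insert a A)) =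
        1 + (\<Sum>i\<le>s. (- 1) ^ Suc i * (esym (Suc i) x A + x a * esym i x A))"
      unfolding Suc using insert.hyps by (subst sum.atMost_Suc_shift) (simp add: esym_0 esym_insert)
    also have "\<dots> = (1 + (\<Sum>i\<le>s. (- 1) ^ Suc i * esym (Suc i) x A)) - x a * E s"
    proof -
      have "(\<Sum>i\<le>s. (- 1) ^ Suc i * (esym (Suc i) x A + x a * esym i x A)) =
          (\<Sum>i\<le>s. (- 1) ^ Suc i * esym (Suc i) x A - x a * ((- 1) ^ i * esym i x A))"
        by (intro sum.cong) (auto simp: algebra_simps)
      then show ?thesis by (simp add: E_def sum_subtractf sum_distrib_left)
    qed
    also have "1 + (\<Sum>i\<le>s. (- 1) ^ Suc i * esym (Suc i) x A) = E (Suc s)"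
      unfolding E_def using insert.hyps by (subst sum.atMost_Suc_shift) (simp add: esym_0)
    finally have eq: "(\<Sum>i\<le>r. (- 1) ^ i * esym i x (insert a A)) = E (Suc s) - x a * E s" .
    have "\<bar>(\<Prod>i\<in>insert a A. 1 - x i) - (\<Sum>i\<le>r. (- 1) ^ i * esym i x (insert a A))\<bar> =
        \<bar>(p - E (Suc s)) - x a * (p - E s)\<bar>"
      unfolding prod eq by (simp add: algebra_simps)
    also have "\<dots> \<le> \<bar>p - E (Suc s)\<bar> + \<bar>x a * (p - E s)\<bar>" by (rule abs_triangle_ineq4)
    also have "\<dots> = \<bar>p - E (Suc s)\<bar> + x a * \<bar>p - E s\<bar>" using xa by (simp add: abs_mult)
    also have "\<dots> \<le> esym (Suc (Suc s)) x A + x a * esym (Suc s) x A"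
      using IH[of "Suc s"] IH[of s] xa by (intro add_mono mult_left_mono) auto
    also have "\<dots> = esym (Suc r) x (insert a A)"
      using insert.hyps Suc by (simp add: esym_insert)
    finally show ?thesis .
  qed
qed

lemma power_add_ge:
  fixes S x :: real
  assumes "S \<ge> 0" "x \<ge> 0"
  shows "S ^ Suc n + real (Suc n) * x * S ^ n \<le> (S + x) ^ Suc n"
proof (induction n)
  case (Suc n)
  have "S ^ Suc (Suc n) + real (Suc (Suc n)) * x * S ^ Suc n \<le>
      (S + x) * (S ^ Suc n + real (Suc n) * x * S ^ n)"
    using assms by (simp add: algebra_simps)
  also have "\<dots> \<le> (S + x) * (S + x) ^ Suc n"
    using Suc.IH assms by (intro mult_left_mono) auto
  finally show ?case by simp
qed simp

text \<open>Each product over \<open>r\<close> distinct indices occurs \<open>fact r\<close> times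
  in the expanded power, and the other terms are nonnegative; the induction adds one index at a
  time.\<close>

lemma esym_le:
  assumes "finite A" "\<And>i. i \<in> A \<Longrightarrow> x i \<ge> 0"
  shows "esym r x A \<le> (\<Sum>i\<in>A. x i) ^ r / fact r"
  using assms
proof (induction A arbitrary: r rule: finite_induct)
  case empty
  then show ?case by (cases r) (auto simp: esym_0 esym_Suc_empty)
next
  case (insert a A)
  show ?case
  proof (cases r)
    case 0
    with insert.hyps show ?thesis by (simp add: esym_0)
  next
    case (Suc n)
    define S where "S = (\<Sum>i\<in>A. x i)"
    have S: "S \<ge> 0" unfolding S_def using insert.prems by (intro sum_nonneg) auto
    have xa: "x a \<ge> 0" using insert.prems by simp
    have IH: "esym j x A \<le> S ^ j / fact j" for j
      unfolding S_def by (rule insert.IH) (use insert.prems in auto)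
    have "esym r x (insert a A) = esym (Suc n) x A + x a * esym n x A"
      using insert.hyps Suc by (simp add: esym_insert)
    also have "\<dots> \<le> S ^ Suc n / fact (Suc n) + x a * (S ^ n / fact n)"
      by (intro add_mono mult_left_mono IH xa)
    also have "\<dots> = (S ^ Suc n + real (Suc n) * x a * S ^ n) / fact (Suc n)"
      by (simp add: field_simps del: of_nat_Suc)
    also have "\<dots> \<le> (S + x a) ^ Suc n / fact (Suc n)"
      by (intro divide_right_mono power_add_ge S xa) simp
    finally show ?thesis using insert.hyps Suc by (simp add: S_def add.commute)
  qed
qed

text \<open>The bound \<open>y ^ r / fact r \<le> exp y\<close> is taken at
  \<open>y = exp 1 * S\<close>, which yields the factor \<open>exp (- real r)\<close>; then
  \<open>exp 1 \<le> 3\<close>.\<close>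

lemma power_div_fact_le_exp:
  fixes S :: real
  assumes "S \<ge> 0"
  shows "S ^ r / fact r \<le> exp (3 * S - real r)"
proof -
  have pw: "y ^ r / fact r \<le> exp y" if "y \<ge> 0" for y :: real
  proof -
    have "(\<Sum>n\<in>{r}. y ^ n /\<^sub>R fact n) \<le> (\<Sum>n. y ^ n /\<^sub>R fact n)"
      using that by (intro sum_le_suminf summable_exp_generic) auto
    then show ?thesis by (simp add: exp_def divide_inverse mult.commute)
  qed
  have "S ^ r / fact r = (exp 1 * S) ^ r / fact r * exp (- real r)"
    by (simp add: power_mult_distrib exp_minus exp_of_nat_mult[of r 1, simplified])
  also have "\<dots> \<le> exp (exp 1 * S) * exp (- real r)"
    using assms by (intro mult_right_mono pw) auto
  also have "\<dots> \<le> exp (3 * S) * exp (- real r)"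
    using assms exp_le by (intro mult_right_mono) (auto intro!: mult_right_mono)
  finally show ?thesis by (simp add: exp_diff exp_minus divide_inverse)
qed

text \<open>\<open>bonferroni\<close> is used twice, for the indicators \<open>y b\<close> of each
  \<open>b\<close> and for the densities \<open>x\<close>. The truncated sums match exactly because
  the counts do, so only the two remainders at level \<open>Suc r\<close> are left, whence the
  factor \<open>2\<close>.\<close>

lemma brun_pure_sieve:
  fixes x :: "'i \<Rightarrow> real" and B :: "'i \<Rightarrow> 'b \<Rightarrow> bool"
  assumes fin: "finite A" "finite I" and x: "\<And>i. i \<in> A \<Longrightarrow> 0 \<le> x i \<and> x i \<le> 1"
    and X: "\<And>T. T \<subseteq> A \<Longrightarrow> card T \<le> Suc r \<Longrightarrow>
      real (card {b \<in> I. \<forall>i\<in>T. B i b}) = X * prod x T"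
  shows "\<bar>real (card {b \<in> I. \<forall>i\<in>A. \<not> B i b}) - X * (\<Prod>i\<in>A. 1 - x i)\<bar> \<le> 2 * X * esym (Suc r) x A"
proof -
  define y where "y = (\<lambda>b i. of_bool (B i b) :: real)"
  have prody: "(\<Prod>i\<in>T. y b i) = of_bool (\<forall>i\<in>T. B i b)" if "finite T" for T b
    using that by induction (auto simp: y_def)
  have prody': "(\<Prod>i\<in>A. 1 - y b i) = of_bool (\<forall>i\<in>A. \<not> B i b)" for b
    using fin(1) by induction (auto simp: y_def)
  have sum_esym: "(\<Sum>b\<in>I. esym j (y b) A) = X * esym j x A" if "j \<le> Suc r" for j
  proof -
    have "(\<Sum>b\<in>I. esym j (y b) A) = (\<Sum>T | T \<subseteq> A \<and> card T = j. \<Sum>b\<in>I. prod (y b) T)"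
      unfolding esym_def by (rule sum.swap)
    also have "\<dots> = (\<Sum>T | T \<subseteq> A \<and> card T = j. X * prod x T)"
    proof (rule sum.cong)
      fix T assume T: "T \<in> {T. T \<subseteq> A \<and> card T = j}"
      then have "finite T" using fin(1) finite_subset by auto
      have "(\<Sum>b\<in>I. prod (y b) T) = real (card {b \<in> I. \<forall>i\<in>T. B i b})"
        using fin(2) by (simp add: prody[OF \<open>finite T\<close>] Int_def conj_commute)
      also have "\<dots> = X * prod x T" using T that by (intro X) auto
      finally show "(\<Sum>b\<in>I. prod (y b) T) = X * prod x T" .
    qed simp
    finally show ?thesis by (simp add: esym_def sum_distrib_left)
  qed
  let ?E = "\<lambda>x. \<Sum>i\<le>r. (- 1) ^ i * esym i x A"
  have count: "real (card {b \<in> I. \<forall>i\<in>A. \<not> B i b}) = (\<Sum>b\<in>I. \<Prod>i\<in>A. 1 - y b i)"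
    using fin(2) by (simp add: prody' Int_def conj_commute)
  have sumE: "(\<Sum>b\<in>I. ?E (y b)) = X * ?E x"
    by (subst sum.swap) (simp add: sum_esym sum_distrib_left mult.left_commute flip: sum_distrib_left)
  have "\<bar>(\<Sum>b\<in>I. \<Prod>i\<in>A. 1 - y b i) - X * ?E x\<bar> =
      \<bar>\<Sum>b\<in>I. (\<Prod>i\<in>A. 1 - y b i) - ?E (y b)\<bar>"
    by (simp add: sum_subtractf sumE)
  also have "\<dots> \<le> (\<Sum>b\<in>I. \<bar>(\<Prod>i\<in>A. 1 - y b i) - ?E (y b)\<bar>)" by (rule sum_abs)
  also have "\<dots> \<le> (\<Sum>b\<in>I. esym (Suc r) (y b) A)"
    by (intro sum_mono bonferroni fin) (auto simp: y_def)
  also have "\<dots> = X * esym (Suc r) x A" by (rule sum_esym) simp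
  finally have 1: "\<bar>(\<Sum>b\<in>I. \<Prod>i\<in>A. 1 - y b i) - X * ?E x\<bar> \<le> X * esym (Suc r) x A" .
  have X0: "X \<ge> 0" using X[of "{}"] by simp
  have "\<bar>X * (\<Prod>i\<in>A. 1 - x i) - X * ?E x\<bar> = X * \<bar>(\<Prod>i\<in>A. 1 - x i) - ?E x\<bar>"
    using X0 by (simp add: abs_mult flip: right_diff_distrib)
  also have "\<dots> \<le> X * esym (Suc r) x A"
    using X0 x fin by (intro mult_left_mono bonferroni) auto
  finally show ?thesis using 1 unfolding count by linarith
qed

section \<open>Sums over monic irreducibles\<close>

lemma short_interval_monom_degree:
  fixes f :: "'a::{field,finite} poly"
  assumes "f \<in> short_interval (monom 1 n) n"
  shows "degree f = n" "f \<noteq> 0"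
proof -
  have c: "coeff f i = coeff (monom 1 n) i" if "i \<ge> n" for i
    using assms that by (simp add: short_interval_iff polys_below_def)
  have "coeff f n = 1" using c[of n] by simp
  then have "n \<le> degree f" "f \<noteq> 0" using le_degree[of f n] by auto
  moreover have "degree f \<le> n" by (rule degree_le) (use c in auto)
  ultimately show "degree f = n" "f \<noteq> 0" by auto
qed

text \<open>Monic polynomials of degree \<open>n\<close> form the interval around
  \<open>t^n\<close>, so the interval counts apply to them.\<close>

lemma monic_irreducible_in_short_interval:
  assumes "P \<in> monic_irreducibles"
  shows "P \<in> short_interval (monom 1 (degree P)) (degree P)"
  using monic_irreducibleD(5)[OF assms]
  by (auto simp: short_interval_iff polys_below_def coeff_eq_0 le_eq_less_or_eq)

lemma finite_monic_irreducibles_le: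
  "finite {P \<in> monic_irreducibles. degree P \<le> n}"
  by (rule finite_subset[OF _ finite_polys_below[of "Suc n"]]) (auto simp: polys_below_Suc_iff)

lemma card_monic_irreducibles_degree:
  "card {P \<in> monic_irreducibles :: 'a::{field,finite} poly set. degree P = d} \<le> CARD('a) ^ d"
proof -
  have "{P \<in> monic_irreducibles. degree P = d} \<subseteq> short_interval (monom 1 d :: 'a poly) d"
    using monic_irreducible_in_short_interval by auto
  then show ?thesis using card_mono[OF finite_short_interval] card_short_interval by metis
qed

text \<open>A double count of the pairs \<open>(P, f)\<close> with \<open>P\<close> an irreducible factor of the monic
  polynomial \<open>f\<close> of degree \<open>n\<close>.\<close>

lemma sum_degree_div_norm_le:
  "(\<Sum>P | P \<in> (monic_irreducibles :: 'a::{field,finite} poly set) \<and> degree P \<le> n.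
      real (degree P) / poly_norm P) \<le> real n"
proof -
  let ?q = "real CARD('a)"
  let ?M = "{P \<in> (monic_irreducibles :: 'a poly set). degree P \<le> n}"
  let ?I = "short_interval (monom 1 n :: 'a poly) n"
  have q: "?q > 0" by simp
  have card: "real (card {f \<in> ?I. P dvd f}) = ?q ^ n / poly_norm P" if "P \<in> ?M" for P
  proof -
    have "card {f \<in> ?I. f mod P \<in> {0}} = card {0 :: 'a poly} * CARD('a) ^ (n - degree P)"
      using that monic_irreducibleD(3) by (intro card_short_interval_mod) auto
    then have "card {f \<in> ?I. P dvd f} = CARD('a) ^ (n - degree P)"
      by (simp add: dvd_eq_mod_eq_0)
    then have "real (card {f \<in> ?I. P dvd f}) = ?q ^ (n - degree P)" by (simp only: of_nat_power)
    then show ?thesis using that by (simp only: poly_norm_def) (simp add: power_diff)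
  qed
  have "?q ^ n * (\<Sum>P\<in>?M. real (degree P) / poly_norm P) =
      (\<Sum>P\<in>?M. real (degree P) * real (card {f \<in> ?I. P dvd f}))"
    unfolding sum_distrib_left by (intro sum.cong) (auto simp: card)
  also have "\<dots> = (\<Sum>P\<in>?M. \<Sum>f\<in>?I. if P dvd f then real (degree P) else 0)"
  proof (rule sum.cong)
    fix P
    have "(\<Sum>f\<in>?I. if P dvd f then real (degree P) else 0) =
        (\<Sum>f\<in>{f \<in> ?I. P dvd f}. real (degree P))"
      by (rule sum.inter_filter[symmetric]) (rule finite_short_interval)
    then show "real (degree P) * real (card {f \<in> ?I. P dvd f}) =
        (\<Sum>f\<in>?I. if P dvd f then real (degree P) else 0)" by simp
  qed simp
  also have "\<dots> = (\<Sum>f\<in>?I. \<Sum>P\<in>?M. if P dvd f then real (degree P) else 0)"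
    by (rule sum.swap)
  also have "\<dots> \<le> (\<Sum>f\<in>?I. real n)"
  proof (rule sum_mono)
    fix f assume f: "f \<in> ?I"
    have "(\<Sum>P\<in>?M. if P dvd f then real (degree P) else 0) =
        (\<Sum>P\<in>{P \<in> ?M. P dvd f}. real (degree P))"
      by (rule sum.inter_filter[symmetric]) (rule finite_monic_irreducibles_le)
    also have "\<dots> = real (\<Sum>P\<in>{P \<in> ?M. P dvd f}. degree P)" by simp
    also have "\<dots> \<le> real (degree f)"
    proof (rule of_nat_mono, rule sum_degree_le_of_dvd)
      show "finite {P \<in> ?M. P dvd f}" using finite_monic_irreducibles_le by (rule finite_subset[rotated]) auto
    qed (use short_interval_monom_degree[OF f] in auto)
    finally show "(\<Sum>P\<in>?M. if P dvd f then real (degree P) else 0) \<le> real n"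
      using short_interval_monom_degree[OF f] by simp
  qed
  also have "\<dots> = ?q ^ n * real n" by (simp add: card_short_interval)
  finally show ?thesis using q by simp
qed

text \<open>Partial summation. The slack \<open>D\<close> is nonnegative, and the stronger claim
  that \<open>D n / n\<close> is at most the sum of \<open>(1 - a d) / d\<close> survives induction
  because \<open>D n / (n + 1) \<le> D n / n\<close>.\<close>

lemma abel_sum_le:
  fixes a :: "nat \<Rightarrow> real"
  assumes "\<And>j. (\<Sum>d=1..j. a d) \<le> real j"
  shows "(\<Sum>d=1..n. a d / real d) \<le> (\<Sum>d=1..n. 1 / real d)"
proof -
  define D where "D = (\<lambda>j. real j - (\<Sum>d=1..j. a d))"
  have D: "D j \<ge> 0" for j using assms by (simp add: D_def)
  have lower: "D (Suc n) / real (Suc n) \<le> (\<Sum>d=1..Suc n. (1 - a d) / real d)" for n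
  proof (induction n)
    case 0
    then show ?case by (simp add: D_def)
  next
    case (Suc n)
    have step: "D (Suc (Suc n)) = D (Suc n) + (1 - a (Suc (Suc n)))" by (simp add: D_def)
    have "D (Suc n) / real (Suc (Suc n)) \<le> D (Suc n) / real (Suc n)"
      using D[of "Suc n"] by (intro divide_left_mono) auto
    then have "D (Suc (Suc n)) / real (Suc (Suc n)) \<le>
        D (Suc n) / real (Suc n) + (1 - a (Suc (Suc n))) / real (Suc (Suc n))"
      unfolding step add_divide_distrib by linarith
    also have "\<dots> \<le> (\<Sum>d=1..Suc (Suc n). (1 - a d) / real d)" using Suc.IH by simp
    finally show ?case .
  qed
  have "0 \<le> (\<Sum>d=1..n. (1 - a d) / real d)"
  proof (cases n)
    case (Suc m)
    have "0 \<le> D (Suc m) / real (Suc m)" using D by simp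
    also note lower[of m]
    finally show ?thesis by (simp only: Suc)
  qed simp
  then show ?thesis by (simp add: diff_divide_distrib sum_subtractf)
qed

lemma harmonic_sum_le: "n \<ge> 1 \<Longrightarrow> (\<Sum>d=1..n. 1 / real d) \<le> 1 + ln (real n)"
proof (induction n rule: dec_induct)
  case (step n)
  have n: "real n > 0" using step by simp
  have "ln (real n / real (Suc n)) \<le> real n / real (Suc n) - 1"
    using n by (intro ln_le_minus_one) auto
  also have "\<dots> = - (1 / real (Suc n))" by (simp add: field_simps)
  also have "ln (real n / real (Suc n)) = ln (real n) - ln (real (Suc n))"
    using n by (simp add: ln_div)
  finally show ?case using step by simp
qed simp

text \<open>An upper bound of Mertens' type: grouping by degree and partial summation remove the
  weight \<open>degree P\<close> from \<open>sum_degree_div_norm_le\<close>.\<close>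

lemma sum_inverse_norm_le:
  fixes F :: "'a::{field,finite} poly set"
  assumes "n \<ge> 1" "F \<subseteq> monic_irreducibles" "\<And>P. P \<in> F \<Longrightarrow> degree P \<le> n"
  shows "(\<Sum>P\<in>F. 1 / poly_norm P) \<le> 1 + ln (real n)"
proof -
  let ?M = "\<lambda>n. {P \<in> (monic_irreducibles :: 'a poly set). degree P \<le> n}"
  define a where "a = (\<lambda>d. \<Sum>P | P \<in> (monic_irreducibles :: 'a poly set) \<and> degree P = d.
    real (degree P) / poly_norm P)"
  have group: "(\<Sum>P\<in>?M j. h P) = (\<Sum>d=1..j. \<Sum>P | P \<in> monic_irreducibles \<and> degree P = d. h P)"
    for j and h :: "'a poly \<Rightarrow> real"
  proof -
    have "(\<Sum>d\<in>{1..j}. \<Sum>P | P \<in> ?M j \<and> degree P = d. h P) = (\<Sum>P\<in>?M j. h P)"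
    proof (rule sum.group)
      show "degree ` ?M j \<subseteq> {1..j}" using monic_irreducibleD(4) by (auto simp: Suc_le_eq)
    qed (auto simp: finite_monic_irreducibles_le)
    moreover have "{P. P \<in> ?M j \<and> degree P = d} = {P. P \<in> monic_irreducibles \<and> degree P = d}"
      if "d \<in> {1..j}" for d using that by auto
    ultimately show ?thesis by (metis (no_types, lifting) sum.cong)
  qed
  have "(\<Sum>P\<in>F. 1 / poly_norm P) \<le> (\<Sum>P\<in>?M n. 1 / poly_norm P)"
    using assms by (intro sum_mono2 finite_monic_irreducibles_le)
      (auto simp: less_imp_le[OF poly_norm_pos])
  also have "\<dots> = (\<Sum>d=1..n. a d / real d)"
    unfolding group a_def sum_divide_distrib by (intro sum.cong) auto
  also have "\<dots> \<le> (\<Sum>d=1..n. 1 / real d)"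
  proof (rule abel_sum_le)
    show "(\<Sum>d=1..j. a d) \<le> real j" for j
      unfolding a_def group[symmetric] by (rule sum_degree_div_norm_le)
  qed
  also have "\<dots> \<le> 1 + ln (real n)" by (rule harmonic_sum_le[OF assms(1)])
  finally show ?thesis .
qed

lemma geometric_tail_le:
  fixes q :: real
  assumes "q \<ge> 2" "finite S" "\<And>d. d \<in> S \<Longrightarrow> w < d"
  shows "(\<Sum>d\<in>S. 1 / q ^ d) \<le> 1 / q ^ w"
proof -
  have tail: "(\<Sum>d\<in>{w<..w + n}. 1 / q ^ d) \<le> 1 / q ^ w - 1 / q ^ (w + n)" for n
  proof (induction n)
    case (Suc n)
    have "{w<..w + Suc n} = insert (w + Suc n) {w<..w + n}" by auto
    then have "(\<Sum>d\<in>{w<..w + Suc n}. 1 / q ^ d) =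
        1 / q ^ (w + Suc n) + (\<Sum>d\<in>{w<..w + n}. 1 / q ^ d)" by simp
    moreover have "2 * (1 / q ^ (w + Suc n)) \<le> 1 / q ^ (w + n)"
    proof -
      have "2 * q ^ (w + n) \<le> q * q ^ (w + n)" using assms(1) by (intro mult_right_mono) auto
      then show ?thesis using assms(1) by (simp add: field_simps)
    qed
    ultimately show ?case using Suc.IH by linarith
  qed simp
  obtain n where n: "\<And>d. d \<in> S \<Longrightarrow> d \<le> n" using finite_nat_set_iff_bounded_le assms(2) by auto
  have "(\<Sum>d\<in>S. 1 / q ^ d) \<le> (\<Sum>d\<in>{w<..w + n}. 1 / q ^ d)"
  proof (rule sum_mono2)
    show "S \<subseteq> {w<..w + n}"
    proof
      fix d assume "d \<in> S"
      then show "d \<in> {w<..w + n}" using assms(3)[of d] n[of d] by simp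
    qed
  qed (use assms(1) in auto)
  also have "\<dots> \<le> 1 / q ^ w"
  proof -
    have "0 \<le> 1 / q ^ (w + n)" using assms(1) by simp
    with tail[of n] show ?thesis by linarith
  qed
  finally show ?thesis .
qed

text \<open>At most \<open>q^d\<close> monic irreducibles have degree \<open>d\<close>, so degree
  \<open>d\<close> contributes at most \<open>q^(-d)\<close>.\<close>

lemma sum_inverse_norm_square_le:
  fixes F :: "'a::{field,finite} poly set"
  assumes fin: "finite F" and F: "F \<subseteq> monic_irreducibles" "\<And>P. P \<in> F \<Longrightarrow> w < degree P"
  shows "(\<Sum>P\<in>F. 1 / poly_norm P ^ 2) \<le> 1 / real CARD('a) ^ w"
proof -
  let ?q = "real CARD('a)"
  have q: "?q \<ge> 2" using card_finite_field_gt_1[where 'a='a] by simp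
  have "(\<Sum>P\<in>F. 1 / poly_norm P ^ 2) = (\<Sum>d\<in>degree ` F. \<Sum>P\<in>{P \<in> F. degree P = d}. 1 / poly_norm P ^ 2)"
    by (rule sum.image_gen[OF fin])
  also have "\<dots> \<le> (\<Sum>d\<in>degree ` F. 1 / ?q ^ d)"
  proof (rule sum_mono)
    fix d
    have "(\<Sum>P\<in>{P \<in> F. degree P = d}. 1 / poly_norm P ^ 2) =
        real (card {P \<in> F. degree P = d}) * (1 / (?q ^ d) ^ 2)"
      by (simp add: poly_norm_def)
    also have "\<dots> \<le> ?q ^ d * (1 / (?q ^ d) ^ 2)"
    proof (rule mult_right_mono)
      have "card {P \<in> F. degree P = d} \<le> card {P \<in> (monic_irreducibles :: 'a poly set). degree P = d}"
        using F by (intro card_mono finite_subset[OF _ finite_monic_irreducibles_le[of d]]) auto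
      also have "\<dots> \<le> CARD('a) ^ d" by (rule card_monic_irreducibles_degree)
      finally show "real (card {P \<in> F. degree P = d}) \<le> ?q ^ d"
        by (metis of_nat_le_iff of_nat_power)
    qed simp
    also have "\<dots> = 1 / ?q ^ d" by (simp add: power2_eq_square)
    finally show "(\<Sum>P\<in>{P \<in> F. degree P = d}. 1 / poly_norm P ^ 2) \<le> 1 / ?q ^ d" .
  qed
  also have "\<dots> \<le> 1 / ?q ^ w" using fin F q by (intro geometric_tail_le) auto
  finally show ?thesis .
qed

text \<open>Distinct monic irreducible divisors of \<open>R\<close> number at most
  \<open>degree R\<close>, and each contributes at most \<open>q^(-w)\<close>.\<close>

lemma sum_inverse_norm_divisors_tail:
  fixes R :: "'a::{field,finite} poly"
  assumes "finite F" "F \<subseteq> monic_irreducibles" "\<And>P. P \<in> F \<Longrightarrow> P dvd R" "R \<noteq> 0"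
    and w: "\<And>P. P \<in> F \<Longrightarrow> w \<le> degree P"
  shows "(\<Sum>P\<in>F. 1 / poly_norm P) \<le> real (degree R) / real CARD('a) ^ w"
proof -
  let ?q = "real CARD('a)"
  have q: "?q \<ge> 1" using card_finite_field_gt_1[where 'a='a] by simp
  have "card F \<le> (\<Sum>P\<in>F. degree P)"
    using sum_mono[of F "\<lambda>_. 1" degree] assms(2) monic_irreducibleD(4) by (auto simp: Suc_le_eq subset_iff)
  also have "\<dots> \<le> degree R" by (rule sum_degree_le_of_dvd[OF assms(1-4)])
  finally have card: "card F \<le> degree R" .
  have "(\<Sum>P\<in>F. 1 / poly_norm P) \<le> (\<Sum>P\<in>F. 1 / ?q ^ w)"
    unfolding poly_norm_def using w q by (intro sum_mono divide_left_mono power_increasing) auto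
  also have "\<dots> = real (card F) / ?q ^ w" by simp
  also have "\<dots> \<le> real (degree R) / ?q ^ w" using card by (intro divide_right_mono) auto
  finally show ?thesis .
qed

text \<open>Mertens' bound covers degrees up to \<open>l\<close>, the number of divisors the rest.
  With \<open>q^l\<close> of the order of \<open>degree R\<close> the total is only doubly
  logarithmic in that degree.\<close>

lemma sum_inverse_norm_divisors:
  fixes R :: "'a::{field,finite} poly"
  assumes F: "finite F" "F \<subseteq> monic_irreducibles" "\<And>P. P \<in> F \<Longrightarrow> P dvd R" "R \<noteq> 0"
    and l: "l \<ge> 1"
  shows "(\<Sum>P\<in>F. 1 / poly_norm P) \<le> 1 + ln (real l) + real (degree R) / real CARD('a) ^ l"
proof -
  have "(\<Sum>P\<in>F. 1 / poly_norm P) = (\<Sum>P\<in>{P \<in> F. degree P \<le> l}. 1 / poly_norm P) +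
      (\<Sum>P\<in>{P \<in> F. \<not> degree P \<le> l}. 1 / poly_norm P)"
    using F(1) by (subst sum.union_disjoint[symmetric]) (auto intro: sum.cong)
  also have "\<dots> \<le> (1 + ln (real l)) + real (degree R) / real CARD('a) ^ l"
    using F by (intro add_mono sum_inverse_norm_le sum_inverse_norm_divisors_tail l) auto
  finally show ?thesis by simp
qed

subsection \<open>Large irreducibles\<close>

text \<open>The inequalities say that \<open>s\<close> is \<open>m / p\<close> rounded up.
  Polynomials of derivative \<open>0\<close> are \<open>p\<close>-th powers, and
  \<open>c ^ p\<close> has degree below \<open>m\<close> exactly when \<open>c\<close> has degree
  below \<open>s\<close>.\<close>

lemma pth_powers_below:
  fixes m s :: nat
  assumes s: "CHAR('a) * (s - 1) < m" "m \<le> CHAR('a) * s"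
  defines "W \<equiv> {a \<in> polys_below m. pderiv (a::'a::{field,finite} poly) = 0}"
  shows "card W = CARD('a) ^ s" and "\<And>a. a \<in> W \<Longrightarrow> \<exists>c \<in> polys_below s. a = c ^ CHAR('a)"
proof -
  let ?p = "CHAR('a)"
  have p: "prime ?p" by (rule prime_CHAR_finite_field)
  have pp: "prime CHAR('a poly)" using p by simp
  have p0: "?p > 0" using p prime_gt_0_nat by blast
  have deriv0: "pderiv (c ^ ?p) = 0" for c :: "'a poly"
    by (simp add: pderiv_power)
  have Wc: "\<exists>c \<in> polys_below s. a = c ^ ?p" if a: "a \<in> W" for a
  proof -
    obtain c where c: "a = c ^ ?p"
      using poly_eq_pth_power_finite_field[of a] a by (auto simp: W_def)
    have "c \<in> polys_below s"
    proof (cases "c = 0")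
      case False
      then have "degree a = ?p * degree c" "a \<noteq> 0" unfolding c by (simp_all add: degree_power_eq)
      moreover have "a = 0 \<or> degree a < m" using a by (simp add: W_def polys_below_iff)
      ultimately have "?p * degree c < ?p * s" using s(2) by linarith
      then show ?thesis by (simp add: polys_below_iff)
    qed simp
    with c show ?thesis by blast
  qed
  then show "\<And>a. a \<in> W \<Longrightarrow> \<exists>c \<in> polys_below s. a = c ^ ?p" .
  have "W = (\<lambda>c. c ^ ?p) ` polys_below s"
  proof (intro equalityI subsetI)
    fix a :: "'a poly" assume "a \<in> (\<lambda>c. c ^ ?p) ` polys_below s"
    then obtain c where c: "c \<in> polys_below s" "a = c ^ ?p" by auto
    have "a \<in> polys_below m"
    proof (cases "c = 0")
      case True
      then show ?thesis using p0 by (simp add: c(2) power_0_left)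
    next
      case False
      then have "degree c \<le> s - 1" using c(1) by (auto simp: polys_below_iff)
      then have "?p * degree c \<le> ?p * (s - 1)" by (rule mult_le_mono2)
      also note s(1)
      finally have "degree a < m" unfolding c(2) degree_power_eq[OF False] by (simp only: mult.commute)
      then show ?thesis by (simp add: polys_below_iff)
    qed
    then show "a \<in> W" using deriv0 by (simp add: W_def c)
  next
    fix a :: "'a poly" assume "a \<in> W"
    with Wc show "a \<in> (\<lambda>c. c ^ ?p) ` polys_below s" by blast
  qed
  moreover have "inj_on (\<lambda>c. c ^ ?p) (polys_below s :: 'a poly set)"
  proof (rule inj_onI)
    fix c d :: "'a poly" assume eq: "c ^ ?p = d ^ ?p"
    have "((c - d) + d) ^ ?p = (c - d) ^ ?p + d ^ ?p"
      by (rule freshmans_dream) (use pp in auto)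
    with eq have "(c - d) ^ ?p = 0" by simp
    then show "c = d" by simp
  qed
  ultimately show "card W = CARD('a) ^ s" by (simp add: card_image card_polys_below)
qed

lemma card_pderiv_fibre:
  fixes N b :: "'a::{field,finite} poly"
  assumes s: "CHAR('a) * (s - 1) < m" "m \<le> CHAR('a) * s" and b: "b \<in> short_interval N m"
  shows "card {c \<in> short_interval N m. pderiv c = pderiv b} = CARD('a) ^ s"
proof -
  have "{c \<in> short_interval N m. pderiv c = pderiv b} =
      (+) b ` {a \<in> polys_below m. pderiv a = 0}"
  proof (intro equalityI subsetI)
    fix c assume c: "c \<in> {c \<in> short_interval N m. pderiv c = pderiv b}"
    then have "(c - N) - (b - N) \<in> polys_below m"
      using b by (intro polys_below_diff[of "c - N" m "b - N"]) (auto simp: short_interval_iff)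
    then have "c - b \<in> {a \<in> polys_below m. pderiv a = 0}" using c by (simp add: pderiv_diff)
    then show "c \<in> (+) b ` {a \<in> polys_below m. pderiv a = 0}"
      by (intro image_eqI[of _ _ "c - b"]) auto
  next
    fix c assume "c \<in> (+) b ` {a \<in> polys_below m. pderiv a = 0}"
    then obtain a where a: "a \<in> polys_below m" "pderiv a = 0" "c = b + a" by auto
    then have "(b - N) + a \<in> polys_below m"
      using b by (intro polys_below_add[of "b - N" m a]) (auto simp: short_interval_iff)
    then show "c \<in> {c \<in> short_interval N m. pderiv c = pderiv b}"
      using a by (simp add: short_interval_iff pderiv_add algebra_simps)
  qed
  then show ?thesis using pth_powers_below(1)[OF s] by (simp add: card_image)
qed

text \<open>Two elements of a fibre differ by some \<open>d ^ p\<close> with \<open>d\<close> of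
  degree below \<open>s \<le> degree P\<close>. If \<open>P\<close> divides this, it divides
  \<open>d\<close>, so \<open>d = 0\<close>; thus a fibre injects into the classes modulo
  \<open>P\<close>.\<close>

lemma card_square_divisible_in_fibre:
  fixes g :: "'a::{field,finite} poly poly"
  assumes sf: "squarefree g" and P: "P \<in> monic_irreducibles" and deg: "s \<le> degree P"
    and s: "CHAR('a) * (s - 1) < m" "m \<le> CHAR('a) * s"
  shows "card {b \<in> short_interval N m. pderiv b = u \<and> P ^ 2 dvd poly g b} \<le> degree g"
proof -
  let ?A = "{b \<in> short_interval N m. pderiv b = u \<and> P ^ 2 dvd poly g b}"
  note PD = monic_irreducibleD[OF P]
  have "inj_on (\<lambda>b. b mod P) ?A"
  proof (rule inj_onI)
    fix b c assume bc: "b \<in> ?A" "c \<in> ?A" "b mod P = c mod P"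
    have "(b - N) - (c - N) \<in> polys_below m"
      using bc by (intro polys_below_diff[of "b - N" m "c - N"]) (auto simp: short_interval_iff)
    then have "b - c \<in> {a \<in> polys_below m. pderiv a = 0}" using bc by (simp add: pderiv_diff)
    then obtain d where d: "d \<in> polys_below s" "b - c = d ^ CHAR('a)"
      using pth_powers_below(2)[OF s] by blast
    have "P dvd d ^ CHAR('a)" using bc(3) d(2) by (metis mod_eq_dvd_iff)
    then have "P dvd d" using PD(2) prime_elem_dvd_power by metis
    moreover have "d = 0 \<or> degree d < degree P" using d(1) deg by (auto simp: polys_below_iff)
    ultimately have "d = 0" using dvd_imp_degree_le[of P d] by (metis leD)
    then have "b - c = 0"
      using d(2) prime_gt_0_nat[OF prime_CHAR_finite_field[where 'a='a]] by simp
    then show "b = c" by simp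
  qed
  then have "card ?A = card ((\<lambda>b. b mod P) ` ?A)" by (simp add: card_image)
  also have "\<dots> \<le> card ((\<lambda>a. a mod P) ` {a. P ^ 2 dvd poly g a})"
    by (rule card_mono[OF card_square_root_classes(1)[OF sf P]]) auto
  also have "\<dots> \<le> degree g" by (rule card_square_root_classes(2)[OF sf P])
  finally show ?thesis .
qed

text \<open>Every such \<open>P\<close> divides the eliminant \<open>R\<close> for \<open>u\<close>
  and has degree at least \<open>s\<close>, so \<open>s\<close> times their number is at most
  \<open>degree R\<close>; each \<open>P\<close> accounts for at most \<open>k\<close> elements. The
  factor \<open>s\<close> on the left avoids a division in \<open>nat\<close>.\<close>

lemma card_large_primes_in_good_fibre:
  fixes g :: "'a::{field,finite} poly poly"
  assumes sf: "squarefree g" and gk: "degree g \<le> k" and gn: "\<And>i. degree (coeff g i) \<le> n"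
    and u: "u \<notin> bad_derivs g" and s: "CHAR('a) * (s - 1) < m" "m \<le> CHAR('a) * s"
  shows "s * card {b \<in> short_interval N m. pderiv b = u \<and>
      (\<exists>P\<in>monic_irreducibles. s \<le> degree P \<and> P ^ 2 dvd poly g b)} \<le>
      k * ((2 * k + 1) * (n + degree u))"
proof -
  let ?I = "short_interval N m"
  obtain R where R: "R \<noteq> 0" "degree R \<le> (2 * k + 1) * (n + degree u)"
    and dvdR: "\<And>P a. P dvd poly g a \<Longrightarrow> P dvd poly (total_deriv g u) a \<Longrightarrow> P dvd R"
    using singular_primes_divide[OF sf gk gn u] by metis
  define Q where "Q = {P \<in> monic_irreducibles. P dvd R \<and> s \<le> degree P}"
  have finQ: "finite Q"
    using finite_irreducible_divisors[OF R(1)] by (rule finite_subset[rotated]) (auto simp: Q_def)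
  have "{b \<in> ?I. pderiv b = u \<and> (\<exists>P\<in>monic_irreducibles. s \<le> degree P \<and> P ^ 2 dvd poly g b)} \<subseteq>
      (\<Union>P\<in>Q. {b \<in> ?I. pderiv b = u \<and> P ^ 2 dvd poly g b})"
  proof
    fix b assume "b \<in> {b \<in> ?I. pderiv b = u \<and>
      (\<exists>P\<in>monic_irreducibles. s \<le> degree P \<and> P ^ 2 dvd poly g b)}"
    then obtain P where b: "b \<in> ?I" "pderiv b = u"
      and P: "P \<in> monic_irreducibles" "s \<le> degree P" "P ^ 2 dvd poly g b" by auto
    have "P dvd poly g b" using P(3) by (metis dvd_mult_left power2_eq_square)
    moreover have "P dvd poly (total_deriv g u) b"
      using dvd_pderiv_of_square_dvd[OF P(3)] b(2) by (simp add: pderiv_poly_eq_total_deriv)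
    ultimately have "P dvd R" by (rule dvdR)
    then have "P \<in> Q" using P by (simp add: Q_def)
    then show "b \<in> (\<Union>P\<in>Q. {b \<in> ?I. pderiv b = u \<and> P ^ 2 dvd poly g b})"
      using b P(3) by (intro UN_I[of P]) auto
  qed
  then have "card {b \<in> ?I. pderiv b = u \<and> (\<exists>P\<in>monic_irreducibles. s \<le> degree P \<and> P ^ 2 dvd poly g b)} \<le>
      card (\<Union>P\<in>Q. {b \<in> ?I. pderiv b = u \<and> P ^ 2 dvd poly g b})"
    using finQ finite_short_interval[of N m] by (intro card_mono) auto
  also have "\<dots> \<le> (\<Sum>P\<in>Q. card {b \<in> ?I. pderiv b = u \<and> P ^ 2 dvd poly g b})"
    by (rule card_UN_le[OF finQ])
  also have "\<dots> \<le> (\<Sum>P\<in>Q. k)"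
  proof (rule sum_mono)
    fix P assume "P \<in> Q"
    then have "P \<in> monic_irreducibles" "s \<le> degree P" by (auto simp: Q_def)
    from card_square_divisible_in_fibre[OF sf this s, of N u] gk
    show "card {b \<in> ?I. pderiv b = u \<and> P ^ 2 dvd poly g b} \<le> k" by simp
  qed
  also have "\<dots> = card Q * k" by simp
  finally have 1: "card {b \<in> ?I. pderiv b = u \<and>
      (\<exists>P\<in>monic_irreducibles. s \<le> degree P \<and> P ^ 2 dvd poly g b)} \<le> card Q * k" .
  have "card Q * s = (\<Sum>P\<in>Q. s)" by simp
  also have "\<dots> \<le> (\<Sum>P\<in>Q. degree P)" by (rule sum_mono) (simp add: Q_def)
  also have "\<dots> \<le> degree R"
    by (rule sum_degree_le_of_dvd[OF finQ _ _ R(1)]) (auto simp: Q_def)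
  also note R(2)
  finally have 2: "card Q * s \<le> (2 * k + 1) * (n + degree u)" .
  have "s * card {b \<in> ?I. pderiv b = u \<and>
      (\<exists>P\<in>monic_irreducibles. s \<le> degree P \<and> P ^ 2 dvd poly g b)} \<le> s * (card Q * k)"
    using 1 by (rule mult_le_mono2)
  also have "\<dots> = k * (card Q * s)" by (simp add: mult_ac)
  also have "\<dots> \<le> k * ((2 * k + 1) * (n + degree u))" using 2 by (rule mult_le_mono2)
  finally show ?thesis .
qed

text \<open>The at most \<open>k\<close> bad fibres are counted in full, with \<open>q^s\<close>
  elements each; the good ones, at most \<open>q^(m - s)\<close> in number, by elimination.
  Derivatives of elements of the interval have degree at most \<open>degree N + m\<close>.\<close>

lemma card_large_primes:
  fixes g :: "'a::{field,finite} poly poly"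
  assumes sf: "squarefree g" and gk: "degree g \<le> k" and gn: "\<And>i. degree (coeff g i) \<le> n"
    and s: "CHAR('a) * (s - 1) < m" "m \<le> CHAR('a) * s" "s \<le> m"
  shows "s * card {b \<in> short_interval N m.
      \<exists>P\<in>monic_irreducibles. s \<le> degree P \<and> P ^ 2 dvd poly g b} \<le>
      s * (k * CARD('a) ^ s) +
      CARD('a) ^ (m - s) * (k * ((2 * k + 1) * (n + (degree N + m))))"
proof -
  let ?I = "short_interval N m"
  let ?L = "\<lambda>b. \<exists>P\<in>monic_irreducibles. s \<le> degree P \<and> P ^ 2 dvd poly g b"
  let ?q = "CARD('a)"
  define U where "U = pderiv ` ?I"
  define D where "D = k * ((2 * k + 1) * (n + (degree N + m)))"
  note finI = finite_short_interval[of N m]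
  have finU: "finite U" unfolding U_def using finI by simp
  have fibre: "card {b \<in> ?I. pderiv b = u} = ?q ^ s" if "u \<in> U" for u
    using that card_pderiv_fibre[OF s(1,2), of _ N] by (auto simp: U_def)
  have degU: "degree u \<le> degree N + m" if u: "u \<in> U" for u
  proof -
    obtain b where b: "b \<in> ?I" "u = pderiv b" using u unfolding U_def by blast
    have "degree (N + (b - N)) \<le> degree N + m"
      using b(1) by (intro degree_add_le) (auto simp: short_interval_iff polys_below_iff)
    then show ?thesis using b(2) degree_pderiv_le[of b] by simp
  qed
  have "card ?I = (\<Sum>u\<in>U. card {b \<in> ?I. pderiv b = u})"
    using sum.image_gen[OF finI, of "\<lambda>_. 1::nat" pderiv] by (simp add: U_def)
  also have "\<dots> = card U * ?q ^ s" using fibre by simp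
  finally have "card U * ?q ^ s = ?q ^ m" by (simp add: card_short_interval)
  also have "\<dots> = ?q ^ (m - s) * ?q ^ s" using s(3) by (simp flip: power_add)
  finally have cardU: "card U = ?q ^ (m - s)" by simp
  have "card {b \<in> ?I. ?L b} = (\<Sum>u\<in>pderiv ` {b \<in> ?I. ?L b}. card {b \<in> {b \<in> ?I. ?L b}. pderiv b = u})"
    using sum.image_gen[of "{b \<in> ?I. ?L b}" "\<lambda>_. 1::nat" pderiv] finI by simp
  also have "\<dots> \<le> (\<Sum>u\<in>U. card {b \<in> {b \<in> ?I. ?L b}. pderiv b = u})"
    by (rule sum_mono2[OF finU]) (auto simp: U_def)
  also have "\<dots> = (\<Sum>u\<in>U. card {b \<in> ?I. pderiv b = u \<and> ?L b})"
    by (intro sum.cong arg_cong[of _ _ card]) auto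
  also have "\<dots> = (\<Sum>u\<in>U \<inter> bad_derivs g. card {b \<in> ?I. pderiv b = u \<and> ?L b}) +
      (\<Sum>u\<in>U - bad_derivs g. card {b \<in> ?I. pderiv b = u \<and> ?L b})"
    by (rule sum.Int_Diff[OF finU])
  finally have "s * card {b \<in> ?I. ?L b} \<le>
      s * ((\<Sum>u\<in>U \<inter> bad_derivs g. card {b \<in> ?I. pderiv b = u \<and> ?L b}) +
      (\<Sum>u\<in>U - bad_derivs g. card {b \<in> ?I. pderiv b = u \<and> ?L b}))"
    by (rule mult_le_mono2)
  then have split: "s * card {b \<in> ?I. ?L b} \<le>
      s * (\<Sum>u\<in>U \<inter> bad_derivs g. card {b \<in> ?I. pderiv b = u \<and> ?L b}) +
      s * (\<Sum>u\<in>U - bad_derivs g. card {b \<in> ?I. pderiv b = u \<and> ?L b})"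
    by (simp only: add_mult_distrib2)
  have "(\<Sum>u\<in>U \<inter> bad_derivs g. card {b \<in> ?I. pderiv b = u \<and> ?L b}) \<le>
      (\<Sum>u\<in>U \<inter> bad_derivs g. ?q ^ s)"
  proof (rule sum_mono)
    fix u assume u: "u \<in> U \<inter> bad_derivs g"
    have "card {b \<in> ?I. pderiv b = u \<and> ?L b} \<le> card {b \<in> ?I. pderiv b = u}"
      using finI by (intro card_mono) auto
    with fibre[of u] u show "card {b \<in> ?I. pderiv b = u \<and> ?L b} \<le> ?q ^ s" by simp
  qed
  also have "\<dots> = card (U \<inter> bad_derivs g) * ?q ^ s" by simp
  also have "\<dots> \<le> k * ?q ^ s"
  proof (rule mult_le_mono1)
    have "card (U \<inter> bad_derivs g) \<le> card (bad_derivs g)"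
      using card_bad_derivs(1)[OF sf] by (intro card_mono) auto
    then show "card (U \<inter> bad_derivs g) \<le> k" using card_bad_derivs(2)[OF sf] gk by linarith
  qed
  finally have bad: "s * (\<Sum>u\<in>U \<inter> bad_derivs g. card {b \<in> ?I. pderiv b = u \<and> ?L b}) \<le> s * (k * ?q ^ s)"
    by (rule mult_le_mono2)
  have "s * (\<Sum>u\<in>U - bad_derivs g. card {b \<in> ?I. pderiv b = u \<and> ?L b}) =
      (\<Sum>u\<in>U - bad_derivs g. s * card {b \<in> ?I. pderiv b = u \<and> ?L b})"
    by (rule sum_distrib_left)
  also have "\<dots> \<le> (\<Sum>u\<in>U - bad_derivs g. D)"
  proof (rule sum_mono)
    fix u assume u: "u \<in> U - bad_derivs g"
    then have "s * card {b \<in> ?I. pderiv b = u \<and> ?L b} \<le> k * ((2 * k + 1) * (n + degree u))"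
      using card_large_primes_in_good_fibre[OF sf gk gn _ s(1,2)] by simp
    also have "\<dots> \<le> D" unfolding D_def using degU[of u] u by (intro mult_le_mono2) auto
    finally show "s * card {b \<in> ?I. pderiv b = u \<and> ?L b} \<le> D" .
  qed
  also have "\<dots> = card (U - bad_derivs g) * D" by simp
  also have "\<dots> \<le> card U * D" using finU by (intro mult_le_mono1 card_mono) auto
  finally have good: "s * (\<Sum>u\<in>U - bad_derivs g. card {b \<in> ?I. pderiv b = u \<and> ?L b}) \<le>
      ?q ^ (m - s) * D" by (simp only: cardU)
  show ?thesis using split bad good unfolding D_def by linarith
qed

subsection \<open>The Euler product\<close>

lemma weierstrass_product_ge:
  fixes x :: "'i \<Rightarrow> real"
  assumes "finite A" "\<And>i. i \<in> A \<Longrightarrow> 0 \<le> x i \<and> x i \<le> 1"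
  shows "1 - (\<Sum>i\<in>A. x i) \<le> (\<Prod>i\<in>A. 1 - x i)"
  using assms
proof (induction A rule: finite_induct)
  case (insert a A)
  define p where "p = (\<Prod>i\<in>A. 1 - x i)"
  have p: "p \<le> 1" unfolding p_def using insert.prems by (auto intro!: prod_le_1)
  have "x a * p \<le> x a * 1" using p insert.prems by (intro mult_left_mono) auto
  moreover have "1 - (\<Sum>i\<in>A. x i) \<le> p" using insert by (simp add: p_def)
  moreover have "(\<Prod>i\<in>insert a A. 1 - x i) = p - x a * p"
    using insert.hyps by (simp add: p_def algebra_simps)
  ultimately show ?case using insert.hyps by simp
qed simp

lemma exp_neg_double_le:
  fixes x :: real
  assumes "0 \<le> x" "x \<le> 1 / 2"
  shows "exp (- (2 * x)) \<le> 1 - x"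
proof -
  have "(1 - x) * (1 + 2 * x) - 1 = x * (1 - 2 * x)" by (simp add: algebra_simps)
  also have "\<dots> \<ge> 0" using assms by simp
  finally have "1 \<le> (1 - x) * (1 + 2 * x)" by simp
  also have "\<dots> \<le> (1 - x) * exp (2 * x)"
    using assms exp_ge_add_one_self[of "2 * x"] by (intro mult_left_mono) auto
  finally have "1 * exp (- (2 * x)) \<le> (1 - x) * exp (2 * x) * exp (- (2 * x))"
    by (rule mult_right_mono) simp
  then show ?thesis by (simp only: mult.assoc exp_minus_inverse) simp
qed

text \<open>At most \<open>k\<close> derivatives are bad, but \<open>q^k > k\<close> polynomials lie
  in \<open>polys_below k\<close>, so some \<open>u\<close> of small degree is good. All
  \<open>P\<close> not dividing its eliminant are nonsingular.\<close>

lemma squarefree_obtain_singular_divisor: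
  fixes g :: "'a::{field,finite} poly poly"
  assumes sf: "squarefree g" and gk: "degree g \<le> k" and gn: "\<And>i. degree (coeff g i) \<le> n"
  obtains R where "R \<noteq> 0" "degree R \<le> (2 * k + 1) * (n + k)"
    "\<And>P. P \<in> monic_irreducibles \<Longrightarrow> \<not> P dvd R \<Longrightarrow> rho g (P ^ 2) \<le> k"
proof -
  have "k < 2 ^ k" by (rule less_exp)
  also have "(2::nat) ^ k \<le> CARD('a) ^ k"
    using card_finite_field_gt_1[where 'a='a] by (intro power_mono) auto
  finally have "card (bad_derivs g) < card (polys_below k :: 'a poly set)"
    using card_bad_derivs(2)[OF sf] gk by (simp add: card_polys_below)
  then have "\<not> polys_below k \<subseteq> bad_derivs g"
    using card_mono[OF card_bad_derivs(1)[OF sf], of "polys_below k"] by linarith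
  then obtain u where u: "u \<in> polys_below k" "u \<notin> bad_derivs g" by blast
  have du: "degree u \<le> k" using u(1) by (auto simp: polys_below_iff)
  obtain R where R: "R \<noteq> 0" "degree R \<le> (2 * k + 1) * (n + degree u)"
    and dvdR: "\<And>P a. P dvd poly g a \<Longrightarrow> P dvd poly (total_deriv g u) a \<Longrightarrow> P dvd R"
    using singular_primes_divide[OF sf gk gn u(2)] by metis
  show ?thesis
  proof (rule that)
    show "R \<noteq> 0" by (rule R)
    have "(2 * k + 1) * (n + degree u) \<le> (2 * k + 1) * (n + k)"
      using du by (intro mult_le_mono2) simp
    with R(2) show "degree R \<le> (2 * k + 1) * (n + k)" by linarith
    fix P assume P: "P \<in> monic_irreducibles" "\<not> P dvd R"
    have "rho g (P ^ 2) \<le> degree g"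
      by (rule rho_square_le_nonsingular[OF sf P(1), of u]) (use dvdR P(2) in blast)
    then show "rho g (P ^ 2) \<le> k" using gk by linarith
  qed
qed

section \<open>Densities and vanishing factors\<close>

lemma sq_density_le:
  assumes "squarefree g" "degree g \<le> k" "P \<in> monic_irreducibles"
  shows "sq_density g P \<le> real k * (1 / poly_norm P)"
proof -
  have "rho g (P ^ 2) \<le> k * CARD('a) ^ degree P"
    using rho_square_le[OF assms(1,3)] mult_le_mono1[OF assms(2)] by (rule order_trans)
  then have "real (rho g (P ^ 2)) \<le> real (k * CARD('a) ^ degree P)" by (rule of_nat_mono)
  then have "real (rho g (P ^ 2)) \<le> real k * poly_norm P" by (simp add: poly_norm_def)
  then have "sq_density g P \<le> real k * poly_norm P / poly_norm P ^ 2"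
    unfolding sq_density_def by (rule divide_right_mono) simp
  then show ?thesis using poly_norm_pos[of P] by (simp add: power2_eq_square)
qed

lemma sq_density_le_nonsingular:
  assumes "rho g (P ^ 2) \<le> k"
  shows "sq_density g P \<le> real k * (1 / poly_norm P ^ 2)"
  using assms by (simp add: sq_density_def divide_right_mono)

lemma prod_one_minus_sq_density_bounds:
  assumes "F \<subseteq> monic_irreducibles"
  shows "0 \<le> (\<Prod>P\<in>F. 1 - sq_density g P)" "(\<Prod>P\<in>F. 1 - sq_density g P) \<le> 1"
proof -
  have "0 \<le> sq_density g P \<and> sq_density g P \<le> 1" if "P \<in> F" for P
    using that assms monic_irreducibleD(3)[of P] sq_density_nonneg sq_density_le_1 by blast
  then show "0 \<le> (\<Prod>P\<in>F. 1 - sq_density g P)" "(\<Prod>P\<in>F. 1 - sq_density g P) \<le> 1"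
    by (auto intro!: prod_nonneg prod_le_1)
qed

lemma c_const_tendsto_sq_density:
  "((\<lambda>F. \<Prod>P\<in>F. 1 - sq_density g P) \<longlongrightarrow> c_const g) (finite_subsets_at_top monic_irreducibles)"
  using c_const_tendsto[of g] by (simp add: sq_density_def)

lemma c_const_eq_0:
  assumes "P \<in> monic_irreducibles" "sq_density g P = 1"
  shows "c_const g = 0"
proof -
  have "eventually (\<lambda>F. (\<Prod>P\<in>F. 1 - sq_density g P) = 0) (finite_subsets_at_top monic_irreducibles)"
    unfolding eventually_finite_subsets_at_top
  proof (intro exI[of _ "{P}"] conjI allI impI)
    fix F assume "finite F \<and> {P} \<subseteq> F \<and> F \<subseteq> monic_irreducibles"
    then show "(\<Prod>P\<in>F. 1 - sq_density g P) = 0" using assms(2) by (intro prod_zero) auto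
  qed (use assms in auto)
  then have "((\<lambda>F. \<Prod>P\<in>F. 1 - sq_density g P) \<longlongrightarrow> 0) (finite_subsets_at_top monic_irreducibles)"
    by (rule tendsto_eventually)
  then show ?thesis
    using tendsto_unique[OF _ c_const_tendsto_sq_density[of g]] by simp
qed

text \<open>Every class modulo \<open>P ^ 2\<close> is then a root, so \<open>P ^ 2\<close> is a
  fixed divisor of the values.\<close>

lemma not_squarefree_if_sq_density_1:
  fixes g :: "'a::{field,finite} poly poly"
  assumes P: "P \<in> monic_irreducibles" and d: "sq_density g P = 1"
  shows "\<not> squarefree (poly g b)"
proof -
  have P0: "P ^ 2 \<noteq> 0" using monic_irreducibleD(3)[OF P] by simp
  let ?X = "polys_below (degree (P ^ 2)) :: 'a poly set"
  have "real (rho g (P ^ 2)) = poly_norm P ^ 2"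
    using d poly_norm_pos[of P] by (simp add: sq_density_def)
  also have "\<dots> = real (card ?X)"
    using monic_irreducibleD(3)[OF P]
    by (simp add: poly_norm_def card_polys_below degree_power_eq power_mult mult.commute flip: power_mult)
  finally have "card {r \<in> ?X. P ^ 2 dvd poly g r} = card ?X"
    using rho_eq_card[OF P0, of g] by simp
  then have "{r \<in> ?X. P ^ 2 dvd poly g r} = ?X"
    by (intro card_subset_eq finite_polys_below) auto
  then have "P ^ 2 dvd poly g (b mod P ^ 2)" using mod_in_polys_below[OF P0, of b] by blast
  then have "P ^ 2 dvd poly g b" by (simp only: dvd_poly_mod_iff)
  then show ?thesis
    using monic_irreducibleD(1)[OF P] irreducible_not_unit squarefreeD by metis
qed

lemma small_norm_finite:
  "finite {P \<in> (monic_irreducibles :: 'a::{field,finite} poly set). poly_norm P \<le> real K}"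
proof (rule finite_subset[OF _ finite_monic_irreducibles_le[of K]])
  show "{P \<in> (monic_irreducibles :: 'a poly set). poly_norm P \<le> real K} \<subseteq>
      {P \<in> monic_irreducibles. degree P \<le> K}"
  proof
    fix P assume P: "P \<in> {P \<in> (monic_irreducibles :: 'a poly set). poly_norm P \<le> real K}"
    have "degree P < 2 ^ degree P" by (rule less_exp)
    also have "\<dots> \<le> CARD('a) ^ degree P"
      using card_finite_field_gt_1[where 'a='a] by (intro power_mono) auto
    also have "\<dots> \<le> K"
    proof -
      have "real (CARD('a) ^ degree P) \<le> real K" using P by (simp add: poly_norm_def)
      then show ?thesis by (simp only: of_nat_le_iff)
    qed
    finally show "P \<in> {P \<in> monic_irreducibles. degree P \<le> K}" using P by simp
  qed
qed

text \<open>For \<open>poly_norm P \<le> 2 * k\<close>, a factor other than \<open>0\<close> is at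
  least \<open>1 / poly_norm P ^ 2\<close>, as \<open>rho\<close> is an integer, and the number of
  such \<open>P\<close> depends only on \<open>q\<close> and \<open>k\<close>. For larger
  \<open>P\<close> the density is at most \<open>1 / 2\<close>, where
  \<open>1 - x \<ge> exp (- 2 * x)\<close>.\<close>

lemma prod_one_minus_sq_density_ge:
  fixes g :: "'a::{field,finite} poly poly"
  assumes sf: "squarefree g" and gk: "degree g \<le> k" and k0: "k > 0"
    and F: "finite F" "F \<subseteq> monic_irreducibles" "\<And>P. P \<in> F \<Longrightarrow> sq_density g P \<noteq> 1"
  shows "(1 / real (2 * k) ^ 2) ^ card {P \<in> (monic_irreducibles :: 'a poly set). poly_norm P \<le> real (2 * k)}
    * exp (- 2 * (\<Sum>P\<in>F. sq_density g P)) \<le> (\<Prod>P\<in>F. 1 - sq_density g P)"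
proof -
  let ?x = "sq_density g"
  let ?M = "{P \<in> (monic_irreducibles :: 'a poly set). poly_norm P \<le> real (2 * k)}"
  define c where "c = 1 / real (2 * k) ^ 2"
  have "1 \<le> real (2 * k) ^ 2" using k0 by (intro one_le_power) simp
  then have c: "0 < c" "c \<le> 1" using k0 by (auto simp: c_def)
  have small: "c \<le> 1 - ?x P" if "P \<in> F" "P \<in> ?M" for P
  proof -
    have P: "P \<in> monic_irreducibles" "poly_norm P \<le> real (2 * k)" using that by auto
    have n: "poly_norm P ^ 2 = real (CARD('a) ^ (2 * degree P))"
      by (simp add: poly_norm_def mult.commute flip: power_mult)
    have "real (rho g (P ^ 2)) \<le> poly_norm P ^ 2"
      using sq_density_le_1[OF monic_irreducibleD(3)[OF P(1)], of g] poly_norm_pos[of P]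
      by (simp add: sq_density_def)
    moreover have "real (rho g (P ^ 2)) \<noteq> poly_norm P ^ 2"
      using F(3)[OF that(1)] poly_norm_pos[of P] by (auto simp: sq_density_def)
    ultimately have "rho g (P ^ 2) < CARD('a) ^ (2 * degree P)"
      unfolding n by (simp only: of_nat_le_iff of_nat_eq_iff le_neq_implies_less)
    then have "Suc (rho g (P ^ 2)) \<le> CARD('a) ^ (2 * degree P)" by (rule Suc_leI)
    then have "real (Suc (rho g (P ^ 2))) \<le> real (CARD('a) ^ (2 * degree P))" by (rule of_nat_mono)
    then have "1 \<le> poly_norm P ^ 2 - real (rho g (P ^ 2))" unfolding n by simp
    then have "1 / poly_norm P ^ 2 \<le> (poly_norm P ^ 2 - real (rho g (P ^ 2))) / poly_norm P ^ 2"
      by (intro divide_right_mono) auto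
    also have "\<dots> = 1 - ?x P" using poly_norm_pos[of P] by (simp add: sq_density_def diff_divide_distrib)
    also have "c \<le> 1 / poly_norm P ^ 2"
      unfolding c_def using P(2) poly_norm_pos[of P] by (intro divide_left_mono power_mono) auto
    ultimately show ?thesis by linarith
  qed
  have large: "exp (- (2 * ?x P)) \<le> 1 - ?x P" if "P \<in> F" "P \<notin> ?M" for P
  proof (rule exp_neg_double_le)
    have P: "P \<in> monic_irreducibles" "poly_norm P > real (2 * k)" using that F(2) by auto
    have "?x P \<le> real k / poly_norm P" using sq_density_le[OF sf gk P(1)] by simp
    also have "\<dots> \<le> 1 / 2" using P(2) poly_norm_pos[of P] by (simp add: field_simps)
    finally show "?x P \<le> 1 / 2" .
  qed (rule sq_density_nonneg)
  have "c ^ card ?M * exp (- 2 * (\<Sum>P\<in>F. ?x P)) \<le>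
      c ^ card (F \<inter> ?M) * exp (- 2 * (\<Sum>P\<in>F - ?M. ?x P))"
  proof (rule mult_mono)
    show "c ^ card ?M \<le> c ^ card (F \<inter> ?M)"
      using c card_mono[OF small_norm_finite[of "2 * k"], of "F \<inter> ?M"] by (intro power_decreasing) auto
    have "(\<Sum>P\<in>F - ?M. ?x P) \<le> (\<Sum>P\<in>F. ?x P)"
      using F(1) sq_density_nonneg by (intro sum_mono2) auto
    then show "exp (- 2 * (\<Sum>P\<in>F. ?x P)) \<le> exp (- 2 * (\<Sum>P\<in>F - ?M. ?x P))" by simp
  qed (use c in auto)
  also have "\<dots> = (\<Prod>P\<in>F \<inter> ?M. c) * (\<Prod>P\<in>F - ?M. exp (- (2 * ?x P)))"
    using F(1) by (simp add: exp_sum sum_distrib_left sum_negf[symmetric])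
  also have "\<dots> \<le> (\<Prod>P\<in>F \<inter> ?M. 1 - ?x P) * (\<Prod>P\<in>F - ?M. 1 - ?x P)"
  proof (rule mult_mono)
    show "(\<Prod>P\<in>F \<inter> ?M. c) \<le> (\<Prod>P\<in>F \<inter> ?M. 1 - ?x P)"
    proof (rule prod_mono)
      fix P assume "P \<in> F \<inter> ?M"
      with small c show "0 \<le> c \<and> c \<le> 1 - ?x P" by simp
    qed
    show "(\<Prod>P\<in>F - ?M. exp (- (2 * ?x P))) \<le> (\<Prod>P\<in>F - ?M. 1 - ?x P)"
    proof (rule prod_mono)
      fix P assume "P \<in> F - ?M"
      with large show "0 \<le> exp (- (2 * ?x P)) \<and> exp (- (2 * ?x P)) \<le> 1 - ?x P" by simp
    qed
    show "0 \<le> (\<Prod>P\<in>F \<inter> ?M. 1 - ?x P)"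
      by (rule prod_one_minus_sq_density_bounds) auto
  qed (auto intro: prod_nonneg)
  also have "\<dots> = (\<Prod>P\<in>F. 1 - ?x P)" by (rule prod.Int_Diff[OF F(1), symmetric])
  finally show ?thesis by (simp add: c_def)
qed

text \<open>Nonsingular \<open>P\<close> contribute at most \<open>k / poly_norm P ^ 2\<close>, the
  divisors of \<open>R\<close> at most \<open>k / poly_norm P\<close>. The bounds \<open>A\<close>
  and \<open>B\<close> stay open so that both the tail and the full sum can be treated.\<close>

lemma sum_sq_density_le:
  fixes g :: "'a::{field,finite} poly poly"
  assumes sf: "squarefree g" and gk: "degree g \<le> k"
    and ns: "\<And>P. P \<in> monic_irreducibles \<Longrightarrow> \<not> P dvd R \<Longrightarrow> rho g (P ^ 2) \<le> k"
    and F: "finite F" "F \<subseteq> monic_irreducibles"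
    and A: "(\<Sum>P\<in>F. 1 / poly_norm P ^ 2) \<le> A"
    and B: "(\<Sum>P\<in>{P \<in> F. P dvd R}. 1 / poly_norm P) \<le> B"
  shows "(\<Sum>P\<in>F. sq_density g P) \<le> real k * (A + B)"
proof -
  have le: "sq_density g P \<le>
      real k * (1 / poly_norm P ^ 2) + real k * (if P dvd R then 1 / poly_norm P else 0)"
    if "P \<in> F" for P
  proof (cases "P dvd R")
    have P: "P \<in> monic_irreducibles" using that F(2) by (rule subsetD[rotated])
    case True
    then show ?thesis using sq_density_le[OF sf gk P] by (simp add: add_increasing)
  next
    have P: "P \<in> monic_irreducibles" using that F(2) by (rule subsetD[rotated])
    case False
    with sq_density_le_nonsingular[OF ns, OF P] show ?thesis by simp
  qed
  have "(\<Sum>P\<in>F. sq_density g P) \<le>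
      (\<Sum>P\<in>F. real k * (1 / poly_norm P ^ 2) + real k * (if P dvd R then 1 / poly_norm P else 0))"
    by (rule sum_mono) (rule le)
  also have "\<dots> = real k * ((\<Sum>P\<in>F. 1 / poly_norm P ^ 2) + (\<Sum>P\<in>{P \<in> F. P dvd R}. 1 / poly_norm P))"
    unfolding sum.distrib sum_distrib_left[symmetric] sum.inter_filter[OF F(1)]
    by (simp only: distrib_left)
  also have "\<dots> \<le> real k * (A + B)" using A B by (intro mult_left_mono) auto
  finally show ?thesis .
qed

lemma sum_sq_density_tail_le:
  fixes g :: "'a::{field,finite} poly poly"
  assumes sf: "squarefree g" and gk: "degree g \<le> k" and R0: "R \<noteq> 0"
    and ns: "\<And>P. P \<in> monic_irreducibles \<Longrightarrow> \<not> P dvd R \<Longrightarrow> rho g (P ^ 2) \<le> k"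
    and F: "finite F" "F \<subseteq> monic_irreducibles" "\<And>P. P \<in> F \<Longrightarrow> w < degree P"
  shows "(\<Sum>P\<in>F. sq_density g P) \<le> real k * (1 + real (degree R)) / real CARD('a) ^ w"
proof -
  have "(\<Sum>P\<in>F. sq_density g P) \<le>
      real k * (1 / real CARD('a) ^ w + real (degree R) / real CARD('a) ^ w)"
  proof (rule sum_sq_density_le[OF sf gk ns F(1,2)])
    show "(\<Sum>P\<in>F. 1 / poly_norm P ^ 2) \<le> 1 / real CARD('a) ^ w"
      by (rule sum_inverse_norm_square_le[OF F])
    show "(\<Sum>P\<in>{P \<in> F. P dvd R}. 1 / poly_norm P) \<le> real (degree R) / real CARD('a) ^ w"
      by (rule sum_inverse_norm_divisors_tail) (use F R0 in \<open>auto simp: less_imp_le\<close>)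
  qed
  then show ?thesis by (simp add: add_divide_distrib distrib_left)
qed

lemma sum_sq_density_total_le:
  fixes g :: "'a::{field,finite} poly poly"
  assumes sf: "squarefree g" and gk: "degree g \<le> k" and R0: "R \<noteq> 0"
    and ns: "\<And>P. P \<in> monic_irreducibles \<Longrightarrow> \<not> P dvd R \<Longrightarrow> rho g (P ^ 2) \<le> k"
    and F: "finite F" "F \<subseteq> monic_irreducibles" and l: "l \<ge> 1"
  shows "(\<Sum>P\<in>F. sq_density g P) \<le>
    real k * (2 + ln (real l) + real (degree R) / real CARD('a) ^ l)"
proof -
  have "(\<Sum>P\<in>F. sq_density g P) \<le>
      real k * (1 / real CARD('a) ^ 0 + (1 + ln (real l) + real (degree R) / real CARD('a) ^ l))"
  proof (rule sum_sq_density_le[OF sf gk ns F])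
    \<comment> \<open>Irreducibles have positive degree, so the tail bound with \<open>w = 0\<close>
      covers all of them.\<close>
    show "(\<Sum>P\<in>F. 1 / poly_norm P ^ 2) \<le> 1 / real CARD('a) ^ 0"
      using F(2) monic_irreducibleD(4) by (intro sum_inverse_norm_square_le[OF F]) blast
    show "(\<Sum>P\<in>{P \<in> F. P dvd R}. 1 / poly_norm P) \<le>
        1 + ln (real l) + real (degree R) / real CARD('a) ^ l"
      by (rule sum_inverse_norm_divisors[OF _ _ _ R0 l]) (use F in auto)
  qed
  then show ?thesis by (simp add: add.assoc)
qed

text \<open>The lower bound for finite products does not depend on \<open>F\<close>, so it passes to
  the limit; \<open>x1\<close> rules out a vanishing factor.\<close>

lemma c_const_ge:
  fixes g :: "'a::{field,finite} poly poly"
  assumes sf: "squarefree g" and gk: "degree g \<le> k" and k0: "k > 0" and R0: "R \<noteq> 0"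
    and ns: "\<And>P. P \<in> monic_irreducibles \<Longrightarrow> \<not> P dvd R \<Longrightarrow> rho g (P ^ 2) \<le> k"
    and x1: "\<And>P. P \<in> monic_irreducibles \<Longrightarrow> sq_density g P \<noteq> 1" and l: "l \<ge> 1"
  shows "(1 / real (2 * k) ^ 2) ^ card {P \<in> (monic_irreducibles :: 'a poly set). poly_norm P \<le> real (2 * k)}
    * exp (- 2 * (real k * (2 + ln (real l) + real (degree R) / real CARD('a) ^ l))) \<le> c_const g"
    (is "?K * exp (- 2 * ?S) \<le> _")
proof (rule tendsto_lowerbound[OF c_const_tendsto_sq_density])
  show "eventually (\<lambda>F. ?K * exp (- 2 * ?S) \<le> (\<Prod>P\<in>F. 1 - sq_density g P))
      (finite_subsets_at_top monic_irreducibles)"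
    unfolding eventually_finite_subsets_at_top
  proof (intro exI[of _ "{}"] conjI allI impI)
    fix F :: "'a poly set" assume "finite F \<and> {} \<subseteq> F \<and> F \<subseteq> monic_irreducibles"
    then have F: "finite F" "F \<subseteq> monic_irreducibles" by auto
    have "exp (- 2 * ?S) \<le> exp (- 2 * (\<Sum>P\<in>F. sq_density g P))"
      using sum_sq_density_total_le[OF sf gk R0 ns F l] by simp
    then have "?K * exp (- 2 * ?S) \<le> ?K * exp (- 2 * (\<Sum>P\<in>F. sq_density g P))"
      by (rule mult_left_mono) simp
    also have "\<dots> \<le> (\<Prod>P\<in>F. 1 - sq_density g P)"
      by (rule prod_one_minus_sq_density_ge[OF sf gk k0 F]) (use x1 F in blast)
    finally show "?K * exp (- 2 * ?S) \<le> (\<Prod>P\<in>F. 1 - sq_density g P)" .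
  qed auto
qed simp

text \<open>For every finite \<open>F\<close> containing the irreducibles of degree at most
  \<open>w\<close>, the product is \<open>V w\<close> times a factor between \<open>1\<close> minus
  the tail of the densities and \<open>1\<close>.\<close>

lemma c_const_truncation:
  fixes g :: "'a::{field,finite} poly poly"
  assumes sf: "squarefree g" and gk: "degree g \<le> k" and R0: "R \<noteq> 0"
    and ns: "\<And>P. P \<in> monic_irreducibles \<Longrightarrow> \<not> P dvd R \<Longrightarrow> rho g (P ^ 2) \<le> k"
  defines "V w \<equiv> \<Prod>P\<in>{P \<in> monic_irreducibles. degree P \<le> w}. 1 - sq_density g P"
  shows "\<bar>V w - c_const g\<bar> \<le> real k * (1 + real (degree R)) / real CARD('a) ^ w"
proof -
  define t where "t = real k * (1 + real (degree R)) / real CARD('a) ^ w"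
  let ?A = "{P \<in> monic_irreducibles :: 'a poly set. degree P \<le> w}"
  have ev: "eventually (\<lambda>F. V w - t \<le> (\<Prod>P\<in>F. 1 - sq_density g P) \<and>
      (\<Prod>P\<in>F. 1 - sq_density g P) \<le> V w) (finite_subsets_at_top monic_irreducibles)"
    unfolding eventually_finite_subsets_at_top
  proof (rule exI[of _ ?A], rule conjI[OF _ conjI], goal_cases)
    case 3
    show ?case
    proof (intro allI impI)
      fix F :: "'a poly set" assume F: "finite F \<and> ?A \<subseteq> F \<and> F \<subseteq> monic_irreducibles"
      define p where "p = (\<Prod>P\<in>F - ?A. 1 - sq_density g P)"
      have eq: "(\<Prod>P\<in>F. 1 - sq_density g P) = p * V w"
        unfolding V_def p_def using F by (intro prod.subset_diff) auto
      have V: "0 \<le> V w" "V w \<le> 1" unfolding V_def by (rule prod_one_minus_sq_density_bounds; auto)+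
      have p1: "p \<le> 1" unfolding p_def using F by (intro prod_one_minus_sq_density_bounds) auto
      have "(\<Sum>P\<in>F - ?A. sq_density g P) \<le> t"
        unfolding t_def using F by (intro sum_sq_density_tail_le[OF sf gk R0 ns]) auto
      moreover have "1 - (\<Sum>P\<in>F - ?A. sq_density g P) \<le> p"
        unfolding p_def using F monic_irreducibleD(3)
        by (intro weierstrass_product_ge) (auto simp: sq_density_nonneg intro!: sq_density_le_1)
      ultimately have "1 - t \<le> p" by linarith
      then have "(1 - p) * V w \<le> t * 1"
        using V p1 by (intro mult_mono) auto
      then have "V w - t \<le> p * V w" by (simp add: algebra_simps)
      moreover have "p * V w \<le> V w" using mult_right_mono[OF p1 V(1)] by simp
      ultimately show "V w - t \<le> (\<Prod>P\<in>F. 1 - sq_density g P) \<and>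
          (\<Prod>P\<in>F. 1 - sq_density g P) \<le> V w" unfolding eq by simp
    qed
  qed (auto simp: finite_monic_irreducibles_le)
  have "V w - t \<le> c_const g"
    by (rule tendsto_lowerbound[OF c_const_tendsto_sq_density]) (use ev in \<open>auto elim: eventually_mono\<close>)
  moreover have "c_const g \<le> V w"
    by (rule tendsto_upperbound[OF c_const_tendsto_sq_density]) (use ev in \<open>auto elim: eventually_mono\<close>)
  ultimately show ?thesis unfolding t_def by linarith
qed

subsection \<open>Combining the ranges\<close>

text \<open>A union bound with exact counts: \<open>degree P < s\<close> gives
  \<open>2 * degree P \<le> m\<close>.\<close>

lemma card_medium_primes:
  fixes g :: "'a::{field,finite} poly poly"
  assumes sf: "squarefree g" and gk: "degree g \<le> k" and R0: "R \<noteq> 0"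
    and ns: "\<And>P. P \<in> monic_irreducibles \<Longrightarrow> \<not> P dvd R \<Longrightarrow> rho g (P ^ 2) \<le> k"
    and s: "2 * (s - 1) \<le> m"
  shows "real (card {b \<in> short_interval N m.
      \<exists>P\<in>monic_irreducibles. w < degree P \<and> degree P < s \<and> P ^ 2 dvd poly g b}) \<le>
    real CARD('a) ^ m * (real k * (1 + real (degree R)) / real CARD('a) ^ w)"
proof -
  let ?I = "short_interval N m"
  define Q where "Q = {P \<in> (monic_irreducibles :: 'a poly set). w < degree P \<and> degree P < s}"
  have finQ: "finite Q"
    by (rule finite_subset[OF _ finite_monic_irreducibles_le[of s]]) (auto simp: Q_def)
  have QM: "Q \<subseteq> monic_irreducibles" by (auto simp: Q_def)
  have eq: "{b \<in> ?I. \<exists>P\<in>monic_irreducibles. w < degree P \<and> degree P < s \<and> P ^ 2 dvd poly g b} =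
      (\<Union>P\<in>Q. {b \<in> ?I. P ^ 2 dvd poly g b})" by (auto simp: Q_def)
  have "real (card {b \<in> ?I. \<exists>P\<in>monic_irreducibles. w < degree P \<and> degree P < s \<and>
      P ^ 2 dvd poly g b}) \<le> real (\<Sum>P\<in>Q. card {b \<in> ?I. P ^ 2 dvd poly g b})"
    unfolding eq by (rule of_nat_mono, rule card_UN_le[OF finQ])
  also have "\<dots> = (\<Sum>P\<in>Q. real (card {b \<in> ?I. P ^ 2 dvd poly g b}))" by simp
  also have "\<dots> = (\<Sum>P\<in>Q. real CARD('a) ^ m * sq_density g P)"
  proof (rule sum.cong)
    fix P assume "P \<in> Q"
    then have "P \<in> monic_irreducibles" "2 * degree P \<le> m" using s by (auto simp: Q_def)
    then show "real (card {b \<in> ?I. P ^ 2 dvd poly g b}) = real CARD('a) ^ m * sq_density g P"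
      using card_short_interval_squares_dvd[of "{P}" m N g] by simp
  qed simp
  also have "\<dots> = real CARD('a) ^ m * (\<Sum>P\<in>Q. sq_density g P)" by (simp add: sum_distrib_left)
  also have "\<dots> \<le> real CARD('a) ^ m * (real k * (1 + real (degree R)) / real CARD('a) ^ w)"
    by (intro mult_left_mono sum_sq_density_tail_le[OF sf gk R0 ns finQ QM]) (auto simp: Q_def)
  finally show ?thesis .
qed

text \<open>At most \<open>Suc r\<close> squares of degree at most \<open>2 * w\<close> multiply to
  degree at most \<open>m\<close>, so the counts required by \<open>brun_pure_sieve\<close> are
  exact.\<close>

lemma card_small_primes_sieve:
  fixes g :: "'a::{field,finite} poly poly"
  assumes wr: "Suc r * (2 * w) \<le> m"
    and S: "(\<Sum>P\<in>{P \<in> monic_irreducibles. degree P \<le> w}. sq_density g P) \<le> S"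
  shows "\<bar>real (card {b \<in> short_interval N m.
      \<forall>P\<in>{P \<in> monic_irreducibles. degree P \<le> w}. \<not> P ^ 2 dvd poly g b}) -
      real CARD('a) ^ m * (\<Prod>P\<in>{P \<in> monic_irreducibles. degree P \<le> w}. 1 - sq_density g P)\<bar> \<le>
    real CARD('a) ^ m * (2 * exp (3 * S - real (Suc r)))"
proof -
  let ?A = "{P \<in> (monic_irreducibles :: 'a poly set). degree P \<le> w}"
  let ?x = "sq_density g"
  note finA = finite_monic_irreducibles_le[of w, where ?'a = 'a]
  have x: "0 \<le> ?x P \<and> ?x P \<le> 1" if "P \<in> ?A" for P
    using that monic_irreducibleD(3)[of P] sq_density_nonneg sq_density_le_1 by blast
  have X: "real (card {b \<in> short_interval N m. \<forall>P\<in>T. P ^ 2 dvd poly g b}) =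
      real CARD('a) ^ m * prod ?x T" if T: "T \<subseteq> ?A" "card T \<le> Suc r" for T
  proof (rule card_short_interval_squares_dvd)
    show "finite T" using T(1) finA by (rule finite_subset)
    show "T \<subseteq> monic_irreducibles" using T(1) by auto
    have "(\<Sum>P\<in>T. 2 * degree P) \<le> (\<Sum>P\<in>T. 2 * w)" using T(1) by (intro sum_mono) auto
    also have "\<dots> = card T * (2 * w)" by simp
    also have "\<dots> \<le> Suc r * (2 * w)" using T(2) by (rule mult_le_mono1)
    finally show "(\<Sum>P\<in>T. 2 * degree P) \<le> m" using wr by linarith
  qed
  have sum0: "0 \<le> (\<Sum>P\<in>?A. ?x P)" by (intro sum_nonneg sq_density_nonneg)
  have "esym (Suc r) ?x ?A \<le> (\<Sum>P\<in>?A. ?x P) ^ Suc r / fact (Suc r)"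
    by (rule esym_le[OF finA sq_density_nonneg])
  also have "\<dots> \<le> S ^ Suc r / fact (Suc r)"
    using S sum0 by (intro divide_right_mono power_mono) auto
  also have "\<dots> \<le> exp (3 * S - real (Suc r))"
    using S sum0 by (intro power_div_fact_le_exp) linarith
  finally have e: "esym (Suc r) ?x ?A \<le> exp (3 * S - real (Suc r))" .
  have "\<bar>real (card {b \<in> short_interval N m. \<forall>P\<in>?A. \<not> P ^ 2 dvd poly g b}) -
      real CARD('a) ^ m * (\<Prod>P\<in>?A. 1 - ?x P)\<bar> \<le> 2 * real CARD('a) ^ m * esym (Suc r) ?x ?A"
    by (rule brun_pure_sieve[OF finA finite_short_interval x X])
  also have "\<dots> \<le> 2 * real CARD('a) ^ m * exp (3 * S - real (Suc r))"
    using e by (intro mult_left_mono) auto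
  finally show ?thesis by (simp add: mult_ac)
qed

text \<open>The set \<open>X\<close> of \<open>b\<close> with square-free value lies in
  \<open>Y\<close>, and \<open>Y\<close> in the union of \<open>X\<close>, \<open>Z\<close> and
  \<open>U\<close>; the last three conditions sort by the absence of small and the presence of
  medium or large \<open>P\<close>. Of the two terms \<open>t\<close> one bounds \<open>Z\<close>,
  the other replaces the truncated product by \<open>c_const g\<close>.\<close>

lemma card_squarefree_values_approx:
  fixes g :: "'a::{field,finite} poly poly" and N :: "'a poly"
  assumes sf: "squarefree g" and gk: "degree g \<le> k" and gn: "\<And>i. degree (coeff g i) \<le> n"
    and R0: "R \<noteq> 0"
    and ns: "\<And>P. P \<in> monic_irreducibles \<Longrightarrow> \<not> P dvd R \<Longrightarrow> rho g (P ^ 2) \<le> k"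
    and s: "CHAR('a) * (s - 1) < m" "m \<le> CHAR('a) * s"
    and r: "r > 0" "r * (2 * w) \<le> m" and l: "l \<ge> 1"
  defines "t \<equiv> real k * (1 + real (degree R)) / real CARD('a) ^ w"
    and "S \<equiv> real k * (2 + ln (real l) + real (degree R) / real CARD('a) ^ l)"
    and "D \<equiv> real (k * ((2 * k + 1) * (n + (degree N + m))))"
  shows "\<bar>real (card {b \<in> short_interval N m. squarefree (poly g b)}) -
      c_const g * real CARD('a) ^ m\<bar> \<le>
    real CARD('a) ^ m * (2 * exp (3 * S - real r) + 2 * t) +
    (real k * real CARD('a) ^ s + real CARD('a) ^ (m - s) * D / real s)"
proof -
  let ?I = "short_interval N m"
  let ?q = "real CARD('a)"
  let ?A = "{P \<in> (monic_irreducibles :: 'a poly set). degree P \<le> w}"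
  define X where "X = {b \<in> ?I. squarefree (poly g b)}"
  define Y where "Y = {b \<in> ?I. \<forall>P\<in>?A. \<not> P ^ 2 dvd poly g b}"
  define Z where "Z = {b \<in> ?I.
      \<exists>P\<in>monic_irreducibles. w < degree P \<and> degree P < s \<and> P ^ 2 dvd poly g b}"
  define U where "U = {b \<in> ?I. \<exists>P\<in>monic_irreducibles. s \<le> degree P \<and> P ^ 2 dvd poly g b}"
  define V where "V = (\<Prod>P\<in>?A. 1 - sq_density g P)"
  note finI = finite_short_interval[of N m]
  have fin: "finite X" "finite Y" "finite Z" "finite U"
    unfolding X_def Y_def Z_def U_def using finI by auto
  have p2: "CHAR('a) \<ge> 2" using prime_CHAR_finite_field prime_ge_2_nat by blast
  have "2 * (s - 1) \<le> CHAR('a) * (s - 1)" using p2 by (rule mult_le_mono1)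
  then have s2: "2 * (s - 1) \<le> m" "s \<le> m" using s(1) by linarith+
  have s0: "s > 0" using s by (cases s) auto
  have "X \<subseteq> Y"
  proof
    fix b assume b: "b \<in> X"
    have "\<not> P ^ 2 dvd poly g b" if "P \<in> ?A" for P
    proof
      assume "P ^ 2 dvd poly g b"
      moreover have "squarefree (poly g b)" using b by (simp add: X_def)
      ultimately have "P dvd 1" using squarefreeD by metis
      then show False using that monic_irreducibleD(1)[of P] irreducible_not_unit by blast
    qed
    then show "b \<in> Y" using b by (auto simp: X_def Y_def)
  qed
  then have XY: "real (card X) \<le> real (card Y)" using fin by (simp add: card_mono)
  have "Y \<subseteq> X \<union> Z \<union> U"
  proof
    fix b assume b: "b \<in> Y"
    show "b \<in> X \<union> Z \<union> U"
    proof (cases "squarefree (poly g b)")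
      case True
      then show ?thesis using b by (simp add: X_def Y_def)
    next
      case False
      then obtain P where P: "P \<in> monic_irreducibles" "P ^ 2 dvd poly g b"
        using not_squarefree_imp_square_dvd by blast
      have "\<not> degree P \<le> w" using b P by (auto simp: Y_def)
      then show ?thesis using b P by (cases "degree P < s") (auto simp: Y_def Z_def U_def not_le not_less)
    qed
  qed
  then have "card Y \<le> card (X \<union> Z \<union> U)" using fin by (intro card_mono) auto
  also have "\<dots> \<le> card X + card Z + card U"
    using card_Un_le[of "X \<union> Z" U] card_Un_le[of X Z] by linarith
  finally have YX: "real (card Y) \<le> real (card X) + real (card Z) + real (card U)" by linarith
  have Z: "real (card Z) \<le> ?q ^ m * t"
    unfolding Z_def t_def by (rule card_medium_primes[OF sf gk R0 ns s2(1)])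
  have U: "real (card U) \<le> real k * ?q ^ s + ?q ^ (m - s) * D / real s"
  proof -
    have "s * card U \<le> s * (k * CARD('a) ^ s) +
        CARD('a) ^ (m - s) * (k * ((2 * k + 1) * (n + (degree N + m))))"
      unfolding U_def by (rule card_large_primes[OF sf gk gn s s2(2)])
    then have "real (s * card U) \<le> real (s * (k * CARD('a) ^ s) +
        CARD('a) ^ (m - s) * (k * ((2 * k + 1) * (n + (degree N + m)))))" by (rule of_nat_mono)
    also have "\<dots> = real s * (real k * ?q ^ s) + ?q ^ (m - s) * D"
      unfolding D_def by (simp only: of_nat_add of_nat_mult of_nat_power)
    finally have "real s * real (card U) \<le> real s * (real k * ?q ^ s) + ?q ^ (m - s) * D" by simp
    then show ?thesis using s0 by (simp add: field_simps)
  qed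
  have Y: "\<bar>real (card Y) - ?q ^ m * V\<bar> \<le> ?q ^ m * (2 * exp (3 * S - real r))"
  proof -
    obtain r' where r': "r = Suc r'" using r(1) gr0_implies_Suc by blast
    have "(\<Sum>P\<in>?A. sq_density g P) \<le> S"
      unfolding S_def by (rule sum_sq_density_total_le[OF sf gk R0 ns finite_monic_irreducibles_le _ l]) auto
    then show ?thesis
      using card_small_primes_sieve[of r' w m g S N] r(2) unfolding Y_def V_def r' by blast
  qed
  have "\<bar>V - c_const g\<bar> \<le> t"
    unfolding V_def t_def by (rule c_const_truncation[OF sf gk R0 ns])
  then have "?q ^ m * \<bar>V - c_const g\<bar> \<le> ?q ^ m * t" by (rule mult_left_mono) simp
  then have V: "\<bar>?q ^ m * V - c_const g * ?q ^ m\<bar> \<le> ?q ^ m * t"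
    by (simp add: abs_mult mult.commute flip: left_diff_distrib)
  have "?q ^ m * (2 * exp (3 * S - real r) + 2 * t) =
      ?q ^ m * (2 * exp (3 * S - real r)) + 2 * (?q ^ m * t)" by (simp add: distrib_left)
  then show ?thesis
    using XY YX Z U Y V unfolding X_def[symmetric] by linarith
qed

subsection \<open>Asymptotics\<close>

text \<open>Translation by \<open>1\<close> permutes the field, so summing all elements shows that
  \<open>q\<close> vanishes in it, and the characteristic divides \<open>p ^ e\<close>.\<close>

lemma CHAR_eq_of_card:
  assumes "prime p" "CARD('a::{field,finite}) = p ^ e"
  shows "CHAR('a) = p"
proof -
  have "(\<Sum>x\<in>(UNIV :: 'a set). x) = (\<Sum>x\<in>UNIV. x + 1)"
    by (rule sum.reindex_bij_witness[of _ "\<lambda>x. x + 1" "\<lambda>x. x - 1"]) auto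
  then have "of_nat (p ^ e) = (0 :: 'a)" by (simp add: sum.distrib flip: assms(2))
  then have "CHAR('a) dvd p ^ e" using of_nat_eq_0_iff_char_dvd by blast
  then have "CHAR('a) dvd p" using prime_dvd_power[OF prime_CHAR_finite_field] by metis
  then show ?thesis using assms(1) prime_CHAR_finite_field primes_dvd_imp_eq by metis
qed

section \<open>Real estimates\<close>

lemma ln_ge_two_thirds:
  assumes "Q \<ge> 2"
  shows "2 / 3 \<le> ln (Q::real)"
proof -
  \<comment> \<open>The bound \<open>exp x \<le> 1 + x + x^2\<close> gives \<open>157 / 144\<close>
    at \<open>x = 1 / 12\<close>, and the eighth power of this stays just below
    \<open>2\<close>.\<close>
  have "exp (2 / 3) = exp (1 / 12 :: real) ^ 8"
    using exp_of_nat_mult[of 8 "1 / 12 :: real"] by simp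
  also have "\<dots> \<le> (157 / 144) ^ 8"
    using exp_bound[of "1 / 12"] by (intro power_mono) (auto simp: power2_eq_square)
  also have "\<dots> \<le> Q" using assms by (simp add: power_numeral_reduce)
  finally show ?thesis using assms by (subst ln_ge_iff) auto
qed

lemma ln_le_half: "x > 0 \<Longrightarrow> ln (x::real) \<le> x / 2"
proof -
  assume x: "x > 0"
  have "ln (x / 2) \<le> x / 2 - 1" using x by (intro ln_le_minus_one) simp
  moreover have "ln (x / 2) = ln x - ln 2" using x by (simp add: ln_div)
  moreover have "ln (2::real) \<le> 2 - 1" by (rule ln_le_minus_one) simp
  ultimately show ?thesis by linarith
qed

text \<open>In use \<open>Q powr L\<close> is \<open>n1\<close>. Multiplication by
  \<open>ln Q \<ge> 1 / 2\<close> leaves at least half of the excess \<open>4 * k * L + B\<close> of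
  \<open>w\<close> over \<open>L\<close> in the exponent, and \<open>ln L \<le> L\<close>.\<close>

lemma powr_div_power_le:
  fixes Q L B :: real and k w :: nat
  assumes Q: "Q \<ge> 2" and L: "L \<ge> 1" and B: "B \<ge> 0"
    and w: "(1 + 4 * real k) * L + B \<le> real w"
  shows "Q powr L / Q ^ w \<le> exp (- B / 2) * exp (- (2 * real k * ln L))"
proof -
  have "ln L \<le> L" using ln_le_half[of L] L by linarith
  then have kL: "real k * ln L \<le> real k * L" by (rule mult_left_mono) simp
  have lnQ: "1 / 2 \<le> ln Q" using ln_ge_two_thirds[OF Q] by linarith
  have "(4 * real k * L + B) * (1 / 2) \<le> (4 * real k * L + B) * ln Q"
    using lnQ L B by (intro mult_left_mono) auto
  moreover have "(4 * real k * L + B) * ln Q \<le> (real w - L) * ln Q"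
    using w lnQ by (intro mult_right_mono) (auto simp: algebra_simps)
  ultimately have "(L - real w) * ln Q \<le> - B / 2 - 2 * (real k * L)"
    by (simp add: algebra_simps)
  also have "\<dots> \<le> - B / 2 - 2 * (real k * ln L)" using kL by simp
  finally have le: "(L - real w) * ln Q \<le> - B / 2 - 2 * (real k * ln L)" .
  have "Q powr L / Q ^ w = Q powr (L - real w)"
    using Q by (simp add: powr_diff powr_realpow)
  also have "\<dots> = exp ((L - real w) * ln Q)" using Q by (simp add: powr_def)
  also have "\<dots> \<le> exp (- B / 2 - 2 * (real k * ln L))" using le by simp
  also have "\<dots> = exp (- B / 2) * exp (- (2 * real k * ln L))"
    by (simp add: exp_add[symmetric] algebra_simps)
  finally show ?thesis .
qed

text \<open>In use \<open>Q powr M\<close> is the degree of \<open>N\<close>. Since \<open>s\<close>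
  is at least \<open>M / 4\<close>, dividing by \<open>s\<close> saves the factor
  \<open>Q powr (log Q M)\<close> up to a constant; this accounts for the term
  \<open>- log_q log_q n_2\<close> in the hypothesis on \<open>m\<close>.\<close>

lemma interval_centre_degree_term_le:
  fixes Q L M B :: real and k s :: nat
  assumes Q: "Q \<ge> 2" and L: "L \<ge> 1" and M: "M \<ge> 1" and B: "B \<ge> 0"
    and s: "M - log Q M + 2 * real k * log Q L + B \<le> real s"
  shows "M / 4 \<le> M - log Q M"
    and "Q powr M / (real s * Q ^ s) \<le> 4 * (exp (- B / 2) * exp (- (2 * real k * ln L)))"
proof -
  have lnQ: "2 / 3 \<le> ln Q" by (rule ln_ge_two_thirds[OF Q])
  \<comment> \<open>With \<open>ln Q \<ge> 2 / 3\<close>, the bound \<open>ln M \<le> M / 2\<close>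
    becomes \<open>log Q M \<le> 3 * M / 4\<close>; a lower bound of \<open>1 / 2\<close> would
    leave no positive share of \<open>M\<close>.\<close>
  have "log Q M * (2 / 3) \<le> log Q M * ln Q"
    using lnQ Q M by (intro mult_left_mono) auto
  also have "\<dots> = ln M" using Q by (simp add: log_def)
  also have "\<dots> \<le> M / 2" using M by (intro ln_le_half) simp
  finally show M4: "M / 4 \<le> M - log Q M" by simp
  have logL: "0 \<le> log Q L" using Q L by simp
  have "0 \<le> real k * log Q L" using logL by simp
  then have sM: "M / 4 \<le> real s" using s M4 B by linarith
  have s0: "real s > 0" using sM M by linarith
  have "Q powr M = M * Q powr (M - log Q M)" using Q M by (simp add: powr_diff)
  also have "\<dots> \<le> (4 * real s) * Q powr (M - log Q M)"
    using sM by (intro mult_right_mono) auto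
  finally have "Q powr M / (real s * Q ^ s) \<le> (4 * real s) * Q powr (M - log Q M) / (real s * Q ^ s)"
    using s0 Q by (intro divide_right_mono) auto
  also have "\<dots> = 4 * Q powr (M - log Q M - real s)"
    using s0 Q by (simp add: powr_diff powr_realpow)
  also have "\<dots> \<le> 4 * Q powr (- B - 2 * real k * log Q L)"
    using s Q by (intro mult_left_mono powr_mono) auto
  also have "Q powr (- B - 2 * real k * log Q L) = exp (- B * ln Q - 2 * real k * ln L)"
    using Q by (simp add: powr_def log_def algebra_simps)
  also have "\<dots> \<le> exp (- B / 2 - 2 * real k * ln L)"
  proof -
    have "B * (1 / 2) \<le> B * ln Q" using lnQ B by (intro mult_left_mono) auto
    then show ?thesis by simp
  qed
  also have "\<dots> = exp (- B / 2) * exp (- (2 * real k * ln L))"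
    by (simp add: exp_add[symmetric])
  finally show "Q powr M / (real s * Q ^ s) \<le> 4 * (exp (- B / 2) * exp (- (2 * real k * ln L)))"
    by simp
qed

section \<open>Constants depending only on \<open>q\<close> and \<open>k\<close>\<close>

definition singular_degree_const :: "nat \<Rightarrow> real" where
  "singular_degree_const k = real ((2 * k + 1) * (1 + k))"

text \<open>The additive constant in the bound \<open>k * ln L + density_sum_const k\<close> for the
  sum of densities; \<open>3\<close> is \<open>2\<close> from \<open>sum_sq_density_total_le\<close>
  plus \<open>1\<close> from rounding \<open>L\<close> up.\<close>

definition density_sum_const :: "nat \<Rightarrow> real" where
  "density_sum_const k = real k * (3 + singular_degree_const k)"

text \<open>Times \<open>L^(-2k)\<close> it bounds \<open>c_const g\<close> from below when no
  factor vanishes: the \<open>P\<close> of norm at most \<open>2 * k\<close> give the power, the sum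
  of densities the exponential.\<close>

definition euler_product_const :: "'a::{field,finite} itself \<Rightarrow> nat \<Rightarrow> real" where
  "euler_product_const _ k =
     (1 / real (2 * k) ^ 2) ^ card {P \<in> (monic_irreducibles :: 'a poly set). poly_norm P \<le> real (2 * k)}
       * exp (- 2 * density_sum_const k)"

text \<open>The summands come, in order, from the sieve, the two tails, the bad fibres and the good
  fibres; \<open>5 + p\<close> collects \<open>1\<close> for \<open>n1\<close>, \<open>4\<close> for
  the degree of \<open>N\<close> and \<open>p\<close> for \<open>m\<close>.\<close>

definition error_const :: "nat \<Rightarrow> nat \<Rightarrow> real" where
  "error_const p k = 2 * exp (3 * density_sum_const k) + 2 * (real k * (1 + singular_degree_const k)) +
     real k + real (k * (2 * k + 1)) * (5 + real p)"

lemma euler_product_const_pos: "k > 0 \<Longrightarrow> euler_product_const TYPE('a::{field,finite}) k > 0"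
  by (simp add: euler_product_const_def)

lemma error_const_pos: "error_const p k > 0"
proof -
  have "0 \<le> singular_degree_const k" by (simp add: singular_degree_const_def)
  then show ?thesis unfolding error_const_def by (intro add_pos_nonneg) auto
qed

lemma singular_divisor_estimates:
  fixes g :: "'a::{field,finite} poly poly"
  assumes sf: "squarefree g" and gk: "degree g \<le> k"
    and gn: "\<And>i. degree (coeff g i) \<le> n1" and n1: "n1 \<ge> CARD('a)"
  defines "L \<equiv> log (real CARD('a)) (real n1)"
  obtains R l where "R \<noteq> 0" "\<And>P. P \<in> monic_irreducibles \<Longrightarrow> \<not> P dvd R \<Longrightarrow> rho g (P ^ 2) \<le> k"
    "real (degree R) \<le> singular_degree_const k * real n1" "l \<ge> 1"
    "real k * (2 + ln (real l) + real (degree R) / real CARD('a) ^ l) \<le>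
       real k * ln L + density_sum_const k"
proof -
  let ?q = "real CARD('a)"
  have q2: "?q \<ge> 2" using card_finite_field_gt_1[where 'a='a] by simp
  have n1q: "real n1 \<ge> ?q" using n1 by simp
  have L1: "L \<ge> 1" unfolding L_def using q2 n1q by (subst le_log_iff) auto
  have qL: "?q powr L = real n1" unfolding L_def using q2 n1q by (intro powr_log_cancel) auto
  obtain R where R: "R \<noteq> 0" "degree R \<le> (2 * k + 1) * (n1 + k)"
    and ns: "\<And>P. P \<in> monic_irreducibles \<Longrightarrow> \<not> P dvd R \<Longrightarrow> rho g (P ^ 2) \<le> k"
    using squarefree_obtain_singular_divisor[OF sf gk gn] by metis
  have "n1 \<ge> 1" using n1q q2 by linarith
  \<comment> \<open>The additive \<open>k\<close> is absorbed into a multiple of \<open>n1\<close>,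
    which produces \<open>singular_degree_const\<close>.\<close>
  then have "n1 + k \<le> (1 + k) * n1" by simp
  then have "(2 * k + 1) * (n1 + k) \<le> (2 * k + 1) * ((1 + k) * n1)" by (rule mult_le_mono2)
  with R(2) have "degree R \<le> (2 * k + 1) * (1 + k) * n1" by (simp only: mult.assoc)
  then have "real (degree R) \<le> real ((2 * k + 1) * (1 + k) * n1)" by (rule of_nat_mono)
  then have dR: "real (degree R) \<le> singular_degree_const k * real n1"
    by (simp only: singular_degree_const_def of_nat_mult)
  \<comment> \<open>Rounding \<open>L\<close> up makes \<open>q^l \<ge> n1\<close>, so that
    \<open>degree R / q^l\<close> is bounded while \<open>ln l\<close> is at most
    \<open>1 + ln L\<close>.\<close>
  define l where "l = nat \<lceil>L\<rceil>"
  have l: "L \<le> real l" "real l \<le> L + 1" "l \<ge> 1" using L1 unfolding l_def by linarith+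
  have "real n1 \<le> ?q ^ l"
  proof -
    have "?q powr L \<le> ?q powr real l" using l(1) q2 by (intro powr_mono) auto
    then show ?thesis using q2 by (simp add: qL powr_realpow)
  qed
  then have "singular_degree_const k * real n1 \<le> singular_degree_const k * ?q ^ l"
    by (rule mult_left_mono) (simp add: singular_degree_const_def)
  with dR have "real (degree R) \<le> singular_degree_const k * ?q ^ l" by linarith
  then have d: "real (degree R) / ?q ^ l \<le> singular_degree_const k"
    using q2 by (simp add: divide_le_eq)
  have "ln (real l) \<le> ln (2 * L)" using l L1 by (intro ln_mono) auto
  also have "\<dots> = ln 2 + ln L" using L1 by (simp add: ln_mult)
  also have "ln (2::real) \<le> 2 - 1" by (rule ln_le_minus_one) simp
  finally have "ln (real l) \<le> 1 + ln L" by simp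
  with d have "2 + ln (real l) + real (degree R) / ?q ^ l \<le> ln L + (3 + singular_degree_const k)"
    by linarith
  then have "real k * (2 + ln (real l) + real (degree R) / ?q ^ l) \<le>
      real k * (ln L + (3 + singular_degree_const k))" by (rule mult_left_mono) simp
  then have "real k * (2 + ln (real l) + real (degree R) / ?q ^ l) \<le>
      real k * ln L + density_sum_const k" by (simp only: distrib_left density_sum_const_def)
  with R(1) ns dR l(3) show ?thesis by (rule that)
qed

text \<open>This is \<open>c_const_ge\<close> with \<open>l\<close> about \<open>L\<close>; the
  factor \<open>exp (- (2 * k * ln L))\<close> is \<open>L^(-2k)\<close>.\<close>

lemma c_const_lower_bound:
  fixes g :: "'a::{field,finite} poly poly"
  assumes sf: "squarefree g" and gk: "degree g \<le> k" and k0: "k > 0"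
    and gn: "\<And>i. degree (coeff g i) \<le> n1" and n1: "n1 \<ge> CARD('a)"
    and x1: "\<And>P. P \<in> monic_irreducibles \<Longrightarrow> sq_density g P \<noteq> 1"
  shows "euler_product_const TYPE('a) k *
    exp (- (2 * real k * ln (log (real CARD('a)) (real n1)))) \<le> c_const g"
proof -
  define L where "L = log (real CARD('a)) (real n1)"
  obtain R l where R: "R \<noteq> 0" "\<And>P. P \<in> monic_irreducibles \<Longrightarrow> \<not> P dvd R \<Longrightarrow> rho g (P ^ 2) \<le> k"
    and l: "l \<ge> 1" and S: "real k * (2 + ln (real l) + real (degree R) / real CARD('a) ^ l) \<le>
       real k * ln L + density_sum_const k"
    using singular_divisor_estimates[OF sf gk gn n1] unfolding L_def by metis
  let ?S = "real k * (2 + ln (real l) + real (degree R) / real CARD('a) ^ l)"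
  let ?K = "(1 / real (2 * k) ^ 2) ^
    card {P \<in> (monic_irreducibles :: 'a poly set). poly_norm P \<le> real (2 * k)}"
  have "euler_product_const TYPE('a) k * exp (- (2 * real k * ln L)) =
      ?K * (exp (- 2 * density_sum_const k) * exp (- (2 * real k * ln L)))"
    by (simp only: euler_product_const_def mult.assoc)
  also have "exp (- 2 * density_sum_const k) * exp (- (2 * real k * ln L)) =
      exp (- 2 * (real k * ln L + density_sum_const k))"
    by (simp add: exp_add[symmetric] algebra_simps)
  also have "?K * \<dots> \<le> ?K * exp (- 2 * ?S)" using S by (intro mult_left_mono) auto
  also have "\<dots> \<le> c_const g" by (rule c_const_ge[OF sf gk k0 R x1 l])
  finally show ?thesis unfolding L_def .
qed

text \<open>The cut-offs \<open>w\<close> and \<open>r\<close> make every error term at most a constant times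
  \<open>exp (- B / 2) * L^(-2k)\<close>, where \<open>L^(-2k)\<close> is the order of the lower bound for \<open>c_g\<close>.\<close>

lemma squarefree_values_error:
  fixes g :: "'a::{field,finite} poly poly" and N :: "'a poly"
  assumes sf: "squarefree g" and gk: "degree g \<le> k" and k0: "k > 0"
    and gn: "\<And>i. degree (coeff g i) \<le> n1" and n1: "n1 \<ge> CARD('a)"
    and N: "degree N = n2" and n2: "n2 \<ge> CARD('a)"
    and x1: "\<And>P. P \<in> monic_irreducibles \<Longrightarrow> sq_density g P \<noteq> 1"
  defines "L \<equiv> log (real CARD('a)) (real n1)" and "M \<equiv> log (real CARD('a)) (real n2)"
  assumes B: "real CHAR('a) \<le> B"
    and w: "(1 + 4 * real k) * L + B \<le> real w" and r: "5 * real k * ln L + B \<le> real r"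
    and wr: "r * (2 * w) \<le> m"
    and m: "M - log (real CARD('a)) M + 2 * real k * log (real CARD('a)) L + B \<le> real m / real CHAR('a)"
  shows "\<bar>real (card {b \<in> short_interval N m. squarefree (poly g b)}) - c_const g * real CARD('a) ^ m\<bar> \<le>
    error_const CHAR('a) k / euler_product_const TYPE('a) k * exp (- B / 2) *
      (c_const g * real CARD('a) ^ m)"
proof -
  let ?q = "real CARD('a)" and ?p = "CHAR('a)"
  let ?\<kappa> = "singular_degree_const k" and ?K = "density_sum_const k"
  define H where "H = exp (- B / 2) * exp (- (2 * real k * ln L))"
  have H0: "H > 0" by (simp add: H_def)
  have q2: "?q \<ge> 2" using card_finite_field_gt_1[where 'a='a] by simp
  have p2: "?p \<ge> 2" using prime_CHAR_finite_field prime_ge_2_nat by blast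
  have nq: "real n1 \<ge> ?q" "real n2 \<ge> ?q" using n1 n2 by simp_all
  have L1: "L \<ge> 1" unfolding L_def using q2 nq by (subst le_log_iff) auto
  have M1: "M \<ge> 1" unfolding M_def using q2 nq by (subst le_log_iff) auto
  have qL: "?q powr L = real n1" unfolding L_def using q2 nq by (intro powr_log_cancel) auto
  have qM: "?q powr M = real n2" unfolding M_def using q2 nq by (intro powr_log_cancel) auto
  have B0: "B \<ge> 0" using B p2 by linarith
  have lnL: "ln L \<ge> 0" using L1 by simp
  obtain R l where R: "R \<noteq> 0" "\<And>P. P \<in> monic_irreducibles \<Longrightarrow> \<not> P dvd R \<Longrightarrow> rho g (P ^ 2) \<le> k"
    and dR: "real (degree R) \<le> ?\<kappa> * real n1"
    and l: "l \<ge> 1" and S: "real k * (2 + ln (real l) + real (degree R) / ?q ^ l) \<le> real k * ln L + ?K"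
    using singular_divisor_estimates[OF sf gk gn n1] unfolding L_def by metis
  define S where "S = real k * (2 + ln (real l) + real (degree R) / ?q ^ l)"
  \<comment> \<open>The bound \<open>p \<le> B\<close> enters here: it gives
    \<open>p \<le> r\<close>, and then \<open>p * w \<le> r * (2 * w) \<le> m \<le> p * s\<close>,
    that is \<open>w \<le> s\<close>.\<close>
  have "real ?p \<le> real r" using r B lnL mult_nonneg_nonneg[of "5 * real k" "ln L"] by linarith
  then have rp: "?p \<le> r" by simp
  have r0: "r > 0" using rp p2 by linarith
  define s where "s = nat \<lceil>real m / real ?p\<rceil>"
  have sm: "real m / real ?p \<le> real s" "real s < real m / real ?p + 1"
  proof -
    have "0 \<le> real m / real ?p" by simp
    then show "real m / real ?p \<le> real s" "real s < real m / real ?p + 1" unfolding s_def by linarith+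
  qed
  have "real m \<le> real (?p * s)" using sm(1) p2 by (simp add: field_simps)
  then have ms: "m \<le> ?p * s" by (simp only: of_nat_le_iff)
  have "real (?p * s) < real (m + ?p)" using sm(2) p2 by (simp add: field_simps)
  then have ps: "?p * s < m + ?p" by (simp only: of_nat_less_iff)
  have w1: "w > 0"
  proof -
    have "1 * 1 \<le> (1 + 4 * real k) * L" using L1 by (intro mult_mono) auto
    then have "0 < real w" using w B0 by linarith
    then show ?thesis by simp
  qed
  have m0: "m > 0" using wr r0 w1 by (metis mult_pos_pos zero_less_numeral less_le_trans)
  then have s0: "s > 0" using ms by (cases s) auto
  then obtain s' where s': "s = Suc s'" using gr0_implies_Suc by blast
  have ps': "?p * (s - 1) < m" using ps by (simp add: s')
  have "?p * w \<le> r * w" using rp by (rule mult_le_mono1)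
  also have "\<dots> \<le> r * (2 * w)" by simp
  also note wr
  also note ms
  finally have ws: "w \<le> s" using p2 by simp
  \<comment> \<open>This follows from \<open>2 * (s - 1) < m\<close> and
    \<open>2 * w \<le> m\<close>; it makes the \<open>q^s\<close> elements of a bad fibre negligible
    against \<open>q^m\<close>.\<close>
  have swm: "s + w \<le> m"
  proof -
    have "2 * s' \<le> ?p * s'" using p2 by (rule mult_le_mono1)
    also have "\<dots> < m" using ps' by (simp add: s')
    finally have "2 * s' < m" .
    moreover have "1 * (2 * w) \<le> r * (2 * w)" using r0 by (intro mult_le_mono1) simp
    then have "2 * w \<le> m" using wr by linarith
    ultimately show ?thesis unfolding s' by linarith
  qed
  have n1w: "real n1 / ?q ^ w \<le> H"
    using powr_div_power_le[OF q2 L1 B0 w] by (simp add: qL H_def)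
  have one_w: "1 / ?q ^ w \<le> H"
    using divide_right_mono[of 1 "real n1" "?q ^ w"] n1w nq q2 by simp
  have ws_pow: "?q ^ w \<le> ?q ^ s" using ws q2 by (intro power_increasing) auto
  have sq: "1 / ?q ^ s \<le> 1 / ?q ^ w" using ws_pow q2 by (intro divide_left_mono) auto
  \<comment> \<open>The coefficient \<open>5\<close> in \<open>r\<close> is \<open>3 + 2\<close>:
    three parts cancel against \<open>3 * S\<close>, two parts leave \<open>L^(-2k)\<close>.\<close>
  have E1: "2 * exp (3 * S - real r) \<le> 2 * exp (3 * ?K) * H"
  proof -
    have "3 * S - real r \<le> 3 * ?K + (- B / 2 + - (2 * real k * ln L))"
      using S r B0 unfolding S_def by (simp add: algebra_simps)
    then have "exp (3 * S - real r) \<le> exp (3 * ?K) * H" unfolding H_def exp_add[symmetric] by simp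
    then show ?thesis by simp
  qed
  have E2: "real k * (1 + real (degree R)) / ?q ^ w \<le> real k * (1 + ?\<kappa>) * H"
  proof -
    have "real k * (1 + real (degree R)) / ?q ^ w \<le> real k * ((1 + ?\<kappa>) * real n1) / ?q ^ w"
      using dR nq q2 by (intro divide_right_mono mult_left_mono) (auto simp: algebra_simps)
    also have "\<dots> = real k * (1 + ?\<kappa>) * (real n1 / ?q ^ w)" by simp
    also have "\<dots> \<le> real k * (1 + ?\<kappa>) * H"
      using n1w by (rule mult_left_mono) (simp add: singular_degree_const_def)
    finally show ?thesis .
  qed
  have E3: "real k * ?q ^ s \<le> ?q ^ m * (real k * H)"
  proof -
    have "?q ^ s * ?q ^ w \<le> ?q ^ m"
      using swm q2 by (subst power_add[symmetric]) (rule power_increasing, auto)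
    then have "?q ^ s \<le> ?q ^ m * (1 / ?q ^ w)" using q2 by (simp add: field_simps)
    also have "\<dots> \<le> ?q ^ m * H" using one_w by (rule mult_left_mono) simp
    finally have "real k * ?q ^ s \<le> real k * (?q ^ m * H)" by (rule mult_left_mono) simp
    then show ?thesis by (simp add: mult_ac)
  qed
  let ?D = "real (k * ((2 * k + 1) * (n1 + (degree N + m))))"
  have E4: "?q ^ (m - s) * ?D / real s \<le> ?q ^ m * (real (k * (2 * k + 1)) * (5 + real ?p) * H)"
  proof -
    have s1: "real s \<ge> 1" using s0 by simp
    have a: "real n1 / (real s * ?q ^ s) \<le> H"
    proof -
      have "1 * ?q ^ w \<le> real s * ?q ^ s" using s1 ws_pow by (intro mult_mono) auto
      then have "real n1 / (real s * ?q ^ s) \<le> real n1 / ?q ^ w"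
        using q2 s1 by (intro divide_left_mono) auto
      with n1w show ?thesis by linarith
    qed
    have b: "real m / (real s * ?q ^ s) \<le> real ?p * H"
    proof -
      have "real m \<le> real ?p * real s" using ms by (metis of_nat_le_iff of_nat_mult)
      then have "real m / (real s * ?q ^ s) \<le> real ?p * real s / (real s * ?q ^ s)"
        using q2 by (intro divide_right_mono) auto
      also have "\<dots> = real ?p * (1 / ?q ^ s)" using s1 by simp
      also have "\<dots> \<le> real ?p * H" using sq one_w by (intro mult_left_mono) linarith+
      finally show ?thesis .
    qed
    have c: "real n2 / (real s * ?q ^ s) \<le> 4 * H"
    proof -
      have "M - log ?q M + 2 * real k * log ?q L + B \<le> real s" using m sm(1) by linarith
      from interval_centre_degree_term_le(2)[OF q2 L1 M1 B0 this] show ?thesis by (simp add: qM H_def)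
    qed
    have "?q ^ (m - s) = ?q ^ m / ?q ^ s" using swm q2 by (simp add: power_diff)
    then have "?q ^ (m - s) * ?D / real s = ?q ^ m * (real (k * (2 * k + 1)) *
        (real n1 / (real s * ?q ^ s) + real n2 / (real s * ?q ^ s) + real m / (real s * ?q ^ s)))"
      using s1 q2 by (simp add: N field_simps)
    also have "\<dots> \<le> ?q ^ m * (real (k * (2 * k + 1)) * (H + 4 * H + real ?p * H))"
      using a b c by (intro mult_left_mono add_mono) auto
    also have "\<dots> = ?q ^ m * (real (k * (2 * k + 1)) * (5 + real ?p) * H)"
      by (simp add: algebra_simps)
    finally show ?thesis .
  qed
  let ?t = "real k * (1 + real (degree R)) / ?q ^ w"
  have "?q ^ m * (2 * exp (3 * S - real r) + 2 * ?t) \<le>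
      ?q ^ m * (2 * exp (3 * ?K) * H + 2 * (real k * (1 + ?\<kappa>) * H))"
    using E1 E2 by (intro mult_left_mono add_mono) auto
  then have "?q ^ m * (2 * exp (3 * S - real r) + 2 * ?t) +
      (real k * ?q ^ s + ?q ^ (m - s) * ?D / real s) \<le>
      ?q ^ m * (2 * exp (3 * ?K) * H + 2 * (real k * (1 + ?\<kappa>) * H)) +
      (?q ^ m * (real k * H) + ?q ^ m * (real (k * (2 * k + 1)) * (5 + real ?p) * H))"
    using E3 E4 by linarith
  also have "\<dots> = error_const ?p k * H * ?q ^ m" by (simp add: error_const_def algebra_simps)
  finally have bound: "\<bar>real (card {b \<in> short_interval N m. squarefree (poly g b)}) -
      c_const g * ?q ^ m\<bar> \<le> error_const ?p k * H * ?q ^ m"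
    using card_squarefree_values_approx[OF sf gk gn R ps' ms r0 wr l, of N]
    unfolding S_def[symmetric] by linarith
  \<comment> \<open>The lower bound for \<open>c_const g\<close> turns the absolute error
    \<open>H\<close> into a relative one.\<close>
  have "euler_product_const TYPE('a) k * exp (- (2 * real k * ln L)) \<le> c_const g"
    unfolding L_def by (rule c_const_lower_bound[OF sf gk k0 gn n1 x1])
  then have "exp (- (2 * real k * ln L)) \<le> c_const g / euler_product_const TYPE('a) k"
    using euler_product_const_pos[OF k0, where 'a='a] by (simp add: field_simps)
  then have "H \<le> exp (- B / 2) * (c_const g / euler_product_const TYPE('a) k)"
    unfolding H_def by (rule mult_left_mono) simp
  then have "error_const ?p k * H * ?q ^ m \<le>
      error_const ?p k * (exp (- B / 2) * (c_const g / euler_product_const TYPE('a) k)) * ?q ^ m"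
    using error_const_pos[of ?p k] by (intro mult_right_mono mult_left_mono) auto
  with bound show ?thesis by (simp add: mult_ac)
qed

theorem theorem2p5:
  fixes p e q k :: nat
  assumes "prime p" and "e > 0" and "q = p ^ e" and "k > 0"
    and "CARD('a::{field,finite}) = q"
  shows "\<exists>C>0. \<forall>(m :: nat \<Rightarrow> nat) (n1 :: nat \<Rightarrow> nat) (n2 :: nat \<Rightarrow> nat)
           (g :: nat \<Rightarrow> 'a poly poly) (N :: nat \<Rightarrow> 'a poly).
      (\<forall>j. m j > 0 \<and> n1 j \<ge> q \<and> n2 j \<ge> q) \<longrightarrow>
      (\<forall>j. real (m j) \<ge> C * log q (n1 j) * log q (log q (n1 j))) \<longrightarrow>
      filterlim (\<lambda>j. real (m j) - real p * (log q (n2 j) - log q (log q (n2 j))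
                        + 2 * real k * log q (log q (n1 j)))) at_top sequentially \<longrightarrow>
      (\<forall>j. squarefree (g j) \<and> degree (g j) \<le> k \<and> deg_t (g j) \<le> n1 j) \<longrightarrow>
      (\<forall>j. degree (N j) = n2 j) \<longrightarrow>
      (\<exists>\<epsilon> :: nat \<Rightarrow> real. \<epsilon> \<longlonglongrightarrow> 0 \<and>
         (\<forall>j. real (card {b \<in> short_interval (N j) (m j). squarefree (poly (g j) b)})
                = c_const (g j) * real q ^ m j * (1 + \<epsilon> j)))"
proof -
  have q: "q = CARD('a)" and char: "CHAR('a) = p"
    using assms CHAR_eq_of_card[of p e] by simp_all
  have q2: "real q \<ge> 2" using card_finite_field_gt_1[where 'a='a] unfolding q by simp
  have lnq: "ln (real q) > 0" using q2 by simp
  have p0: "p > 0" using assms(1) prime_gt_0_nat by blast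
  \<comment> \<open>Chosen so that \<open>(6 * k * ln L) * (2 * ((2 + 4 * k) * L))\<close>, the
    bound for \<open>r * (2 * w)\<close> when \<open>L\<close> is large, equals
    \<open>C * L * log q L\<close>.\<close>
  define C where "C = 12 * real k * (2 + 4 * real k) * ln (real q)"
  define K where "K = error_const p k / euler_product_const TYPE('a) k"
  have C0: "C > 0" unfolding C_def using assms(4) lnq by (intro mult_pos_pos) auto
  have K0: "K > 0"
    unfolding K_def using error_const_pos euler_product_const_pos[OF assms(4)] by (intro divide_pos_pos)
  show ?thesis
  proof (intro exI[of _ C] conjI allI impI C0)
    fix m n1 n2 :: "nat \<Rightarrow> nat" and g :: "nat \<Rightarrow> 'a poly poly" and N :: "nat \<Rightarrow> 'a poly"
    assume A1: "\<forall>j. m j > 0 \<and> n1 j \<ge> q \<and> n2 j \<ge> q"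
      and A2: "\<forall>j. real (m j) \<ge> C * log q (n1 j) * log q (log q (n1 j))"
      and A3: "filterlim (\<lambda>j. real (m j) - real p * (log q (n2 j) - log q (log q (n2 j))
                        + 2 * real k * log q (log q (n1 j)))) at_top sequentially"
      and A4: "\<forall>j. squarefree (g j) \<and> degree (g j) \<le> k \<and> deg_t (g j) \<le> n1 j"
      and A5: "\<forall>j. degree (N j) = n2 j"
    define cnt where "cnt = (\<lambda>j. real (card {b \<in> short_interval (N j) (m j). squarefree (poly (g j) b)}))"
    \<comment> \<open>Where \<open>c_const (g j) = 0\<close> the count is \<open>0\<close> too, so
      the value is free and \<open>0\<close> keeps the sequence null.\<close>
    define \<epsilon> where "\<epsilon> = (\<lambda>j. if c_const (g j) = 0 then 0 else cnt j / (c_const (g j) * real q ^ m j) - 1)"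
    have gn: "degree (coeff (g j) i) \<le> n1 j" for i j
      using A4 deg_t_le_iff by blast
    have L1: "log q (n1 j) \<ge> 1" "log q (n2 j) \<ge> 1" for j
    proof -
      have "real q \<le> real (n1 j)" "real q \<le> real (n2 j)" using A1 by simp_all
      then show "log q (n1 j) \<ge> 1" "log q (n2 j) \<ge> 1" using q2 by (simp_all add: le_log_iff)
    qed
    have x1: "sq_density (g j) P \<noteq> 1" if "c_const (g j) \<noteq> 0" "P \<in> monic_irreducibles" for j P
      using c_const_eq_0 that by blast
    have cpos: "c_const (g j) > 0" if "c_const (g j) \<noteq> 0" for j
    proof -
      have "0 < euler_product_const TYPE('a) k * exp (- (2 * real k * ln (log (real CARD('a)) (real (n1 j)))))"
        using euler_product_const_pos[OF assms(4)] by (intro mult_pos_pos) auto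
      also have "\<dots> \<le> c_const (g j)"
        using A1 A4 gn x1[OF that] q assms(4) by (intro c_const_lower_bound) auto
      finally show ?thesis .
    qed
    have cnt: "cnt j = c_const (g j) * real q ^ m j * (1 + \<epsilon> j)" for j
    proof (cases "c_const (g j) = 0")
      case False
      then show ?thesis using q2 by (simp add: \<epsilon>_def)
    next
      case True
      \<comment> \<open>Without a vanishing factor the lower bound would make
        \<open>c_const (g j)\<close> positive; with one, some \<open>P ^ 2\<close> divides every
        value.\<close>
      have "\<exists>P\<in>monic_irreducibles. sq_density (g j) P = 1"
      proof (rule ccontr)
        assume "\<not> ?thesis"
        then have "euler_product_const TYPE('a) k *
            exp (- (2 * real k * ln (log (real CARD('a)) (real (n1 j))))) \<le> c_const (g j)"
          using A1 A4 gn q assms(4) by (intro c_const_lower_bound) auto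
        moreover have "0 < euler_product_const TYPE('a) k *
            exp (- (2 * real k * ln (log (real CARD('a)) (real (n1 j)))))"
          using euler_product_const_pos[OF assms(4)] by (intro mult_pos_pos) auto
        ultimately show False using True by linarith
      qed
      then have "{b \<in> short_interval (N j) (m j). squarefree (poly (g j) b)} = {}"
        using not_squarefree_if_sq_density_1 by blast
      then show ?thesis using True by (simp only: cnt_def) simp
    qed
    have "\<epsilon> \<longlonglongrightarrow> 0"
      unfolding tendsto_iff
    proof (intro allI impI)
      fix \<delta> :: real
      assume \<delta>: "\<delta> > 0"
      \<comment> \<open>\<open>B \<ge> p\<close> is what \<open>squarefree_values_error\<close> asks
        for; the other term makes the relative error \<open>K * exp (- B / 2)\<close> smaller than
        \<open>\<delta>\<close>.\<close>
      define B where "B = max (real p) (2 * ln (K / \<delta>) + 1)"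
      have Bp: "B \<ge> real p" and B1: "B \<ge> 2 * ln (K / \<delta>) + 1" by (simp_all add: B_def)
      have B0: "B \<ge> 0" using Bp by linarith
      have KB: "K * exp (- B / 2) < \<delta>"
      proof -
        have "exp (- B / 2) < exp (- ln (K / \<delta>))" using B1 by simp
        also have "\<dots> = \<delta> / K" using K0 \<delta> by (simp add: exp_minus)
        finally show ?thesis using K0 by (simp add: field_simps)
      qed
      \<comment> \<open>\<open>T0\<close> bounds \<open>r * (2 * w)\<close> as long as
        \<open>ln L < B + 1\<close>; the threshold \<open>T\<close> also contains
        \<open>p * B\<close>, which yields the slack \<open>B\<close> in the condition on
        \<open>m / p\<close>.\<close>
      define T0 where "T0 = 2 * (5 * real k * (B + 1) + B + 1) * ((1 + 4 * real k) * exp (B + 1) + B + 1)"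
      define T where "T = max (real p * B) T0"
      have "eventually (\<lambda>j. T \<le> real (m j) - real p * (log q (n2 j) - log q (log q (n2 j))
                        + 2 * real k * log q (log q (n1 j)))) sequentially"
        using A3 by (simp add: filterlim_at_top)
      then show "eventually (\<lambda>j. dist (\<epsilon> j) 0 < \<delta>) sequentially"
      proof (rule eventually_mono)
        fix j
        define L where "L = log q (n1 j)"
        define M where "M = log q (n2 j)"
        assume "T \<le> real (m j) - real p * (log q (n2 j) - log q (log q (n2 j))
                        + 2 * real k * log q (log q (n1 j)))"
        then have T: "T \<le> real (m j) - real p * (M - log q M + 2 * real k * log q L)"
          by (simp add: L_def M_def)
        have L: "L \<ge> 1" and M: "M \<ge> 1" using L1 by (simp_all add: L_def M_def)
        have lnL: "ln L \<ge> 0" "ln L \<le> L" using L ln_le_half[of L] by auto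
        have lnL_eq: "ln L = ln q * log q L" using q2 by (simp add: log_def)
        have logL: "log q L \<ge> 0" using L q2 by simp
        have "M / 4 \<le> M - log q M"
          by (rule interval_centre_degree_term_le(1)[of "real q" L M B k "nat \<lceil>M - log q M + 2 * real k * log q L + B\<rceil>"])
            (use q2 L M B0 in \<open>auto intro: real_nat_ceiling_ge\<close>)
        \<comment> \<open>The subtracted bracket is nonnegative, so \<open>T\<close> bounds
          \<open>m j\<close> itself from below.\<close>
        then have br: "0 \<le> M - log q M + 2 * real k * log q L" using M logL by (simp add: add_nonneg_nonneg)
        then have mT: "real (m j) \<ge> T" using T mult_nonneg_nonneg[OF _ br, of "real p"] by linarith
        have "real p * (M - log q M + 2 * real k * log q L + B) \<le> real (m j)"
          using T by (simp add: T_def algebra_simps)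
        then have mp: "M - log q M + 2 * real k * log q L + B \<le> real (m j) / real p"
          using p0 by (simp only: pos_le_divide_eq of_nat_0_less_iff mult.commute)
        define w where "w = nat \<lceil>(1 + 4 * real k) * L + B\<rceil>"
        define r where "r = nat \<lceil>5 * real k * ln L + B\<rceil>"
        have "0 \<le> (1 + 4 * real k) * L + B" "0 \<le> 5 * real k * ln L + B"
          using L lnL B0 by (auto intro!: add_nonneg_nonneg)
        then have w: "(1 + 4 * real k) * L + B \<le> real w" "real w \<le> (1 + 4 * real k) * L + B + 1"
          and r: "5 * real k * ln L + B \<le> real r" "real r \<le> 5 * real k * ln L + B + 1"
          unfolding w_def r_def by linarith+
        have "real r * (2 * real w) \<le> (5 * real k * ln L + B + 1) * (2 * ((1 + 4 * real k) * L + B + 1))"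
          using w r by (intro mult_mono) auto
        \<comment> \<open>Two regimes: large \<open>L\<close> is covered by the first growth
          hypothesis on \<open>m\<close>, bounded \<open>L\<close> by the divergence in the second
          one, through \<open>T0\<close>.\<close>
        also have "\<dots> \<le> real (m j)"
        proof (cases "ln L \<ge> B + 1")
          case True
          have k1: "real k \<ge> 1" using assms(4) by simp
          have "B + 1 \<le> real k * ln L" using True k1 lnL mult_right_mono[of 1 "real k" "ln L"] by linarith
          then have a: "5 * real k * ln L + B + 1 \<le> 6 * real k * ln L" by simp
          have b: "(1 + 4 * real k) * L + B + 1 \<le> (2 + 4 * real k) * L"
            using True lnL by (simp add: algebra_simps)
          have "(5 * real k * ln L + B + 1) * (2 * ((1 + 4 * real k) * L + B + 1)) \<le>
              (6 * real k * ln L) * (2 * ((2 + 4 * real k) * L))"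
            using a b L lnL B0 by (intro mult_mono) (auto intro!: add_nonneg_nonneg)
          also have "\<dots> = C * L * log q L" unfolding C_def lnL_eq by (simp add: algebra_simps)
          also have "\<dots> \<le> real (m j)" using A2 by (simp add: L_def)
          finally show ?thesis .
        next
          case False
          then have a: "5 * real k * ln L + B + 1 \<le> 5 * real k * (B + 1) + B + 1"
            using mult_left_mono[of "ln L" "B + 1" "5 * real k"] by simp
          have "L = exp (ln L)" using L by simp
          also have "\<dots> \<le> exp (B + 1)" using False by simp
          finally have "(1 + 4 * real k) * L \<le> (1 + 4 * real k) * exp (B + 1)"
            by (rule mult_left_mono) simp
          then have b: "(1 + 4 * real k) * L + B + 1 \<le> (1 + 4 * real k) * exp (B + 1) + B + 1" by simp
          have "(5 * real k * ln L + B + 1) * (2 * ((1 + 4 * real k) * L + B + 1)) \<le>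
              (5 * real k * (B + 1) + B + 1) * (2 * ((1 + 4 * real k) * exp (B + 1) + B + 1))"
            using a b L lnL B0 by (intro mult_mono) (auto intro!: add_nonneg_nonneg)
          also have "\<dots> = T0" unfolding T0_def by (simp only: mult_ac)
          also have "\<dots> \<le> real (m j)" using mT by (simp add: T_def)
          finally show ?thesis .
        qed
        finally have "real (r * (2 * w)) \<le> real (m j)" by simp
        then have wr: "r * (2 * w) \<le> m j" by (simp only: of_nat_le_iff)
        show "dist (\<epsilon> j) 0 < \<delta>"
        proof (cases "c_const (g j) = 0")
          case True
          then show ?thesis using \<delta> by (simp add: \<epsilon>_def)
        next
          case False
          have cq: "c_const (g j) * real q ^ m j > 0" using cpos[OF False] q2 by simp
          have "\<bar>cnt j - c_const (g j) * real q ^ m j\<bar> \<le>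
              K * exp (- B / 2) * (c_const (g j) * real q ^ m j)"
            unfolding cnt_def K_def q char[symmetric]
            using A1 A4 A5 gn x1[OF False] Bp w(1) r(1) wr mp assms(4)
            by (intro squarefree_values_error[where ?n1.0 = "n1 j" and ?n2.0 = "n2 j" and w = w and r = r])
              (auto simp: L_def M_def q char)
          also have "cnt j - c_const (g j) * real q ^ m j = c_const (g j) * real q ^ m j * \<epsilon> j"
            unfolding cnt by (simp add: algebra_simps)
          also have "\<bar>c_const (g j) * real q ^ m j * \<epsilon> j\<bar> = c_const (g j) * real q ^ m j * \<bar>\<epsilon> j\<bar>"
            by (simp only: abs_mult[of "c_const (g j) * real q ^ m j"] abs_of_pos[OF cq])
          also have "K * exp (- B / 2) * (c_const (g j) * real q ^ m j) =
              c_const (g j) * real q ^ m j * (K * exp (- B / 2))" by (rule mult.commute)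
          finally have "c_const (g j) * real q ^ m j * \<bar>\<epsilon> j\<bar> \<le>
              c_const (g j) * real q ^ m j * (K * exp (- B / 2))" .
          then have "\<bar>\<epsilon> j\<bar> \<le> K * exp (- B / 2)" using cq by (simp only: mult_le_cancel_left_pos)
          with KB show ?thesis by (simp add: dist_real_def)
        qed
      qed
    qed
    with cnt show "\<exists>\<epsilon> :: nat \<Rightarrow> real. \<epsilon> \<longlonglongrightarrow> 0 \<and>
        (\<forall>j. real (card {b \<in> short_interval (N j) (m j). squarefree (poly (g j) b)})
                = c_const (g j) * real q ^ m j * (1 + \<epsilon> j))"
      unfolding cnt_def by blast
  qed
qed

end
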